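(* Let $F$ be a graph and let $s,t$ be positive integers with $t\ge\max\{|E(F)|,s+1\}$. (i) If $F$ is not bipartite and $n$ is sufficiently large, then $\mathrm{ex}_t(n,\{F,M_{s+1}\})=s(n-s)+\mathrm{ex}_t(s,\mathcal{F}(F))$. (ii) If $F$ is bipartite and $p(F)>s$, then $\mathrm{ex}_t(n,\{F,M_{s+1}\})=s(n-s)+\mathrm{ex}_t(s,\mathcal{F}[s])$. (iii) If $F$ is bipartite, $p=p(F)\le s$ and $t$ is sufficiently large, then $\mathrm{ex}_t(n,\{F,M_{s+1}\})=(p-1)n+O(1)$. (iv) Assume that $F$ is a balanced tree, i.e., $|V(F)|=2p(F)$, and that the Erdős–Sós conjecture holds for $F$. If $p=p(F)\le s$ and $t$ is sufficiently large, then for sufficiently large $n$ we have $\mathrm{ex}_t(n,\{F,M_{s+1}\})=(p-1)(n-p+1)+\mathrm{ex}_t(p-1,\mathcal{F}[p-1])$.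
   Context: All graphs are finite and simple. $M_k$ denotes the matching with $k$ edges, and $K_k$ the complete graph on $k$ vertices. A collection $(G_1,\dots,G_t)$ consists of graphs on the same vertex set $V$; it is "on $n$ vertices" if $|V|=n$; the indices $1,\dots,t$ are called colors. A subgraph of the union of the $G_i$ is rainbow if for each edge $uv$ of it one can choose an index $i$ with $uv\in E(G_i)$ so that each $i$ is chosen at most once. For a family $\mathcal{H}$ of graphs, the collection is rainbow $\mathcal{H}$-free if there is no rainbow copy (as a not necessarily induced subgraph) of any member of $\mathcal{H}$. $\mathrm{ex}_t(n,\mathcal{H})$ denotes the largest integer $e$ such that there is a rainbow $\mathcal{H}$-free collection $(G_1,\dots,G_t)$ on $n$ vertices in which each $G_i$ has at least $e$ edges. $\mathcal{F}(F)$ denotes the family of graphs obtained from $F$ by deleting an independent set (of vertices). For an integer $p$, define $\mathcal{F}[p]=\{K_{p+1}\}$ if $F$ has no covering (vertex cover) of size at most $p$; otherwise $\mathcal{F}[p]=\{F[S] : S \text{ is a covering of } F \text{ with } |S|\le p\}$, where $F[S]$ is the induced subgraph. For a bipartite graph $F$, $p(F)$ denotes the smallest possible order of a color class in a proper two-coloring of $F$. The Erdős–Sós conjecture for a tree $T$ on $k$ vertices is the statement that $\mathrm{ex}(n,T)\le (k-2)n/2$, where $\mathrm{ex}(n,T)$ is the largest number of edges in an $n$-vertex graph not containing $T$ as a subgraph. "$n$ sufficiently large" means larger than a bound depending on $F,s,t$; "$t$ sufficiently large" means larger than a bound depending on $F,s$; $O(1)$ is as $n\to\infty$ with $F,s,t$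 fixed.
   Formalization: Part (ii) is stated for n sufficiently large, since it fails at n = 2s+1 (complete graphs in all colors); part (iii) assumes that F has at least one edge, since otherwise p(F) = 0 and ex_t is undefined for large n. *)

theory Defs
  imports Complex_Main "HOL-Library.Landau_Symbols"
begin

text \<open>Vertices are natural numbers. This is no restriction, since all graphs are finite and every
  notion below is invariant under isomorphism; it lets graphs of different origin (such as
  \<open>F\<close> and \<open>M\<^sub>k\<close>) belong to one family.\<close>

record graph =
  verts :: "nat set"
  edges :: "nat set set"

definition simple_graph :: "graph \<Rightarrow> bool" where
  "simple_graph G \<longleftrightarrow> finite (verts G) \<and> (\<forall>e\<in>edges G. e \<subseteq> verts G \<and> card e = 2)"

definition subgraph :: "graph \<Rightarrow> graph \<Rightarrow> bool" where
  "subgraph H G \<longleftrightarrow> simple_graph H \<and> verts H \<subseteq> verts G \<and> edges H \<subseteq> edges G"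

definition isomorphic :: "graph \<Rightarrow> graph \<Rightarrow> bool" where
  "isomorphic H R \<longleftrightarrow> (\<exists>f. bij_betw f (verts H) (verts R) \<and> (\<lambda>e. f ` e) ` edges H = edges R)"

definition contains_copy :: "graph \<Rightarrow> graph \<Rightarrow> bool" where
  "contains_copy G H \<longleftrightarrow> (\<exists>R. subgraph R G \<and> isomorphic H R)"

definition induced :: "graph \<Rightarrow> nat set \<Rightarrow> graph" where
  "induced G S = \<lparr>verts = S, edges = {e \<in> edges G. e \<subseteq> S}\<rparr>"

definition complete_graph :: "nat \<Rightarrow> graph" where
  "complete_graph k = \<lparr>verts = {..<k}, edges = {e. e \<subseteq> {..<k} \<and> card e = 2}\<rparr>"

definition matching_graph :: "nat \<Rightarrow> graph" where
  "matching_graph k = \<lparr>verts = {..<2 * k}, edges = {{2 * i, 2 * i + 1} | i. i < k}\<rparr>"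

definition cycle_graph :: "nat \<Rightarrow> graph" where
  "cycle_graph k = \<lparr>verts = {..<k}, edges = {{i, Suc i mod k} | i. i < k}\<rparr>"


definition independent_set :: "graph \<Rightarrow> nat set \<Rightarrow> bool" where
  "independent_set G I \<longleftrightarrow> I \<subseteq> verts G \<and> (\<forall>e\<in>edges G. \<not> e \<subseteq> I)"

definition covering :: "graph \<Rightarrow> nat set \<Rightarrow> bool" where
  "covering G S \<longleftrightarrow> S \<subseteq> verts G \<and> (\<forall>e\<in>edges G. e \<inter> S \<noteq> {})"

definition two_coloring :: "graph \<Rightarrow> nat set \<Rightarrow> nat set \<Rightarrow> bool" where
  "two_coloring G A B \<longleftrightarrow>
     A \<union> B = verts G \<and> A \<inter> B = {} \<and> independent_set G A \<and> independent_set G B"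

definition bipartite :: "graph \<Rightarrow> bool" where
  "bipartite G \<longleftrightarrow> (\<exists>A B. two_coloring G A B)"

text \<open>\<open>p(F)\<close>, meaningful for bipartite graphs only. Considering the first class suffices because
  \<open>two_coloring\<close> is symmetric in the two classes.\<close>

definition min_class :: "graph \<Rightarrow> nat" where
  "min_class G = (LEAST k. \<exists>A B. two_coloring G A B \<and> card A = k)"

definition connected_graph :: "graph \<Rightarrow> bool" where
  "connected_graph G \<longleftrightarrow> verts G \<noteq> {} \<and>
     (\<forall>u\<in>verts G. \<forall>v\<in>verts G. (u, v) \<in> {(x, y). {x, y} \<in> edges G}\<^sup>*)"

definition tree :: "graph \<Rightarrow> bool" where
  "tree G \<longleftrightarrow> simple_graph G \<and> connected_graph G \<and> (\<forall>k\<ge>3. \<not> contains_copy G (cycle_graph k))"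

definition ex :: "nat \<Rightarrow> graph \<Rightarrow> nat" where
  "ex n H = (GREATEST m. \<exists>G. simple_graph G \<and> card (verts G) = n \<and>
     \<not> contains_copy G H \<and> card (edges G) = m)"

definition Erdos_Sos :: "graph \<Rightarrow> bool" where
  "Erdos_Sos T \<longleftrightarrow> (\<forall>n. real (ex n T) \<le> (real (card (verts T)) - 2) * real n / 2)"


text \<open>A collection \<open>(G\<^sub>1, \<dots>, G\<^sub>t)\<close> is a function on the colors \<open>{1..t}\<close>.\<close>

definition collection :: "nat set \<Rightarrow> nat \<Rightarrow> (nat \<Rightarrow> graph) \<Rightarrow> bool" where
  "collection V t G \<longleftrightarrow> finite V \<and> (\<forall>i\<in>{1..t}. simple_graph (G i) \<and> verts (G i) = V)"

definition union_graph :: "nat set \<Rightarrow> nat \<Rightarrow> (nat \<Rightarrow> graph) \<Rightarrow> graph" where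
  "union_graph V t G = \<lparr>verts = V, edges = (\<Union>i\<in>{1..t}. edges (G i))\<rparr>"

definition rainbow :: "nat \<Rightarrow> (nat \<Rightarrow> graph) \<Rightarrow> graph \<Rightarrow> bool" where
  "rainbow t G R \<longleftrightarrow>
     (\<exists>c. inj_on c (edges R) \<and> (\<forall>e\<in>edges R. c e \<in> {1..t} \<and> e \<in> edges (G (c e))))"

definition rainbow_free :: "nat set \<Rightarrow> nat \<Rightarrow> (nat \<Rightarrow> graph) \<Rightarrow> graph set \<Rightarrow> bool" where
  "rainbow_free V t G \<H> \<longleftrightarrow>
     \<not> (\<exists>H\<in>\<H>. \<exists>R. subgraph R (union_graph V t G) \<and> isomorphic H R \<and> rainbow t G R)"

text \<open>\<open>ex\<^sub>t(n, \<H>)\<close>. The maximum exists if \<open>t > 0\<close> and every member of \<open>\<H>\<close> has an edge or more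
  than \<open>n\<close> vertices.\<close>

definition ex_rainbow :: "nat \<Rightarrow> nat \<Rightarrow> graph set \<Rightarrow> int" where
  "ex_rainbow t n \<H> = (GREATEST e. \<exists>V G. collection V t G \<and> card V = n \<and>
     rainbow_free V t G \<H> \<and> (\<forall>i\<in>{1..t}. e \<le> int (card (edges (G i)))))"

text \<open>\<open>\<F>(F)\<close> and \<open>\<F>[p]\<close>.\<close>

definition indep_deletions :: "graph \<Rightarrow> graph set" where
  "indep_deletions F = {induced F (verts F - I) | I. independent_set F I}"

definition cover_family :: "graph \<Rightarrow> nat \<Rightarrow> graph set" where
  "cover_family F p =
     (if \<nexists>S. covering F S \<and> card S \<le> p then {complete_graph (p + 1)}
      else {induced F S | S. covering F S \<and> card S \<le> p})"

end

theory Submission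
  imports Defs
begin

text \<open>
  Two thresholds decide what a collection without a rainbow matching of size \<open>s + 1\<close> looks like. Call a
  colour flexible if its edges cannot be covered by \<open>2 * s\<close> vertices: such a colour can always supply the
  last edge of a rainbow matching. A colour that is not flexible has, apart from boundedly many
  edges, only edges at vertices of high degree, and vertices of high degree can be matched in any
  order. So rainbow matchings correspond to systems of distinct representatives for the sets of
  high-degree vertices, and their absence bounds these sets.

  In all exact cases the lower bound comes from a join: \<open>k\<close> vertices, in every colour joined to all other
  vertices, with an extremal collection inside. A rainbow copy of \<open>F\<close> meets the \<open>k\<close> vertices
  in a covering of \<open>F\<close>, so what must be avoided inside is \<open>F\<close> minus an independent set
  (\<open>join_attainable\<close>). The family \<open>cover_family F k\<close> amounts to the same on \<open>k\<close> vertices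
  (\<open>ex_rainbow_cover_family\<close>).

  If \<open>F\<close> has no colour class of size at most \<open>s\<close>, in particular if \<open>F\<close> is not bipartite, then \<open>k = s\<close>
  is possible, and every colour of an optimal collection has so many edges that the sets of
  high-degree vertices all coincide with one set of size \<open>s\<close> that meets every edge
  (\<open>common_cover\<close>). Almost all other vertices are joined to this set in every colour, so a forbidden
  rainbow graph inside it extends to \<open>F\<close> (\<open>cover_graph_upper\<close>).

  If \<open>F\<close> is bipartite with smaller class of size \<open>p \<le> s\<close>, then all but \<open>2 * s\<close> colours have their
  high-degree vertices in a common set \<open>W\<close> of at most \<open>s\<close> vertices (\<open>common_high_vertices\<close>). A
  collection with more than \<open>(p - 1) * n + O(1)\<close> edges per colour has vertices outside \<open>W\<close> with
  \<open>p\<close> neighbours in \<open>W\<close>, where \<open>p - 1\<close> of the edges have many colours. The remaining edge may have a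
  single colour, but by discarding colours one finds many such vertices with different
  single colours, and they carry a rainbow complete bipartite graph (\<open>bipartite_upper\<close>).

  For a balanced tree the additive constant is determined by passing to one graph: the edges with
  at least \<open>card (edges F)\<close> colours. It contains no copy of \<open>F\<close>, and since the other edges live on a
  bounded vertex set, averaging over many colours shows that it has as many edges as the smallest
  colour (\<open>many_robust_edges\<close>). In this graph \<open>p - 1\<close> vertices are joined to a large set; a
  vertex outside them that has a neighbour among them has degree at most \<open>p - 1\<close>, and the Erdos-Sos
  bound controls the rest (\<open>erdos_sos_bound\<close>).
\<close>

section \<open>Rainbow copies as injective maps\<close>

definition edges_on :: "nat set \<Rightarrow> nat set set \<Rightarrow> bool" where
  "edges_on V X \<longleftrightarrow> (\<forall>e\<in>X. e \<subseteq> V \<and> card e = 2)"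

text \<open>A rainbow copy of a graph with edge set \<open>X\<close> is an injective vertex map \<open>f\<close> with this property.
  The colour classes form an arbitrary family \<open>E\<close> over an arbitrary colour set \<open>T\<close>, because the
  proofs pass to subsets of the colours.\<close>

definition rainbow_map ::
  "nat set \<Rightarrow> (nat \<Rightarrow> nat set set) \<Rightarrow> nat set set \<Rightarrow> (nat \<Rightarrow> nat) \<Rightarrow> bool" where
  "rainbow_map T E X f \<longleftrightarrow> (\<exists>c. inj_on c X \<and> (\<forall>e\<in>X. c e \<in> T \<and> f ` e \<in> E (c e)))"

lemma simple_graph_edges_on:
  "simple_graph G \<longleftrightarrow> finite (verts G) \<and> edges_on (verts G) (edges G)"
  by (auto simp: simple_graph_def edges_on_def)

lemma finite_edges_on: "edges_on V X \<Longrightarrow> finite V \<Longrightarrow> finite X"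
  by (rule finite_subset[of _ "Pow V"]) (auto simp: edges_on_def)

lemma card_edges_on_le: "edges_on V X \<Longrightarrow> finite V \<Longrightarrow> card X \<le> 2 ^ card V"
  by (rule order_trans[OF card_mono[of "Pow V"]]) (auto simp: edges_on_def card_Pow)

lemma edges_on_subset: "edges_on V X \<Longrightarrow> Y \<subseteq> X \<Longrightarrow> edges_on V Y"
  by (auto simp: edges_on_def)

lemma edges_onE:
  assumes "edges_on V X" "e \<in> X"
  obtains a b where "e = {a, b}" "a \<noteq> b" "a \<in> V" "b \<in> V"
  using assms by (auto simp: edges_on_def card_2_iff)

lemma edges_on_inj_image:
  assumes "edges_on V X" "inj_on f V"
  shows "inj_on ((`) f) X"
  by (rule inj_onI) (use assms in \<open>auto simp: edges_on_def inj_on_image_eq_iff\<close>)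

lemma edges_on_image:
  assumes "edges_on V X" "inj_on f V"
  shows "edges_on (f ` V) ((`) f ` X)"
proof -
  have "card (f ` e) = 2" if "e \<in> X" for e
    using assms that card_image[of f e] inj_on_subset[of f V e] by (auto simp: edges_on_def)
  then show ?thesis using assms by (auto simp: edges_on_def)
qed

text \<open>Vertex maps are easier to build and to extend than subgraphs with an isomorphism and an edge
  colouring, so all embedding arguments below speak of maps.\<close>

lemma rainbow_copy_iff:
  assumes H: "simple_graph H" and G: "collection V t G"
  shows "(\<exists>R. subgraph R (union_graph V t G) \<and> isomorphic H R \<and> rainbow t G R) \<longleftrightarrow>
    (\<exists>f. inj_on f (verts H) \<and> f ` verts H \<subseteq> V \<and> rainbow_map {1..t} (\<lambda>i. edges (G i)) (edges H) f)"
    (is "?L \<longleftrightarrow> ?R")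
proof
  assume ?L
  then obtain R f c where R: "subgraph R (union_graph V t G)"
    and f: "bij_betw f (verts H) (verts R)" "(\<lambda>e. f ` e) ` edges H = edges R"
    and c: "inj_on c (edges R)" "\<forall>e\<in>edges R. c e \<in> {1..t} \<and> e \<in> edges (G (c e))"
    unfolding isomorphic_def rainbow_def by blast
  have inj: "inj_on f (verts H)" using f(1) by (simp add: bij_betw_def)
  have im: "f ` verts H \<subseteq> V"
    using f(1) R by (auto simp: bij_betw_def subgraph_def union_graph_def)
  have "inj_on (c \<circ> (`) f) (edges H)"
    using c(1) f(2) edges_on_inj_image[of "verts H" "edges H" f] inj H
    by (intro comp_inj_on) (auto simp: simple_graph_edges_on)
  moreover have "\<forall>e\<in>edges H. (c \<circ> (`) f) e \<in> {1..t} \<and> f ` e \<in> edges (G ((c \<circ> (`) f) e))"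
    using c(2) f(2) by auto
  ultimately show ?R unfolding rainbow_map_def using inj im by blast
next
  assume ?R
  then obtain f c where inj: "inj_on f (verts H)" and im: "f ` verts H \<subseteq> V"
    and c: "inj_on c (edges H)" "\<forall>e\<in>edges H. c e \<in> {1..t} \<and> f ` e \<in> edges (G (c e))"
    unfolding rainbow_map_def by blast
  let ?R = "\<lparr>verts = f ` verts H, edges = (`) f ` edges H\<rparr>"
  let ?c = "c \<circ> inv_into (edges H) ((`) f)"
  have EH: "edges_on (verts H) (edges H)" "finite (verts H)"
    using H by (auto simp: simple_graph_edges_on)
  have ii: "inj_on ((`) f) (edges H)" using edges_on_inj_image[OF EH(1) inj] .
  have "subgraph ?R (union_graph V t G)"
    using edges_on_image[OF EH(1) inj] EH im c(2)
    by (fastforce simp: subgraph_def union_graph_def simple_graph_edges_on)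
  moreover have "isomorphic H ?R"
    using inj by (auto simp: isomorphic_def bij_betw_def intro!: exI[of _ f])
  moreover have "rainbow t G ?R"
    unfolding rainbow_def
  proof (intro exI[of _ ?c] conjI ballI)
    show "inj_on ?c (edges ?R)"
      using c(1) ii by (auto simp: inj_on_def)
  qed (use c(2) ii in auto)
  ultimately show ?L by blast
qed

lemma rainbow_free_iff:
  assumes "\<forall>H\<in>\<H>. simple_graph H" "collection V t G"
  shows "rainbow_free V t G \<H> \<longleftrightarrow>
    (\<forall>H\<in>\<H>. \<forall>f. inj_on f (verts H) \<longrightarrow> f ` verts H \<subseteq> V \<longrightarrow>
        \<not> rainbow_map {1..t} (\<lambda>i. edges (G i)) (edges H) f)"
  unfolding rainbow_free_def
  by (simp add: rainbow_copy_iff[OF _ assms(2)] assms(1) cong: bex_cong del: atLeastAtMost_iff)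
    blast

lemma contains_copy_iff:
  assumes H: "simple_graph H"
  shows "contains_copy G H \<longleftrightarrow>
    (\<exists>f. inj_on f (verts H) \<and> f ` verts H \<subseteq> verts G \<and> (\<forall>e\<in>edges H. f ` e \<in> edges G))"
    (is "?L \<longleftrightarrow> ?R")
proof
  assume ?L
  then show ?R
    by (fastforce simp: contains_copy_def subgraph_def isomorphic_def bij_betw_def)
next
  assume ?R
  then obtain f where inj: "inj_on f (verts H)" and im: "f ` verts H \<subseteq> verts G"
    and e: "\<forall>e\<in>edges H. f ` e \<in> edges G" by blast
  let ?R = "\<lparr>verts = f ` verts H, edges = (`) f ` edges H\<rparr>"
  have "subgraph ?R G"
    using edges_on_image[of "verts H" "edges H" f] inj H im e
    by (auto simp: subgraph_def simple_graph_edges_on)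
  moreover have "isomorphic H ?R"
    using inj by (auto simp: isomorphic_def bij_betw_def intro!: exI[of _ f])
  ultimately show ?L by (auto simp: contains_copy_def)
qed

section \<open>The extremal number as a maximum\<close>

text \<open>\<open>ex_rainbow\<close> is the greatest attainable number.\<close>

definition attainable :: "nat \<Rightarrow> nat \<Rightarrow> graph set \<Rightarrow> int \<Rightarrow> bool" where
  "attainable t n \<H> e \<longleftrightarrow> (\<exists>V G. collection V t G \<and> card V = n \<and>
     rainbow_free V t G \<H> \<and> (\<forall>i\<in>{1..t}. e \<le> int (card (edges (G i)))))"

lemma ex_rainbow_eqI:
  assumes "attainable t n \<H> e" "\<And>e'. attainable t n \<H> e' \<Longrightarrow> e' \<le> e"
  shows "ex_rainbow t n \<H> = e"
  unfolding ex_rainbow_def attainable_def[symmetric] using assms by (intro Greatest_equality) auto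

lemma attainable_bounded:
  assumes "t > 0" "attainable t n \<H> e"
  shows "e \<le> 2 ^ n"
proof -
  obtain V G where G: "collection V t G" "card V = n"
      "\<forall>i\<in>{1..t}. e \<le> int (card (edges (G i)))"
    using assms(2) unfolding attainable_def by blast
  have "1 \<in> {1..t}" using assms(1) by auto
  then have "e \<le> int (card (edges (G 1)))" "edges_on V (edges (G 1))" "finite V"
    using G by (auto simp: collection_def simple_graph_edges_on)
  then show ?thesis using card_edges_on_le[of V "edges (G 1)"] G(2)
    by (metis of_nat_le_iff of_nat_numeral of_nat_power order_trans)
qed

text \<open>\<open>ex_rainbow\<close> is a greatest element among the integers, which is meaningful only if that element
  exists: a graph on \<open>n\<close> vertices has at most \<open>2 ^ n\<close> edges, so one attainable value suffices.\<close>

lemma ex_rainbow_greatest: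
  assumes t: "t > 0" and e0: "attainable t n \<H> e0"
  shows "attainable t n \<H> (ex_rainbow t n \<H>)"
    and "attainable t n \<H> e \<Longrightarrow> e \<le> ex_rainbow t n \<H>"
proof -
  let ?A = "{e. e0 \<le> e \<and> attainable t n \<H> e}"
  have fin: "finite ?A"
    by (rule finite_subset[of _ "{e0..2 ^ n}"]) (use attainable_bounded[OF t] in auto)
  have ne: "?A \<noteq> {}" using e0 by auto
  have M: "Max ?A \<in> ?A" using Max_in[OF fin ne] .
  have le: "e' \<le> Max ?A" if "attainable t n \<H> e'" for e'
  proof (cases "e0 \<le> e'")
    case True then show ?thesis using that fin by (intro Max_ge) auto
  next
    case False then show ?thesis using M by auto
  qed
  have eq: "ex_rainbow t n \<H> = Max ?A" using M le by (intro ex_rainbow_eqI) auto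
  show "attainable t n \<H> (ex_rainbow t n \<H>)" using M eq by auto
  show "e \<le> ex_rainbow t n \<H>" if "attainable t n \<H> e" using le[OF that] eq by simp
qed

text \<open>The collection of empty graphs contains no graph with an edge and none with too many vertices.\<close>

lemma attainable_zero:
  assumes "\<forall>H\<in>\<H>. simple_graph H"
    and "\<And>H. H \<in> \<H> \<Longrightarrow> edges H \<noteq> {} \<or> card (verts H) > n"
  shows "attainable t n \<H> 0"
proof -
  let ?G = "\<lambda>i::nat. \<lparr>verts = {..<n}, edges = {}\<rparr>"
  have c: "collection {..<n} t ?G" by (auto simp: collection_def simple_graph_def)
  have "rainbow_free {..<n} t ?G \<H>"
    unfolding rainbow_free_iff[OF assms(1) c]
  proof (intro ballI allI impI notI)
    fix H f assume H: "H \<in> \<H>" "inj_on f (verts H)" "f ` verts H \<subseteq> {..<n}"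
      and r: "rainbow_map {1..t} (\<lambda>i. edges (?G i)) (edges H) f"
    from r have "edges H = {}" by (auto simp: rainbow_map_def)
    with assms(2)[OF H(1)] have "card (verts H) > n" by auto
    with card_inj_on_le[OF H(2,3)] show False by auto
  qed
  then show ?thesis unfolding attainable_def using c by (intro exI[of _ "{..<n}"] exI[of _ ?G]) auto
qed

section \<open>Coverings and the graph families derived from F\<close>

lemma simple_graph_induced:
  "simple_graph F \<Longrightarrow> S \<subseteq> verts F \<Longrightarrow> simple_graph (induced F S)"
  using finite_subset[of S "verts F"] unfolding simple_graph_def induced_def by simp

lemma covering_iff_independent_compl:
  assumes "simple_graph F" "S \<subseteq> verts F"
  shows "covering F S \<longleftrightarrow> independent_set F (verts F - S)"
proof
  assume "covering F S"
  then show "independent_set F (verts F - S)"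
    unfolding covering_def independent_set_def by blast
next
  assume *: "independent_set F (verts F - S)"
  have "e \<inter> S \<noteq> {}" if "e \<in> edges F" for e
  proof
    assume "e \<inter> S = {}"
    moreover have "e \<subseteq> verts F" using that assms(1) by (simp add: simple_graph_def)
    ultimately have "e \<subseteq> verts F - S" by auto
    then show False using that * by (auto simp: independent_set_def)
  qed
  then show "covering F S" using assms(2) unfolding covering_def by blast
qed

text \<open>The complement of an independent set is a covering.\<close>

lemma indep_deletions_eq:
  assumes "simple_graph F"
  shows "indep_deletions F = {induced F S |S. covering F S}"
proof (intro equalityI subsetI)
  fix H assume "H \<in> indep_deletions F"
  then obtain I where I: "independent_set F I" "H = induced F (verts F - I)"
    by (auto simp: indep_deletions_def)
  then have "verts F - (verts F - I) = I" by (auto simp: independent_set_def)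
  then have "covering F (verts F - I)"
    using covering_iff_independent_compl[OF assms, of "verts F - I"] I by auto
  with I show "H \<in> {induced F S |S. covering F S}" by blast
next
  fix H assume "H \<in> {induced F S |S. covering F S}"
  then obtain S where S: "covering F S" "H = induced F S" by auto
  then have "S \<subseteq> verts F" by (auto simp: covering_def)
  then have "independent_set F (verts F - S)" "S = verts F - (verts F - S)"
    using S covering_iff_independent_compl[OF assms] by auto
  then show "H \<in> indep_deletions F"
    unfolding indep_deletions_def mem_Collect_eq using S(2) by (intro exI[of _ "verts F - S"]) simp
qed

lemma rainbow_free_indep_deletions_iff:
  assumes "simple_graph F" "collection V t G"
  shows "rainbow_free V t G (indep_deletions F) \<longleftrightarrow>
    (\<forall>S f. covering F S \<longrightarrow> inj_on f S \<longrightarrow> f ` S \<subseteq> V \<longrightarrow>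
      \<not> rainbow_map {1..t} (\<lambda>i. edges (G i)) (edges (induced F S)) f)"
proof -
  have sg: "\<forall>H \<in> indep_deletions F. simple_graph H"
    using simple_graph_induced[OF assms(1)]
    by (auto simp: indep_deletions_eq[OF assms(1)] covering_def)
  show ?thesis
    unfolding rainbow_free_iff[OF sg assms(2)] unfolding indep_deletions_eq[OF assms(1)]
    by (auto simp del: atLeastAtMost_iff simp: induced_def)
qed

text \<open>On \<open>k\<close> vertices only subgraphs with at most \<open>k\<close> vertices can occur. Hence the restriction to
  coverings of size at most \<open>k\<close> changes nothing, and if there is no such covering then neither
  family has a member that fits, the complete graph on \<open>k + 1\<close> vertices included. It follows that
  all exact values of the theorem can be expressed by \<open>indep_deletions\<close>.\<close>

lemma rainbow_free_cover_family_iff: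
  assumes F: "simple_graph F" and G: "collection V t G" and "card V = k"
  shows "rainbow_free V t G (cover_family F k) \<longleftrightarrow> rainbow_free V t G (indep_deletions F)"
proof -
  have fin: "finite V" using G by (auto simp: collection_def)
  have small: "card S \<le> k" if "inj_on f S" "f ` S \<subseteq> V" for f :: "nat \<Rightarrow> nat" and S
    using card_inj_on_le[OF that fin] assms(3) by simp
  show ?thesis
  proof (cases "\<exists>S. covering F S \<and> card S \<le> k")
    case True
    then have cf: "cover_family F k = {induced F S |S. covering F S \<and> card S \<le> k}"
      by (auto simp: cover_family_def)
    have sg: "\<forall>H \<in> cover_family F k. simple_graph H"
      using simple_graph_induced[OF F] by (auto simp: cf covering_def)
    have "rainbow_free V t G (cover_family F k) \<longleftrightarrow> (\<forall>S f. covering F S \<and> card S \<le> k \<longrightarrow>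
        inj_on f S \<longrightarrow> f ` S \<subseteq> V \<longrightarrow>
        \<not> rainbow_map {1..t} (\<lambda>i. edges (G i)) (edges (induced F S)) f)"
      unfolding rainbow_free_iff[OF sg G] unfolding cf
      by (auto simp del: atLeastAtMost_iff simp: induced_def)
    then show ?thesis
      unfolding rainbow_free_indep_deletions_iff[OF F G] using small by blast
  next
    case False
    then have cf: "cover_family F k = {complete_graph (k + 1)}"
      by (auto simp: cover_family_def)
    have sg: "\<forall>H \<in> cover_family F k. simple_graph H"
      by (auto simp: cf complete_graph_def simple_graph_def)
    have "\<not> f ` {..<k + 1} \<subseteq> V" if "inj_on f {..<k + 1}" for f
      using small[OF that] by auto
    then have "rainbow_free V t G (cover_family F k)"
      unfolding rainbow_free_iff[OF sg G] unfolding cf by (auto simp: complete_graph_def)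
    moreover have "rainbow_free V t G (indep_deletions F)"
      unfolding rainbow_free_indep_deletions_iff[OF F G] using False small by blast
    ultimately show ?thesis by blast
  qed
qed

lemma ex_rainbow_cover_family:
  assumes "simple_graph F"
  shows "ex_rainbow t k (cover_family F k) = ex_rainbow t k (indep_deletions F)"
  unfolding ex_rainbow_def
  by (simp cong: conj_cong add: rainbow_free_cover_family_iff[OF assms] del: atLeastAtMost_iff)

text \<open>An independent covering is a colour class of a two-coloring. The condition therefore covers the
  non-bipartite graphs and the bipartite graphs with \<open>k < min_class F\<close> at the same time.\<close>

definition indep_cover_free :: "graph \<Rightarrow> nat \<Rightarrow> bool" where
  "indep_cover_free F k \<longleftrightarrow> (\<forall>S. covering F S \<longrightarrow> card S \<le> k \<longrightarrow> \<not> independent_set F S)"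

lemma two_coloring_covering:
  assumes "simple_graph F" "covering F S" "independent_set F S"
  shows "two_coloring F S (verts F - S)"
  using assms covering_iff_independent_compl[OF assms(1), of S]
  by (auto simp: two_coloring_def covering_def)

lemma indep_cover_free_nonbipartite:
  assumes "simple_graph F" "\<not> bipartite F"
  shows "indep_cover_free F k"
  using assms two_coloring_covering[OF assms(1)] by (auto simp: indep_cover_free_def bipartite_def)

lemma indep_cover_free_min_class:
  assumes "simple_graph F" "k < min_class F"
  shows "indep_cover_free F k"
  unfolding indep_cover_free_def
proof (intro allI impI notI)
  fix S assume S: "covering F S" "card S \<le> k" "independent_set F S"
  have "min_class F \<le> card S" unfolding min_class_def
    using two_coloring_covering[OF assms(1) S(1,3)] by (intro Least_le) blast
  with S(2) assms(2) show False by simp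
qed

lemma attainable_zero_indep_deletions:
  assumes F: "simple_graph F" and "indep_cover_free F k"
  shows "attainable t k (indep_deletions F) 0"
proof (rule attainable_zero)
  show "\<forall>H \<in> indep_deletions F. simple_graph H"
    using simple_graph_induced[OF F] by (auto simp: indep_deletions_eq[OF F] covering_def)
  fix H assume "H \<in> indep_deletions F"
  then obtain S where S: "covering F S" "H = induced F S" by (auto simp: indep_deletions_eq[OF F])
  show "edges H \<noteq> {} \<or> card (verts H) > k"
  proof (cases "card S \<le> k")
    case True
    then have "\<not> independent_set F S" using assms(2) S by (auto simp: indep_cover_free_def)
    then show ?thesis using S by (auto simp: independent_set_def covering_def induced_def)
  qed (use S in \<open>auto simp: induced_def\<close>)
qed

section \<open>Greedy choices of colours and vertices\<close>

text \<open>A special case of Hall's theorem: when a representative is chosen, fewer than \<open>card C\<close> elements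
  have been used.\<close>

lemma greedy_representatives:
  assumes "finite C" "\<forall>i\<in>C. card C \<le> card (B i)" "\<forall>i\<in>C. finite (B i)"
  shows "\<exists>v. inj_on v C \<and> (\<forall>i\<in>C. v i \<in> B i)"
proof -
  have "\<exists>v. inj_on v D \<and> (\<forall>i\<in>D. v i \<in> B i)" if "D \<subseteq> C" for D
    using finite_subset[OF that assms(1)] that
  proof (induction D rule: finite_induct)
    case (insert i D)
    then obtain v where v: "inj_on v D" "\<forall>j\<in>D. v j \<in> B j" by auto
    have "card (v ` D) \<le> card D" by (rule card_image_le[OF insert.hyps(1)])
    also have "card D < card (insert i D)" using insert.hyps by simp
    also have "card (insert i D) \<le> card C" by (rule card_mono[OF assms(1) insert.prems])
    also have "card C \<le> card (B i)" using assms(2) insert.prems by auto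
    finally have "\<not> B i \<subseteq> v ` D" using card_mono[of "v ` D" "B i"] insert.hyps(1) by auto
    then obtain x where x: "x \<in> B i" "x \<notin> v ` D" by blast
    have "inj_on (v(i := x)) (insert i D)"
      using v(1) x(2) insert.hyps(2) by (auto simp: inj_on_def)
    moreover have "\<forall>j\<in>insert i D. (v(i := x)) j \<in> B j" using v(2) x(1) by auto
    ultimately show ?case by blast
  qed auto
  then show ?thesis by blast
qed

lemma greedy_extension:
  assumes "finite X" "X0 \<subseteq> X" "inj_on c0 X0"
    and "\<forall>e\<in>X - X0. card X \<le> card (B e)" "\<forall>e\<in>X - X0. finite (B e)"
  shows "\<exists>c. inj_on c X \<and> (\<forall>e\<in>X0. c e = c0 e) \<and> (\<forall>e\<in>X - X0. c e \<in> B e)"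
proof -
  have fX0: "finite X0" using assms(1,2) by (rule finite_subset[rotated])
  have "card (X - X0) \<le> card (B e - c0 ` X0)" if e: "e \<in> X - X0" for e
  proof -
    have "card (X - X0) = card X - card X0" using fX0 assms(2) by (rule card_Diff_subset)
    also have "\<dots> \<le> card (B e) - card (c0 ` X0)"
      using assms(4) e card_image[OF assms(3)] by (simp add: diff_le_mono)
    also have "\<dots> \<le> card (B e - c0 ` X0)" by (rule diff_card_le_card_Diff) (use fX0 in auto)
    finally show ?thesis .
  qed
  then obtain v where v: "inj_on v (X - X0)" "\<forall>e\<in>X - X0. v e \<in> B e - c0 ` X0"
    using greedy_representatives[of "X - X0" "\<lambda>e. B e - c0 ` X0"] assms(1,5) by auto
  let ?c = "\<lambda>e. if e \<in> X0 then c0 e else v e"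
  have "inj_on ?c X"
    using v assms(3) unfolding inj_on_def by (metis Diff_iff image_eqI)
  then show ?thesis using v(2) by (intro exI[of _ ?c]) auto
qed

definition colours_of :: "nat set \<Rightarrow> (nat \<Rightarrow> nat set set) \<Rightarrow> nat set \<Rightarrow> nat set" where
  "colours_of T E e = {i \<in> T. e \<in> E i}"

text \<open>The tool by which every rainbow copy is completed: edges whose image carries at least as many
  colours as there are edges never run out of colours, so only the few edges in \<open>X0\<close> have to be
  coloured by hand.\<close>

lemma rainbow_map_extend:
  assumes "finite T" "finite X" "X0 \<subseteq> X" "inj_on c0 X0"
    and "\<forall>e\<in>X0. c0 e \<in> T \<and> f ` e \<in> E (c0 e)"
    and "\<forall>e\<in>X - X0. card X \<le> card (colours_of T E (f ` e))"
  shows "rainbow_map T E X f"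
proof -
  obtain c where c: "inj_on c X" "\<forall>e\<in>X0. c e = c0 e" "\<forall>e\<in>X - X0. c e \<in> colours_of T E (f ` e)"
    using greedy_extension[of X X0 c0 "\<lambda>e. colours_of T E (f ` e)"] assms
    by (auto simp: colours_of_def)
  have "c e \<in> T \<and> f ` e \<in> E (c e)" if "e \<in> X" for e
    using that c(2,3) assms(5) by (cases "e \<in> X0") (auto simp: colours_of_def)
  then show ?thesis unfolding rainbow_map_def using c(1) by blast
qed

lemma rainbow_map_mono:
  "rainbow_map T E X f \<Longrightarrow> T \<subseteq> T' \<Longrightarrow> rainbow_map T' E X f"
  unfolding rainbow_map_def by blast

lemma rainbow_map_cong:
  assumes "edges_on S X" "\<forall>x\<in>S. f x = g x"
  shows "rainbow_map T E X f \<longleftrightarrow> rainbow_map T E X g"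
proof -
  have "f ` e = g ` e" if "e \<in> X" for e
    using that assms by (intro image_cong) (auto simp: edges_on_def)
  then show ?thesis unfolding rainbow_map_def by (metis (no_types, lifting))
qed

lemma extend_injection:
  fixes f :: "nat \<Rightarrow> nat"
  assumes "finite V" "finite A" "card (V - S) \<le> card A" "inj_on f S" "f ` S \<inter> A = {}"
  shows "\<exists>g. inj_on g (S \<union> V) \<and> (\<forall>x\<in>S. g x = f x) \<and> g ` (V - S) \<subseteq> A"
proof -
  have "\<exists>h. inj_on h (V - S) \<and> (\<forall>x\<in>V - S. h x \<in> A)"
    using greedy_representatives[of "V - S" "\<lambda>_. A"] assms(1-3) by blast
  then obtain h where h: "inj_on h (V - S)" "\<forall>x\<in>V - S. h x \<in> A" by blast
  let ?g = "\<lambda>x. if x \<in> S then f x else h x"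
  have "inj_on ?g (S \<union> V)"
  proof (rule inj_onI)
    fix x y assume xy: "x \<in> S \<union> V" "y \<in> S \<union> V" "?g x = ?g y"
    have cross: "f a \<noteq> h b" if "a \<in> S" "b \<in> V - S" for a b
      using that h(2) assms(5) by auto
    show "x = y"
      using xy cross[of x y] cross[of y x] inj_onD[OF assms(4), of x y] inj_onD[OF h(1), of x y]
      by (auto split: if_splits)
  qed
  then show ?thesis using h by (intro exI[of _ ?g]) auto
qed

text \<open>All edges of \<open>F\<close> that are not inside the covering \<open>S'\<close> have exactly one end in \<open>S'\<close>. If \<open>S'\<close> is already embedded
  in \<open>S\<close>, then the other vertices, which are independent, may go anywhere into a large set that is
  joined to \<open>S\<close> in many colours.\<close>

lemma rainbow_map_from_cover:
  assumes F: "simple_graph F" and cov: "covering F S'"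
    and f: "inj_on f S'" "f ` S' \<subseteq> S" "rainbow_map T E (edges (induced F S')) f"
    and T: "finite T"
    and A: "finite A" "A \<inter> S = {}" "card (verts F) \<le> card A"
    and full: "\<forall>a\<in>A. \<forall>x\<in>S. card (edges F) \<le> card (colours_of T E {a, x})"
  shows "\<exists>g. inj_on g (verts F) \<and> g ` verts F \<subseteq> S \<union> A \<and> rainbow_map T E (edges F) g"
proof -
  have F': "edges_on (verts F) (edges F)" "finite (verts F)"
    using F by (auto simp: simple_graph_edges_on)
  have S': "S' \<subseteq> verts F" using cov by (auto simp: covering_def)
  have "card (verts F - S') \<le> card A"
    using A(3) card_mono[OF F'(2), of "verts F - S'"] by auto
  moreover have "f ` S' \<inter> A = {}" using f(2) A(2) by auto
  ultimately obtain g where g: "inj_on g (S' \<union> verts F)" "\<forall>x\<in>S'. g x = f x"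
      "g ` (verts F - S') \<subseteq> A"
    using extend_injection[OF F'(2) A(1) _ f(1)] by meson
  have inj: "inj_on g (verts F)" using g(1) by (rule inj_on_subset) auto
  have im: "g ` verts F \<subseteq> S \<union> A" using g f(2) by (auto simp: image_subset_iff)
  have "rainbow_map T E (edges (induced F S')) g"
    using f(3) g(2) rainbow_map_cong[of S' "edges (induced F S')" g f] F'(1)
    by (auto simp: induced_def edges_on_def)
  then obtain c where c: "inj_on c (edges (induced F S'))"
      "\<forall>e\<in>edges (induced F S'). c e \<in> T \<and> g ` e \<in> E (c e)"
    unfolding rainbow_map_def by blast
  have "rainbow_map T E (edges F) g"
  proof (rule rainbow_map_extend[OF T _ _ c(1) c(2)])
    show "finite (edges F)" using finite_edges_on[OF F'] .
    show "edges (induced F S') \<subseteq> edges F" by (auto simp: induced_def)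
    show "\<forall>e\<in>edges F - edges (induced F S'). card (edges F) \<le> card (colours_of T E (g ` e))"
    proof
      fix e assume e: "e \<in> edges F - edges (induced F S')"
      then obtain a b where ab: "e = {a, b}" "a \<in> verts F" "b \<in> verts F"
        using edges_onE[OF F'(1), of e] by blast
      have "e \<inter> S' \<noteq> {}" "\<not> e \<subseteq> S'" using e cov by (auto simp: covering_def induced_def)
      then have "\<exists>x y. e = {y, x} \<and> x \<in> S' \<and> y \<in> verts F - S'"
        using ab by (cases "a \<in> S'") auto
      then obtain x y where xy: "e = {y, x}" "x \<in> S'" "y \<in> verts F - S'" by blast
      then have "g x \<in> S" "g y \<in> A" using g f(2) by (auto simp: image_subset_iff)
      then show "card (edges F) \<le> card (colours_of T E (g ` e))" using full xy(1) by auto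
    qed
  qed
  then show ?thesis using inj im by blast
qed

section \<open>Rainbow matchings\<close>

text \<open>The edges are indexed by their colours, so that distinctness of the colours is built in.\<close>

definition rainbow_matching :: "nat set \<Rightarrow> (nat \<Rightarrow> nat set set) \<Rightarrow> (nat \<Rightarrow> nat set) \<Rightarrow> bool" where
  "rainbow_matching C E m \<longleftrightarrow>
     (\<forall>i\<in>C. m i \<in> E i) \<and> (\<forall>i\<in>C. \<forall>j\<in>C. i \<noteq> j \<longrightarrow> m i \<inter> m j = {})"

lemma simple_graph_matching: "simple_graph (matching_graph k)"
  by (auto simp: simple_graph_def matching_graph_def)

text \<open>Vertex \<open>n\<close> of the standard matching lies in its edge number \<open>n div 2\<close>; the edges of the standard
  matching are recognised by their minimum.\<close>

lemma rainbow_matching_imp_map: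
  assumes m: "rainbow_matching C E m" and C: "C \<subseteq> T" "card C = k" "finite C"
    and E: "\<forall>i\<in>C. edges_on V (E i)"
  shows "\<exists>f. inj_on f (verts (matching_graph k)) \<and> f ` verts (matching_graph k) \<subseteq> V \<and>
    rainbow_map T E (edges (matching_graph k)) f"
proof -
  obtain g where g: "bij_betw g {..<k} C"
    using ex_bij_betw_nat_finite[OF C(3)] C(2) by (auto simp: atLeast0LessThan)
  have "\<exists>a b. m (g j) = {a, b} \<and> a \<noteq> b \<and> a \<in> V \<and> b \<in> V" if "j < k" for j
  proof -
    have "g j \<in> C" using g that by (auto simp: bij_betw_def)
    then show ?thesis using m E edges_onE[of V "E (g j)" "m (g j)"]
      unfolding rainbow_matching_def by metis
  qed
  then obtain a b where ab: "\<And>j. j < k \<Longrightarrow> m (g j) = {a j, b j} \<and> a j \<noteq> b j \<and> a j \<in> V \<and> b j \<in> V"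
    by metis
  define f where "f n = (if even n then a (n div 2) else b (n div 2))" for n
  have fm: "f n \<in> m (g (n div 2)) \<and> f n \<in> V" if "n < 2 * k" for n
    using ab[of "n div 2"] that by (auto simp: f_def)
  have "n = n'" if n: "n < 2 * k" "n' < 2 * k" "f n = f n'" for n n'
  proof -
    have eq: "n div 2 = n' div 2"
    proof (rule ccontr)
      assume "n div 2 \<noteq> n' div 2"
      moreover have "n div 2 \<in> {..<k}" "n' div 2 \<in> {..<k}" using n by auto
      ultimately have "g (n div 2) \<noteq> g (n' div 2)" "g (n div 2) \<in> C" "g (n' div 2) \<in> C"
        using g by (auto simp: bij_betw_def inj_on_def)
      then have "m (g (n div 2)) \<inter> m (g (n' div 2)) = {}"
        using m by (auto simp: rainbow_matching_def)
      with fm[OF n(1)] fm[OF n(2)] n(3) show False by auto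
    qed
    moreover have "even n \<longleftrightarrow> even n'"
    proof -
      have "n div 2 < k" using n(1) by auto
      then have "a (n' div 2) \<noteq> b (n' div 2)" using ab[of "n div 2"] eq by auto
      then show ?thesis using n(3) eq by (auto simp: f_def split: if_splits)
    qed
    ultimately show ?thesis by (metis div_mult_mod_eq even_iff_mod_2_eq_zero odd_iff_mod_2_eq_one)
  qed
  then have "inj_on f (verts (matching_graph k))"
    by (auto simp: inj_on_def matching_graph_def)
  moreover have "f ` verts (matching_graph k) \<subseteq> V" using fm by (auto simp: matching_graph_def)
  moreover have "rainbow_map T E (edges (matching_graph k)) f"
    unfolding rainbow_map_def
  proof (intro exI[of _ "\<lambda>e. g (Min e div 2)"] conjI ballI)
    show "inj_on (\<lambda>e. g (Min e div 2)) (edges (matching_graph k))"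
    proof (rule inj_onI)
      fix e e' assume "e \<in> edges (matching_graph k)" "e' \<in> edges (matching_graph k)"
        and eq: "g (Min e div 2) = g (Min e' div 2)"
      then obtain i j where ij: "e = {2 * i, 2 * i + 1}" "e' = {2 * j, 2 * j + 1}" "i < k" "j < k"
        by (auto simp: matching_graph_def)
      then have "g i = g j" using eq by simp
      then have "i = j" using ij g by (auto simp: bij_betw_def inj_on_def)
      then show "e = e'" using ij by simp
    qed
  next
    fix e assume "e \<in> edges (matching_graph k)"
    then obtain i where i: "e = {2 * i, 2 * i + 1}" "i < k" by (auto simp: matching_graph_def)
    then have gi: "g (Min e div 2) = g i" by simp
    have "g i \<in> C" using g i by (auto simp: bij_betw_def)
    moreover have "f ` e = m (g i)" using i ab[of i] by (auto simp: f_def)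
    ultimately show "g (Min e div 2) \<in> T" "f ` e \<in> E (g (Min e div 2))"
      using C(1) m gi by (auto simp: rainbow_matching_def)
  qed
  ultimately show ?thesis by blast
qed

lemma matching_meets_cover:
  assumes "inj_on f (verts (matching_graph k))" "finite S"
    and "\<forall>e\<in>edges (matching_graph k). f ` e \<inter> S \<noteq> {}"
  shows "k \<le> card S"
proof -
  have "\<exists>n. n div 2 = i \<and> n < 2 * k \<and> f n \<in> S" if "i < k" for i
  proof -
    have "{2 * i, 2 * i + 1} \<in> edges (matching_graph k)" using that by (auto simp: matching_graph_def)
    with assms(3) have "f ` {2 * i, 2 * i + 1} \<inter> S \<noteq> {}" by blast
    then have "f (2 * i) \<in> S \<or> f (2 * i + 1) \<in> S" by auto
    then show ?thesis using that
      by (elim disjE) (auto intro: exI[of _ "2 * i"] exI[of _ "2 * i + 1"])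
  qed
  then obtain h where h: "\<And>i. i < k \<Longrightarrow> h i div 2 = i \<and> h i < 2 * k \<and> f (h i) \<in> S" by metis
  have "inj_on (f \<circ> h) {..<k}"
  proof (rule inj_onI)
    fix i j assume ij: "i \<in> {..<k}" "j \<in> {..<k}" "(f \<circ> h) i = (f \<circ> h) j"
    then have "h i = h j" using assms(1) h by (auto simp: inj_on_def matching_graph_def)
    then show "i = j" using h ij by (metis lessThan_iff)
  qed
  moreover have "(f \<circ> h) ` {..<k} \<subseteq> S" using h by auto
  ultimately show ?thesis using card_inj_on_le[OF _ _ assms(2)] by fastforce
qed

section \<open>The join construction\<close>

lemma card_cross_edges:
  fixes A B :: "nat set"
  assumes "finite A" "finite B" "A \<inter> B = {}"
  shows "card ((\<lambda>(x, u). {x, u}) ` (A \<times> B)) = card A * card B"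
proof -
  have "inj_on (\<lambda>(x, u). {x, u}) (A \<times> B)"
  proof (rule inj_onI, clarify)
    fix x u x' u' assume "x \<in> A" "u \<in> B" "x' \<in> A" "u' \<in> B" "{x, u} = {x', u'}"
    then show "x = x' \<and> u = u'" using assms(3) by (auto simp: doubleton_eq_iff)
  qed
  then show ?thesis by (simp add: card_image card_cartesian_product)
qed

text \<open>The extremal construction: an extremal collection on \<open>k\<close> vertices, and in every colour all edges
  from these to the \<open>n - k\<close> other vertices. All edges meet a set of \<open>k \<le> s\<close> vertices, which excludes
  \<open>s + 1\<close> disjoint edges; and a rainbow copy of \<open>F\<close> meets that set in a covering of \<open>F\<close>, so it
  contains a forbidden rainbow copy inside the set.\<close>

lemma join_attainable:
  assumes F: "simple_graph F" and "k \<le> s" "k \<le> n"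
    and att: "attainable t k (indep_deletions F) e"
  shows "attainable t n {F, matching_graph (s + 1)} (int k * (int n - int k) + e)"
proof -
  obtain V0 G0 where V0: "collection V0 t G0" "card V0 = k"
      "rainbow_free V0 t G0 (indep_deletions F)" "\<forall>i\<in>{1..t}. e \<le> int (card (edges (G0 i)))"
    using att unfolding attainable_def by blast
  have fin0: "finite V0" using V0(1) by (simp add: collection_def)
  then have "infinite (UNIV - V0)" by simp
  then obtain U where U: "finite U" "card U = n - k" "U \<subseteq> UNIV - V0"
    using infinite_arbitrarily_large by blast
  define X where "X = (\<lambda>(x, u). {x, u}) ` (V0 \<times> U)"
  define G where "G i = \<lparr>verts = V0 \<union> U, edges = edges (G0 i) \<union> X\<rparr>" for i
  have E0: "edges_on V0 (edges (G0 i))" if "i \<in> {1..t}" for i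
    using V0(1) that by (auto simp: collection_def simple_graph_edges_on)
  have X: "e \<subseteq> V0 \<union> U \<and> card e = 2 \<and> e \<inter> V0 \<noteq> {} \<and> \<not> e \<subseteq> V0" if "e \<in> X" for e
  proof -
    obtain a b where "e = {a, b}" "a \<in> V0" "b \<in> U" using \<open>e \<in> X\<close> by (auto simp: X_def)
    moreover from this have "a \<noteq> b" "b \<notin> V0" using U(3) by auto
    ultimately show ?thesis by auto
  qed
  have "edges_on (V0 \<union> U) (edges (G i))" if "i \<in> {1..t}" for i
    using E0[OF that] X by (auto simp: G_def edges_on_def)
  then have col: "collection (V0 \<union> U) t G"
    using fin0 U(1) by (auto simp: collection_def simple_graph_edges_on G_def)
  have cardV: "card (V0 \<union> U) = n"
    using card_Un_disjoint[OF fin0 U(1)] U(2,3) V0(2) assms(3) by (auto simp: Int_commute)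
  have meets: "f \<inter> V0 \<noteq> {}" if "i \<in> {1..t}" "f \<in> edges (G i)" for f i
  proof (cases "f \<in> X")
    case False
    then have "f \<in> edges (G0 i)" using that by (simp add: G_def)
    then have "f \<subseteq> V0" "card f = 2" using E0[OF that(1)] by (auto simp: edges_on_def)
    then show ?thesis by (metis Int_absorb2 card.empty zero_neq_numeral)
  qed (use X in blast)
  have sg: "\<forall>H\<in>{F, matching_graph (s + 1)}. simple_graph H"
    using F simple_graph_matching by blast
  have "rainbow_free (V0 \<union> U) t G {F, matching_graph (s + 1)}"
    unfolding rainbow_free_iff[OF sg col] ball_simps
  proof (intro conjI allI impI notI TrueI)
    fix f assume f: "inj_on f (verts F)" "f ` verts F \<subseteq> V0 \<union> U"
      "rainbow_map {1..t} (\<lambda>i. edges (G i)) (edges F) f"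
    then obtain c where c: "inj_on c (edges F)"
        "\<And>e. e \<in> edges F \<Longrightarrow> c e \<in> {1..t} \<and> f ` e \<in> edges (G (c e))"
      unfolding rainbow_map_def by blast
    define S where "S = {x \<in> verts F. f x \<in> V0}"
    have "covering F S"
      unfolding covering_def
    proof (intro conjI ballI)
      fix e assume e: "e \<in> edges F"
      then have "f ` e \<inter> V0 \<noteq> {}" using c(2) meets by blast
      moreover have "e \<subseteq> verts F" using e F by (auto simp: simple_graph_def)
      ultimately show "e \<inter> S \<noteq> {}" by (auto simp: S_def)
    qed (auto simp: S_def)
    moreover have "inj_on f S" using f(1) by (rule inj_on_subset) (auto simp: S_def)
    moreover have "f ` S \<subseteq> V0" by (auto simp: S_def)
    moreover have "rainbow_map {1..t} (\<lambda>i. edges (G0 i)) (edges (induced F S)) f"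
      unfolding rainbow_map_def
    proof (intro exI[of _ c] conjI ballI)
      show "inj_on c (edges (induced F S))"
        using c(1) by (rule inj_on_subset) (auto simp: induced_def)
      fix e assume e: "e \<in> edges (induced F S)"
      then have "e \<in> edges F" "f ` e \<subseteq> V0" by (auto simp: induced_def S_def)
      then show "c e \<in> {1..t}" "f ` e \<in> edges (G0 (c e))"
        using c(2)[of e] X[of "f ` e"] by (auto simp: G_def)
    qed
    ultimately show False
      using V0(3) unfolding rainbow_free_indep_deletions_iff[OF F V0(1)] by blast
  next
    fix f assume f: "inj_on f (verts (matching_graph (s + 1)))"
      "rainbow_map {1..t} (\<lambda>i. edges (G i)) (edges (matching_graph (s + 1))) f"
    have "\<forall>e\<in>edges (matching_graph (s + 1)). f ` e \<inter> V0 \<noteq> {}"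
      using f(2) meets unfolding rainbow_map_def by meson
    from matching_meets_cover[OF f(1) fin0 this] show False using V0(2) assms(2) by simp
  qed
  moreover have "int k * (int n - int k) + e \<le> int (card (edges (G i)))" if i: "i \<in> {1..t}" for i
  proof -
    have "finite (edges (G0 i))" using finite_edges_on[OF E0[OF i] fin0] .
    moreover have "finite X" using fin0 U(1) by (simp add: X_def)
    moreover have "edges (G0 i) \<inter> X = {}"
      using E0[OF i] X by (auto simp: edges_on_def)
    ultimately have "card (edges (G i)) = card (edges (G0 i)) + card X"
      by (simp add: G_def card_Un_disjoint)
    moreover have "card X = k * (n - k)"
      unfolding X_def using card_cross_edges[OF fin0 U(1)] U V0(2) by auto
    ultimately show ?thesis using V0(4) i assms(3) by (simp add: of_nat_diff)
  qed
  ultimately show ?thesis unfolding attainable_def using col cardV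
    by (intro exI[of _ "V0 \<union> U"] exI[of _ G]) auto
qed

section \<open>Flexible colours and vertices of high degree\<close>

definition nbrs :: "nat set set \<Rightarrow> nat \<Rightarrow> nat set" where
  "nbrs X v = {w. {v, w} \<in> X}"

text \<open>A matching with \<open>s\<close> edges has \<open>2 * s\<close> vertices, so a flexible colour can always contribute the last
  edge of a rainbow matching of size \<open>s + 1\<close>. In any other colour \<open>2 * s\<close> vertices cover all edges.\<close>

definition flexible :: "nat \<Rightarrow> nat set set \<Rightarrow> bool" where
  "flexible s X \<longleftrightarrow> (\<forall>Z. finite Z \<longrightarrow> card Z \<le> 2 * s \<longrightarrow> (\<exists>e\<in>X. e \<inter> Z = {}))"

text \<open>A matching with \<open>s + 1\<close> edges has \<open>2 * s + 2 < 3 * s + 3\<close> vertices, so a vertex of high degree can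
  be matched however the other edges of the matching have been chosen.\<close>

definition high :: "nat \<Rightarrow> nat set set \<Rightarrow> nat set" where
  "high s X = {v. 3 * s + 3 \<le> card (nbrs X v)}"

lemma nbrs_subset: "edges_on V X \<Longrightarrow> nbrs X v \<subseteq> V"
  by (auto simp: nbrs_def edges_on_def)

lemma high_subset:
  assumes "edges_on V X"
  shows "high s X \<subseteq> V"
proof
  fix v assume "v \<in> high s X"
  then have "nbrs X v \<noteq> {}" by (auto simp: high_def)
  then show "v \<in> V" using assms by (auto simp: nbrs_def edges_on_def)
qed

lemma edges_covered_card_le:
  assumes X: "edges_on V X" and "finite V" "finite Z" and "\<forall>e\<in>X. e \<inter> Z \<noteq> {}"
  shows "card X \<le> (\<Sum>v\<in>Z. card (nbrs X v))"
proof -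
  have fin: "finite (nbrs X v)" for v using nbrs_subset[OF X] assms(2) by (rule finite_subset)
  have "X \<subseteq> (\<Union>v\<in>Z. (\<lambda>w. {v, w}) ` nbrs X v)"
  proof
    fix e assume e: "e \<in> X"
    then obtain v where v: "v \<in> e" "v \<in> Z" using assms(4) by blast
    obtain a b where "e = {a, b}" using edges_onE[OF X e] by blast
    then obtain w where "e = {v, w}" using v(1) by (auto simp: insert_commute)
    then show "e \<in> (\<Union>v\<in>Z. (\<lambda>w. {v, w}) ` nbrs X v)" using v(2) e by (auto simp: nbrs_def)
  qed
  then have "card X \<le> card (\<Union>v\<in>Z. (\<lambda>w. {v, w}) ` nbrs X v)"
    by (rule card_mono[rotated]) (use assms(3) fin in auto)
  also have "\<dots> \<le> (\<Sum>v\<in>Z. card ((\<lambda>w. {v, w}) ` nbrs X v))" by (rule card_UN_le[OF assms(3)])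
  also have "\<dots> \<le> (\<Sum>v\<in>Z. card (nbrs X v))" by (intro sum_mono card_image_le fin)
  finally show ?thesis .
qed

text \<open>Such edges are covered by at most \<open>2 * s\<close> vertices, none of them of high degree.\<close>

lemma nonflexible_few_edges_avoid_high:
  assumes X: "edges_on V X" "finite V" and nf: "\<not> flexible s X" and W: "high s X \<subseteq> W"
  shows "card {e \<in> X. e \<inter> W = {}} \<le> 2 * s * (3 * s + 3)"
proof -
  obtain Z where Z: "finite Z" "card Z \<le> 2 * s" "\<forall>e\<in>X. e \<inter> Z \<noteq> {}"
    using nf by (auto simp: flexible_def)
  let ?Y = "{e \<in> X. e \<inter> W = {}}"
  have Y: "edges_on V ?Y" by (rule edges_on_subset[OF X(1)]) auto
  have "card ?Y \<le> (\<Sum>v\<in>Z - W. card (nbrs ?Y v))"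
    by (rule edges_covered_card_le[OF Y X(2)]) (use Z in auto)
  also have "\<dots> \<le> (\<Sum>v\<in>Z - W. 3 * s + 3)"
  proof (rule sum_mono)
    fix v assume "v \<in> Z - W"
    then have "v \<notin> high s X" using W by blast
    then have "card (nbrs X v) < 3 * s + 3" by (simp add: high_def)
    moreover have "card (nbrs ?Y v) \<le> card (nbrs X v)"
      by (rule card_mono) (use finite_subset[OF nbrs_subset[OF X(1)] X(2)] in \<open>auto simp: nbrs_def\<close>)
    ultimately show "card (nbrs ?Y v) \<le> 3 * s + 3" by simp
  qed
  also have "\<dots> = card (Z - W) * (3 * s + 3)" by simp
  also have "\<dots> \<le> 2 * s * (3 * s + 3)"
    using Z card_mono[OF Z(1), of "Z - W"] by (intro mult_le_mono1) auto
  finally show ?thesis .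
qed

lemma nonflexible_card_le:
  assumes X: "edges_on V X" "finite V" and nf: "\<not> flexible s X"
  shows "card X \<le> card (high s X) * card V + 2 * s * (3 * s + 3)"
proof -
  let ?B = "high s X" and ?Y = "{e \<in> X. e \<inter> high s X \<noteq> {}}"
  have fB: "finite ?B" using high_subset[OF X(1)] X(2) by (rule finite_subset)
  have Y: "edges_on V ?Y" by (rule edges_on_subset[OF X(1)]) auto
  have "card ?Y \<le> (\<Sum>v\<in>?B. card (nbrs ?Y v))"
    by (rule edges_covered_card_le[OF Y X(2) fB]) auto
  also have "\<dots> \<le> (\<Sum>v\<in>?B. card V)"
    by (intro sum_mono card_mono X(2) nbrs_subset[OF Y])
  finally have "card ?Y \<le> card ?B * card V" by simp
  moreover have "card {e \<in> X. e \<inter> ?B = {}} \<le> 2 * s * (3 * s + 3)"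
    by (rule nonflexible_few_edges_avoid_high[OF X nf]) simp
  moreover have U: "?Y \<union> {e \<in> X. e \<inter> ?B = {}} = X" by auto
  have "card X \<le> card ?Y + card {e \<in> X. e \<inter> ?B = {}}"
    using card_Un_le[of ?Y "{e \<in> X. e \<inter> ?B = {}}"] unfolding U .
  ultimately show ?thesis by linarith
qed

lemma rainbow_matching_insert:
  assumes "rainbow_matching C E m" "i \<notin> C" "e \<in> E i" "e \<inter> \<Union>(m ` C) = {}"
  shows "rainbow_matching (insert i C) E (m(i := e))"
  using assms unfolding rainbow_matching_def by (auto simp: disjoint_iff)

lemma rainbow_matching_vertices:
  assumes "rainbow_matching C E m" "\<forall>i\<in>C. edges_on V (E i)" "finite C"
  shows "finite (\<Union>(m ` C)) \<and> card (\<Union>(m ` C)) \<le> 2 * card C"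
proof -
  have "finite (m i) \<and> card (m i) = 2" if "i \<in> C" for i
  proof -
    have "card (m i) = 2" using assms that by (auto simp: rainbow_matching_def edges_on_def)
    then show ?thesis using card.infinite by fastforce
  qed
  then show ?thesis using card_UN_le[OF assms(3), of m] assms(3) by simp
qed

text \<open>The high-degree vertices \<open>v i\<close> are matched one after the other. The neighbour of each must avoid
  the vertices already matched and the representatives still to be matched.\<close>

lemma add_representatives:
  assumes "finite D" "finite C" "rainbow_matching C E m" "C \<inter> D = {}" "inj_on v D"
    and "\<forall>i\<in>D. v i \<in> high s (E i)" "\<Union>(m ` C) \<inter> v ` D = {}"
    and "card C + card D \<le> s + 1" "\<forall>i\<in>C \<union> D. edges_on V (E i)"
  shows "\<exists>m'. rainbow_matching (C \<union> D) E m'"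
  using assms
proof (induction D arbitrary: C m rule: finite_induct)
  case (insert i D)
  let ?Z = "\<Union>(m ` C) \<union> v ` insert i D"
  have M: "finite (\<Union>(m ` C))" "card (\<Union>(m ` C)) \<le> 2 * card C"
    using rainbow_matching_vertices[OF insert.prems(2) _ insert.prems(1), of V] insert.prems(8) by auto
  have "card ?Z \<le> card (\<Union>(m ` C)) + card (v ` insert i D)" by (rule card_Un_le)
  also have "\<dots> \<le> 2 * card C + card (insert i D)"
    using M(2) card_image_le[of "insert i D" v] insert.hyps(1) by simp
  also have "\<dots> < 3 * s + 3" using insert.prems(7) insert.hyps by simp
  also have "\<dots> \<le> card (nbrs (E i) (v i))" using insert.prems(5) by (auto simp: high_def)
  finally have "\<not> nbrs (E i) (v i) \<subseteq> ?Z"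
    using card_mono[of ?Z "nbrs (E i) (v i)"] M(1) insert.hyps(1) by (auto simp del: Un_insert_right)
  then obtain w where w: "{v i, w} \<in> E i" "w \<notin> ?Z" by (auto simp: nbrs_def)
  have iC: "i \<notin> C" using insert.prems(3) by auto
  have rm: "rainbow_matching (insert i C) E (m(i := {v i, w}))"
    by (rule rainbow_matching_insert[OF insert.prems(2) iC w(1)]) (use w(2) insert.prems(6) in auto)
  have U: "\<Union>((m(i := {v i, w})) ` insert i C) = {v i, w} \<union> \<Union>(m ` C)"
    using iC by auto
  have "v i \<notin> v ` D" using insert.prems(4) insert.hyps(2) by (auto simp: inj_on_def)
  then have disj: "\<Union>((m(i := {v i, w})) ` insert i C) \<inter> v ` D = {}"
    unfolding U using w(2) insert.prems(6) by auto
  have "\<exists>m'. rainbow_matching (insert i C \<union> D) E m'"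
    by (rule insert.IH[OF _ rm _ _ _ disj]) (use insert.prems insert.hyps iC in auto)
  then show ?case by simp
qed auto

lemma add_flexible:
  assumes "finite D" "finite C" "rainbow_matching C E m" "C \<inter> D = {}"
    and "\<forall>i\<in>D. flexible s (E i)"
    and "card C + card D \<le> s + 1" "\<forall>i\<in>C \<union> D. edges_on V (E i)"
  shows "\<exists>m'. rainbow_matching (C \<union> D) E m'"
  using assms
proof (induction D arbitrary: C m rule: finite_induct)
  case (insert i D)
  have M: "finite (\<Union>(m ` C))" "card (\<Union>(m ` C)) \<le> 2 * card C"
    using rainbow_matching_vertices[OF insert.prems(2) _ insert.prems(1), of V] insert.prems(6) by auto
  moreover have "card C \<le> s" using insert.prems(5) insert.hyps by simp
  ultimately have "card (\<Union>(m ` C)) \<le> 2 * s" by linarith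
  then obtain e where e: "e \<in> E i" "e \<inter> \<Union>(m ` C) = {}"
    using insert.prems(4) M(1) unfolding flexible_def by (meson insertI1)
  have iC: "i \<notin> C" using insert.prems(3) by auto
  have rm: "rainbow_matching (insert i C) E (m(i := e))"
    by (rule rainbow_matching_insert[OF insert.prems(2) iC e])
  have "\<exists>m'. rainbow_matching (insert i C \<union> D) E m'"
    by (rule insert.IH[OF _ rm]) (use insert.prems insert.hyps iC in auto)
  then show ?case by simp
qed auto

text \<open>Non-flexible colours are served first, by distinct vertices of high degree; flexible colours can
  be served last since no choice harms them.\<close>

lemma rainbow_matching_exists:
  assumes "finite D" "finite C" "rainbow_matching C E m" "C \<inter> D = {}"
    and v: "inj_on v {i \<in> D. \<not> flexible s (E i)}"
      "\<forall>i\<in>D. \<not> flexible s (E i) \<longrightarrow> v i \<in> high s (E i)"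
      "\<forall>i\<in>D. \<not> flexible s (E i) \<longrightarrow> v i \<notin> \<Union>(m ` C)"
    and "card C + card D \<le> s + 1" "\<forall>i\<in>C \<union> D. edges_on V (E i)"
  shows "\<exists>m'. rainbow_matching (C \<union> D) E m'"
proof -
  let ?N = "{i \<in> D. \<not> flexible s (E i)}" and ?F = "{i \<in> D. flexible s (E i)}"
  have D: "D = ?N \<union> ?F" "?N \<inter> ?F = {}" by auto
  have cD: "card D = card ?N + card ?F"
    using card_Un_disjoint[of ?N ?F] D assms(1) by (metis (no_types, lifting) finite_Un)
  have "\<exists>m'. rainbow_matching (C \<union> ?N) E m'"
    by (rule add_representatives[OF _ assms(2,3) _ v(1)]) (use assms cD in auto)
  then obtain m' where m': "rainbow_matching (C \<union> ?N) E m'" by blast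
  have "card (C \<union> ?N) \<le> card C + card ?N" by (rule card_Un_le)
  then have "\<exists>m'. rainbow_matching ((C \<union> ?N) \<union> ?F) E m'"
    by (intro add_flexible[OF _ _ m']) (use assms cD in auto)
  moreover have "(C \<union> ?N) \<union> ?F = C \<union> D" by auto
  ultimately show ?thesis by simp
qed

section \<open>Collections without a rainbow matching of size s + 1\<close>

lemma rainbow_freeD:
  assumes F: "simple_graph F" and G: "collection V t G"
    and free: "rainbow_free V t G {F, matching_graph k}"
  shows "inj_on f (verts F) \<Longrightarrow> f ` verts F \<subseteq> V \<Longrightarrow>
      \<not> rainbow_map {1..t} (\<lambda>i. edges (G i)) (edges F) f"
    and "C \<subseteq> {1..t} \<Longrightarrow> card C = k \<Longrightarrow> \<not> rainbow_matching C (\<lambda>i. edges (G i)) m"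
proof -
  have sg: "\<forall>H\<in>{F, matching_graph k}. simple_graph H"
    using F simple_graph_matching by blast
  note free' = free[unfolded rainbow_free_iff[OF sg G] ball_simps]
  show "\<not> rainbow_map {1..t} (\<lambda>i. edges (G i)) (edges F) f"
    if "inj_on f (verts F)" "f ` verts F \<subseteq> V" using free' that by blast
  show "\<not> rainbow_matching C (\<lambda>i. edges (G i)) m" if C: "C \<subseteq> {1..t}" "card C = k"
  proof
    assume m: "rainbow_matching C (\<lambda>i. edges (G i)) m"
    have "finite C" using C(1) by (rule finite_subset) simp
    moreover have "\<forall>i\<in>C. edges_on V (edges (G i))"
      using G C(1) by (auto simp: collection_def simple_graph_edges_on)
    ultimately have "\<exists>f. inj_on f (verts (matching_graph k)) \<and> f ` verts (matching_graph k) \<subseteq> V \<and>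
        rainbow_map {1..t} (\<lambda>i. edges (G i)) (edges (matching_graph k)) f"
      using rainbow_matching_imp_map[OF m C] by blast
    then show False using free' by blast
  qed
qed

text \<open>More than \<open>(s - 1) * card V + O(1)\<close> edges force \<open>s\<close> vertices of high degree in every non-flexible
  colour. Without a rainbow matching of size \<open>s + 1\<close> there is then no flexible colour, the sets of
  high-degree vertices have no \<open>s + 1\<close> distinct representatives, which makes them one and the same
  set \<open>S\<close> of size \<open>s\<close>, and an edge that misses \<open>S\<close> would complete \<open>s\<close> representatives to a matching.\<close>

lemma common_cover:
  assumes V: "finite V" and T: "finite T" "s + 1 \<le> card T" and s: "s > 0"
    and E: "\<forall>i\<in>T. edges_on V (E i)"
    and many: "\<forall>i\<in>T. (s - 1) * card V + 2 * s * (3 * s + 3) < card (E i)"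
    and noM: "\<And>C m. C \<subseteq> T \<Longrightarrow> card C = s + 1 \<Longrightarrow> \<not> rainbow_matching C E m"
  shows "\<exists>S\<subseteq>V. card S = s \<and> (\<forall>i\<in>T. \<forall>e\<in>E i. e \<inter> S \<noteq> {})"
proof -
  let ?B = "\<lambda>i. high s (E i)"
  have fB: "finite (?B i)" if "i \<in> T" for i
    using high_subset[of V "E i" s] E that V finite_subset by blast
  have big: "s \<le> card (?B i)" if "i \<in> T" "\<not> flexible s (E i)" for i
  proof (rule ccontr)
    assume "\<not> s \<le> card (?B i)"
    then have "card (?B i) \<le> s - 1" by simp
    then have "card (?B i) * card V \<le> (s - 1) * card V" by (rule mult_le_mono1)
    moreover have "card (E i) \<le> card (?B i) * card V + 2 * s * (3 * s + 3)"
      using nonflexible_card_le[of V "E i" s] E V that by simp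
    moreover have "(s - 1) * card V + 2 * s * (3 * s + 3) < card (E i)" using many that(1) by blast
    ultimately show False by linarith
  qed
  have none: "rainbow_matching {} E m" for m by (simp add: rainbow_matching_def)
  have sub: "\<exists>D\<subseteq>T - I. card D = k" if "finite I" "I \<subseteq> T" "k + card I \<le> s + 1" for I k
    using obtain_subset_with_card_n[of k "T - I"] card_Diff_subset[OF that(1,2)] that(3) T(2)
    by (metis add_le_imp_le_diff order_trans)
  have reps: "\<exists>v. inj_on v D \<and> (\<forall>i\<in>D. v i \<in> ?B i - Y)"
    if "D \<subseteq> T" "\<forall>i\<in>D. \<not> flexible s (E i)" "finite Y" "card D + card Y \<le> s" for D Y
  proof (rule greedy_representatives)
    show "finite D" using that(1) T(1) by (rule finite_subset)
    show "\<forall>i\<in>D. finite (?B i - Y)" using fB that(1) by auto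
    show "\<forall>i\<in>D. card D \<le> card (?B i - Y)"
    proof
      fix i assume "i \<in> D"
      then have "s \<le> card (?B i)" using big that by auto
      moreover have "card (?B i) - card Y \<le> card (?B i - Y)"
        by (rule diff_card_le_card_Diff[OF that(3)])
      ultimately show "card D \<le> card (?B i - Y)" using that(4) by linarith
    qed
  qed
  have nf: "\<not> flexible s (E i)" if i: "i \<in> T" for i
  proof
    assume fl: "flexible s (E i)"
    obtain D where D: "D \<subseteq> T - {i}" "card D = s" using sub[of "{i}" s] i by auto
    have fD: "finite D" using D(1) T(1) finite_subset by fastforce
    let ?N = "{j \<in> D. \<not> flexible s (E j)}"
    have "card ?N \<le> s" using card_mono[OF fD, of ?N] D(2) by auto
    then obtain v where v: "inj_on v ?N" "\<forall>j\<in>?N. v j \<in> ?B j - {}"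
      using reps[of ?N "{}"] D(1) by fastforce
    have NI: "{j \<in> insert i D. \<not> flexible s (E j)} = ?N" using fl by auto
    have "i \<notin> D" using D(1) by auto
    then have cI: "card (insert i D) = s + 1" using D(2) fD by simp
    have "\<exists>m. rainbow_matching ({} \<union> insert i D) E m"
      by (rule rainbow_matching_exists[OF _ _ none _ v(1)[folded NI], where V = V])
        (use v(2) D fD i E fl cI in auto)
    then show False using noM[of "insert i D"] cI D(1) i by auto
  qed
  have noSDR: False if "D \<subseteq> T" "card D = s + 1" "inj_on v D" "\<forall>i\<in>D. v i \<in> ?B i" for D v
  proof -
    have fD: "finite D" using that(1) T(1) finite_subset by blast
    have "\<exists>m. rainbow_matching ({} \<union> D) E m"
      by (rule rainbow_matching_exists[OF _ _ none, where s = s and v = v and V = V])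
        (use that fD E in \<open>auto intro: inj_on_subset\<close>)
    then show False using noM[OF that(1,2)] by simp
  qed
  have subset: "?B j \<subseteq> ?B i" if ij: "i \<in> T" "j \<in> T" "i \<noteq> j" for i j
  proof
    fix x assume x: "x \<in> ?B j"
    show "x \<in> ?B i"
    proof (rule ccontr)
      assume nx: "x \<notin> ?B i"
      obtain D where D: "D \<subseteq> T - {i, j}" "card D = s - 1" using sub[of "{i, j}" "s - 1"] ij s by auto
      have fD: "finite D" using D(1) T(1) finite_subset by fastforce
      have "\<exists>v. inj_on v D \<and> (\<forall>k\<in>D. v k \<in> ?B k - {x})"
        by (rule reps) (use D nf s in auto)
      then obtain v where v: "inj_on v D" "\<forall>k\<in>D. v k \<in> ?B k - {x}" by blast
      have "card (v ` D) < card (?B i)"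
        using card_image_le[OF fD, of v] D(2) big[OF ij(1) nf[OF ij(1)]] s by linarith
      then have "\<not> ?B i \<subseteq> v ` D" using card_mono[of "v ` D" "?B i"] fD by auto
      then obtain y where y: "y \<in> ?B i" "y \<notin> v ` D" by blast
      let ?v = "v(i := y, j := x)"
      have "inj_on ?v (insert i (insert j D))"
        using v y x nx D(1) ij(3) unfolding inj_on_def by auto
      moreover have "\<forall>k\<in>insert i (insert j D). ?v k \<in> ?B k" using v y x D(1) ij(3) by auto
      moreover have "i \<notin> D" "j \<notin> D" using D(1) by auto
      then have "card (insert i (insert j D)) = s + 1" using D(2) ij(3) fD s by simp
      ultimately show False using noSDR[of "insert i (insert j D)" ?v] D(1) ij by auto
    qed
  qed
  have "T \<noteq> {}" using T(2) by auto
  then obtain i0 where i0: "i0 \<in> T" by blast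
  define S where "S = ?B i0"
  have BS: "?B i = S" if "i \<in> T" for i
    using subset[OF that i0] subset[OF i0 that] by (cases "i = i0") (auto simp: S_def)
  have SV: "S \<subseteq> V" using high_subset E i0 by (auto simp: S_def)
  have fS: "finite S" using SV V by (rule finite_subset)
  have "card S \<le> s"
  proof (rule ccontr)
    assume "\<not> card S \<le> s"
    then have c: "s + 1 \<le> card S" by simp
    obtain D where D: "D \<subseteq> T" "card D = s + 1" using sub[of "{}" "s + 1"] by auto
    have fD: "finite D" using D(1) T(1) finite_subset by fastforce
    have "\<exists>v. inj_on v D \<and> (\<forall>i\<in>D. v i \<in> S)"
      by (rule greedy_representatives[OF fD]) (use c D fS in auto)
    then show False using noSDR[OF D] BS D(1) by blast
  qed
  with big[OF i0 nf[OF i0]] have cS: "card S = s" by (simp add: S_def)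
  have "e \<inter> S \<noteq> {}" if e: "i \<in> T" "e \<in> E i" for i e
  proof
    assume disj: "e \<inter> S = {}"
    obtain D where D: "D \<subseteq> T - {i}" "card D = s" using sub[of "{i}" s] e(1) by auto
    have fD: "finite D" using D(1) T(1) finite_subset by fastforce
    have "\<exists>v. inj_on v D \<and> (\<forall>i\<in>D. v i \<in> ?B i - {})"
      by (rule reps) (use D nf in auto)
    then obtain v where v: "inj_on v D" "\<forall>j\<in>D. v j \<in> S" using BS D(1) by fastforce
    have one: "rainbow_matching {i} E (\<lambda>_. e)" using e(2) by (simp add: rainbow_matching_def)
    have "\<exists>m. rainbow_matching ({i} \<union> D) E m"
      by (rule rainbow_matching_exists[OF fD _ one, where s = s and v = v and V = V])
        (use v D BS E e(1) disj in \<open>auto intro: inj_on_subset\<close>)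
    moreover have "i \<notin> D" using D(1) by auto
    then have "card ({i} \<union> D) = s + 1" using D(2) fD by simp
    ultimately show False using noM[of "{i} \<union> D"] D(1) e(1) by auto
  qed
  then show ?thesis using SV cS by blast
qed

text \<open>With fewer edges the sets of high-degree vertices may differ, but a maximal system of distinct
  representatives still has at most \<open>s\<close> members, and so has the set of flexible colours. The
  representatives form \<open>W\<close>: by maximality they contain the high-degree vertices of all other
  colours.\<close>

lemma common_high_vertices:
  assumes V: "finite V" and T: "finite T"
    and E: "\<forall>i\<in>T. edges_on V (E i)"
    and noM: "\<And>C m. C \<subseteq> T \<Longrightarrow> card C = s + 1 \<Longrightarrow> \<not> rainbow_matching C E m"
  shows "\<exists>T'\<subseteq>T. \<exists>W\<subseteq>V. card W \<le> s \<and> card T \<le> card T' + 2 * s \<and>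
    (\<forall>i\<in>T'. \<not> flexible s (E i) \<and> high s (E i) \<subseteq> W)"
proof -
  let ?B = "\<lambda>i. high s (E i)"
  let ?Fl = "{i \<in> T. flexible s (E i)}" and ?N = "{i \<in> T. \<not> flexible s (E i)}"
  have none: "rainbow_matching {} E m" for m by (simp add: rainbow_matching_def)
  have noM': "card C \<le> s"
    if C: "C \<subseteq> T" and m: "\<And>D. D \<subseteq> C \<Longrightarrow> card D = s + 1 \<Longrightarrow> \<exists>m. rainbow_matching D E m" for C
  proof (rule ccontr)
    assume "\<not> card C \<le> s"
    then obtain D where "D \<subseteq> C" "card D = s + 1"
      using obtain_subset_with_card_n[of "s + 1" C] by auto
    with m noM C show False by (meson subset_trans)
  qed
  have "card ?Fl \<le> s"
  proof (rule noM')
    fix D assume D: "D \<subseteq> ?Fl" "card D = s + 1"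
    have fD: "finite D" using D(1) T finite_subset by fastforce
    have "\<exists>m. rainbow_matching ({} \<union> D) E m"
      by (rule add_flexible[OF fD _ none, where s = s and V = V]) (use D E in auto)
    then show "\<exists>m. rainbow_matching D E m" by simp
  qed auto
  define P where "P k \<longleftrightarrow> (\<exists>C v. C \<subseteq> ?N \<and> card C = k \<and> inj_on v C \<and> (\<forall>i\<in>C. v i \<in> ?B i))" for k
  have bound: "k \<le> s" if Pk: "P k" for k
  proof -
    obtain C v where C: "C \<subseteq> ?N" "card C = k" "inj_on v C" "\<forall>i\<in>C. v i \<in> ?B i"
      using Pk unfolding P_def by blast
    have "card C \<le> s"
    proof (rule noM')
      fix D assume D: "D \<subseteq> C" "card D = s + 1"
      have "D \<subseteq> T" using D(1) C(1) by auto
      then have fD: "finite D" using T finite_subset by blast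
      have "\<exists>m. rainbow_matching ({} \<union> D) E m"
        by (rule add_representatives[OF fD _ none, where s = s and v = v and V = V])
          (use D C E inj_on_subset[OF C(3) D(1)] in auto)
      then show "\<exists>m. rainbow_matching D E m" by simp
    qed (use C in auto)
    then show ?thesis using C(2) by simp
  qed
  have "P 0" unfolding P_def by (intro exI[of _ "{}"]) auto
  then obtain k where k: "P k" "\<And>l. P l \<Longrightarrow> l \<le> k"
    using Nat.ex_has_greatest_nat[of P 0 s] bound by blast
  then obtain C v where C: "C \<subseteq> ?N" "card C = k" "inj_on v C" "\<forall>i\<in>C. v i \<in> ?B i"
    unfolding P_def by blast
  have fC: "finite C" using C(1) T finite_subset by fastforce
  have "?B i \<subseteq> v ` C" if i: "i \<in> ?N - C" for i
  proof
    fix x assume x: "x \<in> ?B i"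
    show "x \<in> v ` C"
    proof (rule ccontr)
      assume nx: "x \<notin> v ` C"
      have "P (k + 1)" unfolding P_def
      proof (intro exI conjI)
        show "insert i C \<subseteq> ?N" using i C(1) by auto
        show "card (insert i C) = k + 1" using i C(2) fC by simp
        show "inj_on (v(i := x)) (insert i C)" using nx i C(3) by (auto simp: inj_on_def)
        show "\<forall>j\<in>insert i C. (v(i := x)) j \<in> ?B j" using x i C(4) by auto
      qed
      with k(2) show False by fastforce
    qed
  qed
  then have "\<forall>i\<in>?N - C. \<not> flexible s (E i) \<and> high s (E i) \<subseteq> v ` C" by blast
  moreover have "v ` C \<subseteq> V" using C(1,4) E high_subset by fastforce
  moreover have "card (v ` C) \<le> s" using card_image_le[OF fC, of v] C(2) bound[OF k(1)] by simp
  moreover have "card T \<le> card (?N - C) + 2 * s"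
  proof -
    have "T = (?N - C) \<union> (?Fl \<union> C)" using C(1) by auto
    then have "card T \<le> card (?N - C) + card (?Fl \<union> C)" using card_Un_le[of "?N - C" "?Fl \<union> C"] by simp
    also have "card (?Fl \<union> C) \<le> card ?Fl + card C" by (rule card_Un_le)
    finally show ?thesis using \<open>card ?Fl \<le> s\<close> C(2) bound[OF k(1)] by linarith
  qed
  moreover have "?N - C \<subseteq> T" by auto
  ultimately show ?thesis by blast
qed

lemma card_edges_split:
  assumes X: "edges_on V X" and V: "finite V"
  shows "card X \<le> card {e \<in> X. e \<inter> W = {}} + card {e \<in> X. e \<subseteq> W} + (\<Sum>u\<in>V - W. card (nbrs X u \<inter> W))"
proof -
  let ?A = "{e \<in> X. e \<inter> W = {}}" and ?I = "{e \<in> X. e \<subseteq> W}"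
  let ?C = "{e \<in> X. e \<inter> W \<noteq> {} \<and> \<not> e \<subseteq> W}"
  have fX: "finite X" using finite_edges_on[OF X V] .
  have fn: "finite (nbrs X u)" for u using nbrs_subset[OF X] V by (rule finite_subset)
  have "?C \<subseteq> (\<Union>u\<in>V - W. (\<lambda>w. {u, w}) ` (nbrs X u \<inter> W))"
  proof
    fix e assume e: "e \<in> ?C"
    then have "e \<in> X" by simp
    then obtain a b where ab: "e = {a, b}" "a \<in> V" "b \<in> V" using edges_onE[OF X] by metis
    have "\<exists>u w. e = {u, w} \<and> u \<in> V - W \<and> w \<in> W" using e ab by (cases "a \<in> W") auto
    then obtain u w where uw: "e = {u, w}" "u \<in> V - W" "w \<in> W" by blast
    moreover have "w \<in> nbrs X u" using e uw by (auto simp: nbrs_def)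
    ultimately show "e \<in> (\<Union>u\<in>V - W. (\<lambda>w. {u, w}) ` (nbrs X u \<inter> W))" by blast
  qed
  then have "card ?C \<le> card (\<Union>u\<in>V - W. (\<lambda>w. {u, w}) ` (nbrs X u \<inter> W))"
    by (rule card_mono[rotated]) (use V fn in auto)
  also have "\<dots> \<le> (\<Sum>u\<in>V - W. card ((\<lambda>w. {u, w}) ` (nbrs X u \<inter> W)))"
    by (rule card_UN_le) (use V in auto)
  also have "\<dots> \<le> (\<Sum>u\<in>V - W. card (nbrs X u \<inter> W))"
    by (intro sum_mono card_image_le) (use fn in auto)
  finally have C: "card ?C \<le> (\<Sum>u\<in>V - W. card (nbrs X u \<inter> W))" .
  have U: "X = (?A \<union> ?I) \<union> ?C" by auto
  have "card X \<le> card (?A \<union> ?I) + card ?C" by (subst U) (rule card_Un_le)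
  also have "card (?A \<union> ?I) \<le> card ?A + card ?I" by (rule card_Un_le)
  finally show ?thesis using C by linarith
qed

lemma card_edges_inside_le: "finite W \<Longrightarrow> card {e \<in> X. e \<subseteq> W} \<le> 2 ^ card W"
  by (rule order_trans[OF card_mono[of "Pow W"]]) (auto simp: card_Pow)

section \<open>Graphs without a small independent covering\<close>

lemma attainable_above_ex:
  assumes "t > 0" "attainable t n \<H> e0" "ex_rainbow t n \<H> < e"
    and "collection V t G" "card V = n" "\<And>i. i \<in> {1..t} \<Longrightarrow> e \<le> int (card (edges (G i)))"
  shows "\<not> rainbow_free V t G \<H>"
proof
  assume "rainbow_free V t G \<H>"
  then have "attainable t n \<H> e" unfolding attainable_def using assms(4-6) by blast
  from ex_rainbow_greatest(2)[OF assms(1,2) this] assms(3) show False by simp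
qed

text \<open>If some attainable value were larger, then \<open>common_cover\<close> provides a set \<open>S\<close> of \<open>s\<close> vertices that
  meets all edges. At most \<open>s * (n - s)\<close> edges of a colour leave \<open>S\<close>, so too many lie inside \<open>S\<close> and
  \<open>S\<close> contains a rainbow copy of \<open>F\<close> minus an independent set. As at most \<open>2 ^ s\<close> edges lie inside
  \<open>S\<close>, only boundedly many vertices outside are not joined to all of \<open>S\<close> in all colours, and the
  others allow the missing independent set to be embedded.\<close>

lemma cover_graph_upper:
  assumes F: "simple_graph F" and s: "s > 0" and t: "max (card (edges F)) (s + 1) \<le> t"
    and att0: "attainable t s (indep_deletions F) 0"
    and n: "s + t * 2 ^ s + card (verts F) + s * s + 2 * s * (3 * s + 3) < n"
    and att: "attainable t n {F, matching_graph (s + 1)} e"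
  shows "e \<le> int s * (int n - int s) + ex_rainbow t s (indep_deletions F)"
proof (rule ccontr)
  let ?ex = "ex_rainbow t s (indep_deletions F)"
  assume contra: "\<not> e \<le> int s * (int n - int s) + ?ex"
  have t0: "t > 0" using t by simp
  have ex0: "0 \<le> ?ex" using ex_rainbow_greatest(2)[OF t0 att0 att0] .
  obtain V G where G: "collection V t G" "card V = n"
      "rainbow_free V t G {F, matching_graph (s + 1)}"
      "\<forall>i\<in>{1..t}. e \<le> int (card (edges (G i)))"
    using att unfolding attainable_def by blast
  define E where "E i = edges (G i)" for i
  have V: "finite V" using G(1) by (simp add: collection_def)
  have E: "\<forall>i\<in>{1..t}. edges_on V (E i)"
    using G(1) by (auto simp: collection_def simple_graph_edges_on E_def)
  note free = rainbow_freeD[OF F G(1,3), folded E_def]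
  have sn: "int (s * (n - s)) = int s * (int n - int s)" using n by (simp add: of_nat_diff)
  have big: "int (s * (n - s)) + ?ex < int (card (E i))" if "i \<in> {1..t}" for i
    using G(4) that contra unfolding sn E_def by fastforce
  have big': "s * (n - s) < card (E i)" if "i \<in> {1..t}" for i
    using big[OF that] ex0 by linarith
  have "(s - 1) * n + 2 * s * (3 * s + 3) \<le> s * (n - s)"
  proof -
    have "s * n = (s - 1) * n + n" using s by (cases s) auto
    moreover have "s * (n - s) = s * n - s * s" by (simp add: diff_mult_distrib2)
    ultimately show ?thesis using n by linarith
  qed
  then have "\<forall>i\<in>{1..t}. (s - 1) * card V + 2 * s * (3 * s + 3) < card (E i)"
    using big' G(2) by fastforce
  then obtain S where S: "S \<subseteq> V" "card S = s" "\<forall>i\<in>{1..t}. \<forall>e\<in>E i. e \<inter> S \<noteq> {}"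
    using common_cover[OF V, of "{1..t}" s E] t s E free(2) by auto
  have fS: "finite S" using S(1) V by (rule finite_subset)
  have cVS: "card (V - S) = n - s" using card_Diff_subset[OF fS S(1)] S(2) G(2) by simp
  have fn: "finite (nbrs (E i) u)" if "i \<in> {1..t}" for i u
    using nbrs_subset[of V "E i" u] E that V finite_subset by blast
  have le_s: "card (nbrs (E i) u \<inter> S) \<le> s" for i u
    using card_mono[OF fS, of "nbrs (E i) u \<inter> S"] S(2) by simp
  have split: "card (E i) \<le> card {e \<in> E i. e \<subseteq> S} + (\<Sum>u\<in>V - S. card (nbrs (E i) u \<inter> S))"
    if i: "i \<in> {1..t}" for i
  proof -
    have "{e \<in> E i. e \<inter> S = {}} = {}" using S(3) i by auto
    then have "card {e \<in> E i. e \<inter> S = {}} = 0" by (simp only: card.empty)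
    moreover have "edges_on V (E i)" using E i by blast
    ultimately show ?thesis using card_edges_split[OF _ V, of "E i" S] by linarith
  qed
  have inside: "?ex + 1 \<le> int (card {e \<in> E i. e \<subseteq> S})" if i: "i \<in> {1..t}" for i
  proof -
    have "(\<Sum>u\<in>V - S. card (nbrs (E i) u \<inter> S)) \<le> (\<Sum>u\<in>V - S. s)" by (intro sum_mono le_s)
    then have "card (E i) \<le> card {e \<in> E i. e \<subseteq> S} + s * (n - s)"
      using split[OF i] cVS by (simp add: mult.commute)
    then show ?thesis using big[OF i] by linarith
  qed
  let ?G = "\<lambda>i. \<lparr>verts = S, edges = {e \<in> E i. e \<subseteq> S}\<rparr>"
  have col: "collection S t ?G"
    using E fS by (auto simp: collection_def simple_graph_def edges_on_def)
  have "\<not> rainbow_free S t ?G (indep_deletions F)"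
    by (rule attainable_above_ex[OF t0 att0 _ col S(2), of "?ex + 1"]) (use inside in auto)
  then obtain S' f where f: "covering F S'" "inj_on f S'" "f ` S' \<subseteq> S"
      "rainbow_map {1..t} (\<lambda>i. {e \<in> E i. e \<subseteq> S}) (edges (induced F S')) f"
    unfolding rainbow_free_indep_deletions_iff[OF F col] by auto
  have fmap: "rainbow_map {1..t} E (edges (induced F S')) f"
    using f(4) unfolding rainbow_map_def by blast
  \<comment> \<open>A vertex outside \<open>S\<close> is bad in colour \<open>i\<close> if one of its \<open>s\<close> possible edges to \<open>S\<close> is missing. Each
    bad vertex lowers the number of edges by one, which only edges inside \<open>S\<close> can compensate.\<close>
  define bad where "bad i = {u \<in> V - S. card (nbrs (E i) u \<inter> S) < s}" for i
  have fbad: "finite (bad i)" for i using V by (simp add: bad_def)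
  have bad: "card (bad i) \<le> 2 ^ s" if i: "i \<in> {1..t}" for i
  proof -
    have "(\<Sum>u\<in>V - S. card (nbrs (E i) u \<inter> S) + (if u \<in> bad i then 1 else 0)) \<le> (\<Sum>u\<in>V - S. s)"
      by (intro sum_mono) (use le_s in \<open>auto simp: bad_def Suc_le_eq\<close>)
    moreover have "(\<Sum>u\<in>V - S. if u \<in> bad i then 1 else 0) = card (bad i)"
    proof -
      have "(V - S) \<inter> {u. u \<in> bad i} = bad i" by (auto simp: bad_def)
      then show ?thesis using V by (simp add: sum.If_cases)
    qed
    ultimately have "(\<Sum>u\<in>V - S. card (nbrs (E i) u \<inter> S)) + card (bad i) \<le> s * (n - s)"
      using cVS by (simp add: sum.distrib mult.commute)
    moreover have "card {e \<in> E i. e \<subseteq> S} \<le> 2 ^ s" using card_edges_inside_le[OF fS] S(2) by simp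
    ultimately show ?thesis using split[OF i] big'[OF i] by linarith
  qed
  define A where "A = V - S - (\<Union>i\<in>{1..t}. bad i)"
  have fA: "finite A" using V by (simp add: A_def)
  have "card (\<Union>i\<in>{1..t}. bad i) \<le> (\<Sum>i\<in>{1..t}. card (bad i))" by (rule card_UN_le) simp
  also have "\<dots> \<le> (\<Sum>i\<in>{1..t}. 2 ^ s)" by (intro sum_mono bad)
  finally have "card (\<Union>i\<in>{1..t}. bad i) \<le> t * 2 ^ s" by simp
  moreover have "card (V - S) - card (\<Union>i\<in>{1..t}. bad i) \<le> card A"
    unfolding A_def by (rule diff_card_le_card_Diff) (use fbad in auto)
  ultimately have cA: "card (verts F) \<le> card A" using cVS n by linarith
  have full: "\<forall>a\<in>A. \<forall>x\<in>S. card (edges F) \<le> card (colours_of {1..t} E {a, x})"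
  proof (intro ballI)
    fix a x assume a: "a \<in> A" and x: "x \<in> S"
    have "{a, x} \<in> E i" if i: "i \<in> {1..t}" for i
    proof -
      have "\<not> card (nbrs (E i) a \<inter> S) < s" using a i by (auto simp: A_def bad_def)
      then have "nbrs (E i) a \<inter> S = S" using S(2) by (intro card_seteq[OF fS]) auto
      then show ?thesis using x by (auto simp: nbrs_def)
    qed
    then have "colours_of {1..t} E {a, x} = {1..t}" by (auto simp: colours_of_def)
    then show "card (edges F) \<le> card (colours_of {1..t} E {a, x})" using t by simp
  qed
  have "\<exists>g. inj_on g (verts F) \<and> g ` verts F \<subseteq> S \<union> A \<and> rainbow_map {1..t} E (edges F) g"
    by (rule rainbow_map_from_cover[OF F f(1-3) fmap _ fA _ cA full]) (auto simp: A_def)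
  then obtain g where g: "inj_on g (verts F)" "g ` verts F \<subseteq> S \<union> A"
      "rainbow_map {1..t} E (edges F) g" by blast
  have "g ` verts F \<subseteq> V" using g(2) S(1) by (auto simp: A_def)
  from free(1)[OF g(1) this] g(3) show False by blast
qed

lemma ex_rainbow_eq_cover:
  assumes F: "simple_graph F" and s: "s > 0" and t: "max (card (edges F)) (s + 1) \<le> t"
    and free: "indep_cover_free F s"
    and n: "s + t * 2 ^ s + card (verts F) + s * s + 2 * s * (3 * s + 3) < n"
  shows "ex_rainbow t n {F, matching_graph (s + 1)} =
    int s * (int n - int s) + ex_rainbow t s (indep_deletions F)"
proof (rule ex_rainbow_eqI)
  have t0: "t > 0" using t by simp
  have att0: "attainable t s (indep_deletions F) 0"
    by (rule attainable_zero_indep_deletions[OF F free])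
  show "attainable t n {F, matching_graph (s + 1)}
      (int s * (int n - int s) + ex_rainbow t s (indep_deletions F))"
    by (rule join_attainable[OF F _ _ ex_rainbow_greatest(1)[OF t0 att0]]) (use n in auto)
  show "e \<le> int s * (int n - int s) + ex_rainbow t s (indep_deletions F)"
    if "attainable t n {F, matching_graph (s + 1)} e" for e
    by (rule cover_graph_upper[OF F s t att0 n that])
qed

section \<open>Bipartite graphs with a small colour class\<close>

text \<open>Fewer than \<open>p - 1\<close> vertices with \<open>m \<le> cnt w\<close>, or fewer than \<open>p\<close> vertices with \<open>0 < cnt w\<close>, would make
  the sum too small.\<close>

lemma spread_subset_exists:
  fixes cnt :: "nat \<Rightarrow> nat"
  assumes W: "finite W" "card W \<le> s" and le: "\<forall>w\<in>W. cnt w \<le> \<tau>" and m: "s * m \<le> \<tau>" and p: "p > 0"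
    and sum: "(p - 1) * \<tau> < (\<Sum>w\<in>W. cnt w)"
  shows "\<exists>P x. P \<subseteq> W \<and> card P = p \<and> x \<in> P \<and> 0 < cnt x \<and> (\<forall>y\<in>P - {x}. m \<le> cnt y)"
proof -
  let ?H = "{w \<in> W. m \<le> cnt w}" and ?R = "{w \<in> W. 0 < cnt w}"
  have H: "p - 1 \<le> card ?H"
  proof (rule ccontr)
    assume "\<not> p - 1 \<le> card ?H"
    then have lt: "card ?H + 1 \<le> p - 1" by simp
    have "(\<Sum>w\<in>W. cnt w) \<le> (\<Sum>w\<in>W. (if m \<le> cnt w then \<tau> else 0) + m)"
      by (intro sum_mono) (use le in \<open>auto intro: trans_le_add1\<close>)
    also have "\<dots> = card ?H * \<tau> + card W * m"
      using W(1) by (simp add: sum.distrib sum.If_cases Int_def)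
    also have "\<dots> \<le> card ?H * \<tau> + \<tau>"
      using order_trans[OF mult_le_mono1[OF W(2)] m] by simp
    also have "\<dots> = (card ?H + 1) * \<tau>" by simp
    also have "\<dots> \<le> (p - 1) * \<tau>" by (rule mult_le_mono1[OF lt])
    finally show False using sum by simp
  qed
  have R: "p \<le> card ?R"
  proof (rule ccontr)
    assume "\<not> p \<le> card ?R"
    then have lt: "card ?R \<le> p - 1" by simp
    have "(\<Sum>w\<in>W. cnt w) \<le> (\<Sum>w\<in>W. if 0 < cnt w then \<tau> else 0)"
      by (intro sum_mono) (use le in auto)
    also have "\<dots> = card ?R * \<tau>" using W(1) by (simp add: sum.If_cases Int_def)
    also have "\<dots> \<le> (p - 1) * \<tau>" by (rule mult_le_mono1[OF lt])
    finally show False using sum by simp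
  qed
  obtain Q where Q: "Q \<subseteq> ?H" "card Q = p - 1" "finite Q"
    using obtain_subset_with_card_n[OF H] by blast
  have "\<not> ?R \<subseteq> Q" using card_mono[OF Q(3), of ?R] R Q(2) p by auto
  then obtain x where x: "x \<in> ?R" "x \<notin> Q" by blast
  have "card (insert x Q) = p" using Q x(2) p by simp
  moreover have "insert x Q \<subseteq> W" using Q(1) x(1) by auto
  moreover have "\<forall>y\<in>insert x Q - {x}. m \<le> cnt y" using Q(1) by auto
  ultimately show ?thesis using x(1) by blast
qed

text \<open>Double counting of the coloured edges between \<open>u\<close> and \<open>W\<close>.\<close>

lemma sum_card_nbrs_eq:
  assumes "finite T" "finite W"
  shows "(\<Sum>i\<in>T. card (nbrs (E i) u \<inter> W)) = (\<Sum>w\<in>W. card (colours_of T E {u, w}))"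
proof -
  have "card (nbrs (E i) u \<inter> W) = (\<Sum>w\<in>W. if {u, w} \<in> E i then 1 else 0)" for i
    using assms(2) by (simp add: sum.If_cases nbrs_def Int_def conj_commute)
  moreover have "card (colours_of T E {u, w}) = (\<Sum>i\<in>T. if {u, w} \<in> E i then 1 else 0)" for w
    using assms(1) by (simp add: sum.If_cases colours_of_def Int_def conj_commute)
  ultimately show ?thesis by (simp only: sum.swap[of _ T W])
qed

lemma colours_of_mono: "T \<subseteq> T' \<Longrightarrow> finite T' \<Longrightarrow> card (colours_of T E e) \<le> card (colours_of T' E e)"
  by (rule card_mono) (auto simp: colours_of_def)

lemma card_colours_of_le: "finite T \<Longrightarrow> card (colours_of T E e) \<le> card T"
  by (rule card_mono) (auto simp: colours_of_def)

text \<open>The edge from \<open>u\<close> to \<open>x\<close> may have no colour other than \<open>i\<close>, the edges to the rest of \<open>P\<close> have at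
  least \<open>m\<close> colours. Several vertices \<open>u\<close> of this kind can be used in one rainbow copy as long as
  their special colours \<open>i\<close> differ.\<close>

definition spread_at ::
  "nat set \<Rightarrow> (nat \<Rightarrow> nat set set) \<Rightarrow> nat \<Rightarrow> nat \<Rightarrow> nat \<Rightarrow> nat set \<Rightarrow> nat \<Rightarrow> bool" where
  "spread_at T E m u i P x \<longleftrightarrow>
     x \<in> P \<and> {u, x} \<in> E i \<and> (\<forall>y\<in>P - {x}. m \<le> card (colours_of T E {u, y}))"

text \<open>The pairs \<open>(u, i)\<close> are found one at a time. Discarding the vertices and colours already used costs
  every other colour at most \<open>s * N\<close> edges, so the remaining vertices still have more than \<open>p - 1\<close>
  neighbours in \<open>W\<close> on average, and a vertex above the average has the required neighbours by
  \<open>spread_subset_exists\<close>.\<close>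

lemma spread_system:
  assumes T: "finite T" "N + s * m < card T" and U: "finite U" and W: "finite W" "card W \<le> s"
    and p: "p > 0"
    and many: "\<forall>i\<in>T. (p - 1) * card U + s * N < (\<Sum>u\<in>U. card (nbrs (E i) u \<inter> W))"
  shows "k \<le> N \<Longrightarrow> \<exists>Z\<subseteq>U \<times> T. card Z = k \<and> inj_on fst Z \<and> inj_on snd Z \<and>
    (\<forall>z\<in>Z. \<exists>P x. P \<subseteq> W \<and> card P = p \<and> spread_at T E m (fst z) (snd z) P x)"
proof (induction k)
  case 0
  show ?case by (intro exI[of _ "{}"]) auto
next
  case (Suc k)
  then obtain Z where Z: "Z \<subseteq> U \<times> T" "card Z = k" "inj_on fst Z" "inj_on snd Z"
    "\<forall>z\<in>Z. \<exists>P x. P \<subseteq> W \<and> card P = p \<and> spread_at T E m (fst z) (snd z) P x" by auto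
  have fZ: "finite Z" using Z(1) by (rule finite_subset) (use U T in auto)
  let ?T = "T - snd ` Z" and ?U = "U - fst ` Z"
  have fT: "finite ?T" and fU: "finite ?U" using T U by auto
  have cT: "s * m < card ?T"
    using diff_card_le_card_Diff[of "snd ` Z" T] card_image[OF Z(4)] fZ Z(2) T(2) Suc.prems
    by simp
  have "(p - 1) * card ?U < (\<Sum>u\<in>?U. card (nbrs (E i) u \<inter> W))" if i: "i \<in> ?T" for i
  proof -
    have le: "card (nbrs (E i) u \<inter> W) \<le> s" for u
      using card_mono[OF W(1), of "nbrs (E i) u \<inter> W"] W(2) by simp
    have "(\<Sum>u\<in>U. card (nbrs (E i) u \<inter> W)) \<le>
        (\<Sum>u\<in>?U \<union> fst ` Z. card (nbrs (E i) u \<inter> W))"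
      by (rule sum_mono2) (use U fZ in auto)
    also have "\<dots> = (\<Sum>u\<in>?U. card (nbrs (E i) u \<inter> W)) + (\<Sum>u\<in>fst ` Z. card (nbrs (E i) u \<inter> W))"
      by (rule sum.union_disjoint) (use U fZ in auto)
    also have "(\<Sum>u\<in>fst ` Z. card (nbrs (E i) u \<inter> W)) \<le> (\<Sum>u\<in>fst ` Z. s)"
      by (intro sum_mono le)
    also have "\<dots> = k * s" using card_image[OF Z(3)] Z(2) by simp
    also have "\<dots> \<le> s * N" using Suc.prems by (simp add: mult.commute)
    finally have "(\<Sum>u\<in>U. card (nbrs (E i) u \<inter> W)) \<le> (\<Sum>u\<in>?U. card (nbrs (E i) u \<inter> W)) + s * N"
      by simp
    moreover have "(p - 1) * card U + s * N < (\<Sum>u\<in>U. card (nbrs (E i) u \<inter> W))"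
      using many i by blast
    moreover have "(p - 1) * card ?U \<le> (p - 1) * card U"
      by (intro mult_le_mono2 card_mono U) auto
    ultimately show ?thesis by linarith
  qed
  moreover have "?T \<noteq> {}" using cT by (metis card.empty not_less_zero)
  ultimately have "(\<Sum>i\<in>?T. (p - 1) * card ?U) < (\<Sum>i\<in>?T. \<Sum>u\<in>?U. card (nbrs (E i) u \<inter> W))"
    using fT by (intro sum_strict_mono) blast+
  also have "\<dots> = (\<Sum>u\<in>?U. \<Sum>i\<in>?T. card (nbrs (E i) u \<inter> W))" by (rule sum.swap)
  finally have tot: "card ?U * ((p - 1) * card ?T) < (\<Sum>u\<in>?U. \<Sum>i\<in>?T. card (nbrs (E i) u \<inter> W))"
    by (simp add: algebra_simps)
  have "\<exists>u\<in>?U. (p - 1) * card ?T < (\<Sum>i\<in>?T. card (nbrs (E i) u \<inter> W))"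
  proof (rule ccontr)
    assume "\<not> ?thesis"
    then have "(\<Sum>u\<in>?U. \<Sum>i\<in>?T. card (nbrs (E i) u \<inter> W)) \<le> (\<Sum>u\<in>?U. (p - 1) * card ?T)"
      by (intro sum_mono) (simp add: not_less)
    with tot show False by simp
  qed
  then obtain u where u: "u \<in> ?U" "(p - 1) * card ?T < (\<Sum>w\<in>W. card (colours_of ?T E {u, w}))"
    using sum_card_nbrs_eq[OF fT W(1)] by metis
  obtain P x where P: "P \<subseteq> W" "card P = p" "x \<in> P" "0 < card (colours_of ?T E {u, x})"
      "\<forall>y\<in>P - {x}. m \<le> card (colours_of ?T E {u, y})"
    using spread_subset_exists[OF W _ _ p u(2), of m] card_colours_of_le[OF fT] cT by fastforce
  have "colours_of ?T E {u, x} \<noteq> {}" using P(4) by auto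
  then obtain i where i: "i \<in> ?T" "{u, x} \<in> E i" by (auto simp: colours_of_def)
  have "spread_at T E m u i P x"
    unfolding spread_at_def
    using P i(2) order_trans[OF _ colours_of_mono[OF Diff_subset T(1)]] by blast
  then have "\<forall>z\<in>insert (u, i) Z. \<exists>P x. P \<subseteq> W \<and> card P = p \<and> spread_at T E m (fst z) (snd z) P x"
    using Z(5) P(1,2) by auto
  moreover have "insert (u, i) Z \<subseteq> U \<times> T" using Z(1) u(1) i(1) by auto
  moreover have "(u, i) \<notin> Z" using u(1) by force
  then have "card (insert (u, i) Z) = Suc k" using Z(2) fZ by simp
  moreover have "inj_on fst (insert (u, i) Z)" "inj_on snd (insert (u, i) Z)"
    using Z(3,4) u(1) i(1) by (auto simp: inj_on_insert)
  ultimately show ?case by blast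
qed

lemma pigeonhole_fibre:
  assumes "finite Z" "finite Y" "f ` Z \<subseteq> Y" "card Y * q < card Z"
  shows "\<exists>y\<in>Y. q < card {z \<in> Z. f z = y}"
proof (rule ccontr)
  assume "\<not> ?thesis"
  then have le: "\<forall>y\<in>Y. card {z \<in> Z. f z = y} \<le> q" by (simp add: not_less)
  have "Z = (\<Union>y\<in>Y. {z \<in> Z. f z = y})" using assms(3) by auto
  then have "card Z \<le> (\<Sum>y\<in>Y. card {z \<in> Z. f z = y})"
    using card_UN_le[OF assms(2), of "\<lambda>y. {z \<in> Z. f z = y}"] by simp
  also have "\<dots> \<le> (\<Sum>y\<in>Y. q)" by (intro sum_mono) (use le in auto)
  finally show False using assms(4) by simp
qed

lemma two_coloring_edge:
  assumes F: "simple_graph F" and AB: "two_coloring F A B" and e: "e \<in> edges F"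
  obtains a b where "e = {a, b}" "a \<in> A" "b \<in> B"
proof -
  have "edges_on (verts F) (edges F)" using F by (simp add: simple_graph_edges_on)
  then obtain x y where xy: "e = {x, y}" "x \<in> A \<union> B" "y \<in> A \<union> B"
    using edges_onE[OF _ e] AB unfolding two_coloring_def by metis
  have "\<not> e \<subseteq> A" "\<not> e \<subseteq> B" using AB e by (auto simp: two_coloring_def independent_set_def)
  then have "x \<in> A \<and> y \<in> B \<or> x \<in> B \<and> y \<in> A" using xy by auto
  then show ?thesis using that xy(1) by (metis insert_commute)
qed

text \<open>The class \<open>A\<close> goes to \<open>P\<close> and the class \<open>B\<close> to the vertices of the system. An edge that falls on a
  special edge \<open>{u, x}\<close> receives the colour of its pair; these colours are distinct, and all other
  edges have plenty of colours.\<close>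

lemma rainbow_map_from_spread_system:
  assumes F: "simple_graph F" and AB: "two_coloring F A B" "card A = card P" "card B \<le> card Z"
    and T: "finite T" and Z: "finite Z" "Z \<subseteq> U \<times> T" "inj_on fst Z" "inj_on snd Z"
    and P: "finite P" "P \<inter> U = {}"
    and spread: "\<forall>z\<in>Z. spread_at T E (card (edges F)) (fst z) (snd z) P (x z)"
  shows "\<exists>f. inj_on f (verts F) \<and> f ` verts F \<subseteq> P \<union> U \<and> rainbow_map T E (edges F) f"
proof -
  have fF: "finite (verts F)" "finite (edges F)"
    using F finite_edges_on[of "verts F" "edges F"] by (auto simp: simple_graph_edges_on)
  have VAB: "verts F = A \<union> B" "A \<inter> B = {}" using AB(1) by (auto simp: two_coloring_def)
  have fAB: "finite A" "finite B" using fF(1) VAB by auto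
  have "\<exists>g. inj_on g A \<and> (\<forall>a\<in>A. g a \<in> P)"
    using greedy_representatives[of A "\<lambda>_. P"] fAB(1) AB(2) P(1) by auto
  then obtain g where g: "inj_on g A" "\<forall>a\<in>A. g a \<in> P" by blast
  obtain h where h: "h ` B \<subseteq> Z" "inj_on h B" using card_le_inj[OF fAB(2) Z(1) AB(3)] by metis
  define f where "f v = (if v \<in> A then g v else fst (h v))" for v
  have fB: "f b = fst (h b)" if "b \<in> B" for b using that VAB(2) by (auto simp: f_def)
  have hU: "fst (h b) \<in> U" if "b \<in> B" for b using h(1) Z(2) that by fastforce
  have hinj: "b = b'" if "b \<in> B" "b' \<in> B" "fst (h b) = fst (h b')" for b b'
  proof -
    have "h b = h b'" using inj_onD[OF Z(3) that(3)] h(1) that by blast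
    then show ?thesis using inj_onD[OF h(2)] that by blast
  qed
  have inj: "inj_on f (verts F)"
  proof (rule inj_onI)
    fix v w assume vw: "v \<in> verts F" "w \<in> verts F" "f v = f w"
    have cross: "g a \<noteq> fst (h b)" if "a \<in> A" "b \<in> B" for a b
    proof
      assume "g a = fst (h b)"
      then have "g a \<in> P \<inter> U" using bspec[OF g(2) that(1)] hU[OF that(2)] by simp
      then show False using P(2) by simp
    qed
    consider "v \<in> A" "w \<in> A" | "v \<in> A" "w \<in> B" | "v \<in> B" "w \<in> A" | "v \<in> B" "w \<in> B"
      using vw(1,2) VAB(1) by blast
    then show "v = w"
    proof cases
      case 1
      then show ?thesis using vw(3) inj_onD[OF g(1)] by (simp add: f_def)
    next
      case 2
      then show ?thesis using vw(3) cross[of v w] fB[of w] by (simp add: f_def)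
    next
      case 3
      then show ?thesis using vw(3) cross[of w v] fB[of v] by (simp add: f_def)
    next
      case 4
      then show ?thesis using vw(3) hinj fB by simp
    qed
  qed
  have im: "f ` verts F \<subseteq> P \<union> U" using g(2) hU by (auto simp: VAB(1) f_def)
  define X0 where "X0 = {e \<in> edges F. \<exists>a\<in>A. \<exists>b\<in>B. e = {a, b} \<and> g a = x (h b)}"
  define c0 where "c0 e = snd (h (THE b. b \<in> e \<inter> B))" for e
  have c0: "c0 {a, b} = snd (h b)" if "a \<in> A" "b \<in> B" for a b
  proof -
    have "(THE b'. b' \<in> {a, b} \<inter> B) = b" using that VAB(2) by (intro the_equality) auto
    then show ?thesis by (simp add: c0_def)
  qed
  have "rainbow_map T E (edges F) f"
  proof (rule rainbow_map_extend[OF T fF(2)])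
    show "X0 \<subseteq> edges F" by (auto simp: X0_def)
    show "inj_on c0 X0"
    proof (rule inj_onI)
      fix e e' assume "e \<in> X0" "e' \<in> X0" and eq: "c0 e = c0 e'"
      then obtain a b a' b' where ab: "a \<in> A" "b \<in> B" "e = {a, b}" "g a = x (h b)"
        "a' \<in> A" "b' \<in> B" "e' = {a', b'}" "g a' = x (h b')" unfolding X0_def by blast
      have "snd (h b) = snd (h b')" using eq c0 ab by simp
      then have hb: "h b = h b'" using inj_onD[OF Z(4)] h(1) ab by blast
      then have "b = b'" using inj_onD[OF h(2)] ab by blast
      moreover have "a = a'" using inj_onD[OF g(1)] ab hb by metis
      ultimately show "e = e'" using ab by simp
    qed
    have sp: "spread_at T E (card (edges F)) (f b) (snd (h b)) P (x (h b))" if "b \<in> B" for b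
      using spread h(1) that fB by auto
    show "\<forall>e\<in>X0. c0 e \<in> T \<and> f ` e \<in> E (c0 e)"
    proof
      fix e assume "e \<in> X0"
      then obtain a b where ab: "a \<in> A" "b \<in> B" "e = {a, b}" "g a = x (h b)"
        unfolding X0_def by blast
      have "f ` e = {f b, x (h b)}" using ab by (auto simp: f_def)
      moreover have "snd (h b) \<in> T" using h(1) Z(2) ab(2) by fastforce
      ultimately show "c0 e \<in> T \<and> f ` e \<in> E (c0 e)"
        using sp[OF ab(2)] c0[OF ab(1,2)] ab(3) by (simp add: spread_at_def)
    qed
    show "\<forall>e\<in>edges F - X0. card (edges F) \<le> card (colours_of T E (f ` e))"
    proof
      fix e assume e: "e \<in> edges F - X0"
      then obtain a b where ab: "e = {a, b}" "a \<in> A" "b \<in> B"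
        using two_coloring_edge[OF F AB(1)] by (metis Diff_iff)
      have "g a \<noteq> x (h b)" using e ab by (auto simp: X0_def)
      then have "g a \<in> P - {x (h b)}" using g(2) ab(2) by auto
      moreover have "f ` e = {f b, g a}" using ab by (auto simp: f_def)
      ultimately show "card (edges F) \<le> card (colours_of T E (f ` e))"
        using sp[OF ab(3)] by (simp add: spread_at_def)
    qed
  qed
  then show ?thesis using inj im by blast
qed

text \<open>Nearly all edges of the colours in \<open>T\<close> go from \<open>W\<close> to the rest, so an excess over \<open>(p - 1) * n\<close> gives
  a system as in \<open>spread_system\<close>. Each of its pairs selects one of the at most \<open>2 ^ s\<close> subsets of
  \<open>W\<close>; one subset \<open>Q\<close> is selected often enough to host the other class of \<open>F\<close>.\<close>

lemma bipartite_upper: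
  assumes F: "simple_graph F" and AB: "two_coloring F A B" "card A = p" "p > 0"
    and N: "N = card (verts F) * 2 ^ s + 1"
    and t: "2 * s + N + s * card (edges F) < t"
    and att: "attainable t n {F, matching_graph (s + 1)} e"
  shows "e \<le> int ((p - 1) * n + 2 * s * (3 * s + 3) + 2 ^ s + s * N)"
proof (rule ccontr)
  assume contra: "\<not> ?thesis"
  obtain V G where G: "collection V t G" "card V = n"
      "rainbow_free V t G {F, matching_graph (s + 1)}"
      "\<forall>i\<in>{1..t}. e \<le> int (card (edges (G i)))"
    using att unfolding attainable_def by blast
  define E where "E i = edges (G i)" for i
  have V: "finite V" using G(1) by (simp add: collection_def)
  have E: "\<forall>i\<in>{1..t}. edges_on V (E i)"
    using G(1) by (auto simp: collection_def simple_graph_edges_on E_def)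
  note free = rainbow_freeD[OF F G(1,3), folded E_def]
  obtain T W where TW: "T \<subseteq> {1..t}" "W \<subseteq> V" "card W \<le> s" "t \<le> card T + 2 * s"
      "\<forall>i\<in>T. \<not> flexible s (E i) \<and> high s (E i) \<subseteq> W"
    using common_high_vertices[OF V _ E, of s] free(2) by auto
  have fT: "finite T" using TW(1) finite_subset by blast
  have fW: "finite W" using TW(2) V by (rule finite_subset)
  let ?U = "V - W"
  have many: "\<forall>i\<in>T. (p - 1) * card ?U + s * N < (\<Sum>u\<in>?U. card (nbrs (E i) u \<inter> W))"
  proof
    fix i assume i: "i \<in> T"
    then have Ei: "edges_on V (E i)" using E TW(1) by blast
    have "card (E i) \<le> card {e \<in> E i. e \<inter> W = {}} + card {e \<in> E i. e \<subseteq> W} +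
        (\<Sum>u\<in>?U. card (nbrs (E i) u \<inter> W))"
      by (rule card_edges_split[OF Ei V])
    moreover have "card {e \<in> E i. e \<inter> W = {}} \<le> 2 * s * (3 * s + 3)"
      by (rule nonflexible_few_edges_avoid_high[OF Ei V]) (use TW(5) i in auto)
    moreover have "card {e \<in> E i. e \<subseteq> W} \<le> 2 ^ s"
      by (rule order_trans[OF card_edges_inside_le[OF fW] power_increasing[OF TW(3)]]) simp
    moreover have "int ((p - 1) * n + 2 * s * (3 * s + 3) + 2 ^ s + s * N) < int (card (E i))"
      using contra G(4) i TW(1) unfolding E_def by fastforce
    moreover have "(p - 1) * card ?U \<le> (p - 1) * n"
      using card_mono[OF V, of ?U] G(2) by (intro mult_le_mono2) auto
    ultimately show "(p - 1) * card ?U + s * N < (\<Sum>u\<in>?U. card (nbrs (E i) u \<inter> W))" by linarith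
  qed
  have cT: "N + s * card (edges F) < card T" using t TW(4) by linarith
  have fU: "finite ?U" using V by simp
  obtain Z where Z: "Z \<subseteq> ?U \<times> T" "card Z = N" "inj_on fst Z" "inj_on snd Z"
      "\<forall>z\<in>Z. \<exists>P x. P \<subseteq> W \<and> card P = p \<and> spread_at T E (card (edges F)) (fst z) (snd z) P x"
    using spread_system[OF fT cT fU fW TW(3) AB(3) many, of N] by auto
  then obtain P x where P: "\<forall>z\<in>Z. P z \<subseteq> W \<and> card (P z) = p \<and>
      spread_at T E (card (edges F)) (fst z) (snd z) (P z) (x z)"
    by metis
  have fZ: "finite Z" using Z(1) by (rule finite_subset) (use fU fT in auto)
  have "card (Pow W) * card (verts F) \<le> 2 ^ s * card (verts F)"
    unfolding card_Pow[OF fW] by (intro mult_le_mono1 power_increasing TW(3)) simp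
  also have "\<dots> < card Z" using Z(2) N by simp
  finally have "card (Pow W) * card (verts F) < card Z" .
  moreover have "P ` Z \<subseteq> Pow W" "finite (Pow W)" using P fW by auto
  ultimately obtain Q where Q: "Q \<in> Pow W" "card (verts F) < card {z \<in> Z. P z = Q}"
    using pigeonhole_fibre[OF fZ] by metis
  let ?Z = "{z \<in> Z. P z = Q}"
  have "?Z \<noteq> {}" using Q(2) by (metis card.empty not_less_zero)
  then have cQ: "card A = card Q" using P AB(2) by auto
  have "card B \<le> card (verts F)"
    using AB(1) F by (intro card_mono) (auto simp: two_coloring_def simple_graph_def)
  then have cB: "card B \<le> card ?Z" using Q(2) by simp
  have "\<exists>f. inj_on f (verts F) \<and> f ` verts F \<subseteq> Q \<union> ?U \<and> rainbow_map T E (edges F) f"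
  proof (rule rainbow_map_from_spread_system[OF F AB(1) cQ cB fT])
    show "inj_on fst ?Z" "inj_on snd ?Z" using Z(3,4) by (auto intro: inj_on_subset)
    show "finite Q" "Q \<inter> ?U = {}" using Q(1) fW finite_subset by auto
    show "finite ?Z" "?Z \<subseteq> ?U \<times> T" using fZ Z(1) by auto
    show "\<forall>z\<in>?Z. spread_at T E (card (edges F)) (fst z) (snd z) Q (x z)" using P by auto
  qed
  then obtain f where f: "inj_on f (verts F)" "f ` verts F \<subseteq> Q \<union> ?U" "rainbow_map T E (edges F) f"
    by blast
  have "f ` verts F \<subseteq> V" using f(2) Q(1) TW(2) by auto
  from free(1)[OF f(1) this] rainbow_map_mono[OF f(3) TW(1)] show False by blast
qed

lemma min_class_coloring:
  assumes "bipartite F"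
  shows "\<exists>A B. two_coloring F A B \<and> card A = min_class F"
proof -
  have "\<exists>k A B. two_coloring F A B \<and> card A = k" using assms by (auto simp: bipartite_def)
  then show ?thesis unfolding min_class_def by (rule LeastI_ex)
qed

lemma min_class_pos:
  assumes F: "simple_graph F" "bipartite F" "edges F \<noteq> {}"
  shows "0 < min_class F"
proof -
  obtain A B where AB: "two_coloring F A B" "card A = min_class F"
    using min_class_coloring[OF F(2)] by blast
  obtain e where "e \<in> edges F" using F(3) by blast
  then obtain a b where "a \<in> A" using two_coloring_edge[OF F(1) AB(1)] by metis
  moreover have "finite A"
    using AB(1) F(1) finite_subset[of A "verts F"] by (auto simp: two_coloring_def simple_graph_def)
  ultimately show ?thesis using AB(2) card_gt_0_iff[of A] by auto
qed

text \<open>The lower bound is the join of an empty collection on \<open>p - 1\<close> vertices.\<close>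

lemma bipartite_asymptotics:
  assumes F: "simple_graph F" "bipartite F" "edges F \<noteq> {}" and p: "p = min_class F" "p \<le> s"
    and t: "2 * s + (card (verts F) * 2 ^ s + 1) + s * card (edges F) < t"
  shows "(\<lambda>n. real_of_int (ex_rainbow t n {F, matching_graph (s + 1)})
            - (real p - 1) * real n) \<in> O(\<lambda>n. 1)"
proof -
  let ?ex = "\<lambda>n. ex_rainbow t n {F, matching_graph (s + 1)}"
  define K where "K = 2 * s * (3 * s + 3) + 2 ^ s + s * (card (verts F) * 2 ^ s + 1)"
  define C where "C = K + (p - 1) * (p - 1)"
  obtain A B where AB: "two_coloring F A B" "card A = p" using min_class_coloring[OF F(2)] p(1) by blast
  have p0: "p > 0" using min_class_pos[OF F] p(1) by simp
  have t0: "t > 0" using t by simp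
  have "indep_cover_free F (p - 1)" by (rule indep_cover_free_min_class[OF F(1)]) (use p(1) p0 in simp)
  then have att0: "attainable t (p - 1) (indep_deletions F) 0"
    by (rule attainable_zero_indep_deletions[OF F(1)])
  have bound: "\<bar>real_of_int (?ex n) - (real p - 1) * real n\<bar> \<le> real C" if n: "p - 1 \<le> n" for n
  proof -
    have low: "attainable t n {F, matching_graph (s + 1)} (int (p - 1) * (int n - int (p - 1)) + 0)"
      by (rule join_attainable[OF F(1) _ n att0]) (use p in simp)
    note gr = ex_rainbow_greatest[OF t0 low]
    have "?ex n \<le> int ((p - 1) * n + K)"
      using bipartite_upper[OF F(1) AB p0 refl t gr(1)] unfolding K_def by (simp only: add.assoc)
    moreover have "int K \<le> int C" by (simp only: C_def of_nat_le_iff le_add1)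
    ultimately have up: "?ex n \<le> int (p - 1) * int n + int C" by simp
    have "int (p - 1) * (int n - int (p - 1)) \<le> ?ex n" using gr(2)[OF low] by simp
    then have lo: "int (p - 1) * int n - int C \<le> ?ex n"
      unfolding C_def by (simp add: right_diff_distrib)
    have pr: "real_of_int (int (p - 1) * int n) = (real p - 1) * real n" using p0 by (simp add: of_nat_diff)
    have "real_of_int (?ex n) \<le> (real p - 1) * real n + real C"
      using up unfolding pr[symmetric] by (metis of_int_add of_int_le_iff of_int_of_nat_eq)
    moreover have "(real p - 1) * real n - real C \<le> real_of_int (?ex n)"
      using lo unfolding pr[symmetric] by (metis of_int_diff of_int_le_iff of_int_of_nat_eq)
    ultimately show ?thesis by linarith
  qed
  show ?thesis
  proof (rule bigoI[where c = "real C"])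
    show "\<forall>\<^sub>F n in sequentially. norm (real_of_int (?ex n) - (real p - 1) * real n) \<le> real C * norm (1::real)"
      unfolding eventually_sequentially using bound by (intro exI[of _ "p - 1"]) auto
  qed
qed

section \<open>Forests and trees\<close>

definition path_in :: "nat set set \<Rightarrow> nat list \<Rightarrow> bool" where
  "path_in X xs \<longleftrightarrow> distinct xs \<and> successively (\<lambda>a b. {a, b} \<in> X) xs"

lemma path_in_nth: "path_in X xs \<Longrightarrow> Suc i < length xs \<Longrightarrow> {xs ! i, xs ! Suc i} \<in> X"
  by (auto simp: path_in_def successively_conv_nth)

lemma path_in_drop: "path_in X xs \<Longrightarrow> path_in X (drop i xs)"
  by (auto simp: path_in_def successively_conv_nth)

lemma simple_graph_cycle:
  assumes "k \<ge> 3"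
  shows "simple_graph (cycle_graph k)"
proof -
  have "card {i, Suc i mod k} = 2" if "i < k" for i
  proof -
    have "i \<noteq> Suc i mod k" using assms that by (cases "Suc i = k") auto
    then show ?thesis by simp
  qed
  then show ?thesis using assms by (auto simp: simple_graph_def cycle_graph_def)
qed

text \<open>In contrast to trees, forests are closed under removal of vertices, which the induction in
  \<open>forest_bipartite\<close> needs.\<close>

definition forest :: "graph \<Rightarrow> bool" where
  "forest F \<longleftrightarrow> simple_graph F \<and> (\<forall>k\<ge>3. \<not> contains_copy F (cycle_graph k))"

text \<open>A chord would close a cycle with the part of the path between its ends.\<close>

lemma forest_path_no_chord:
  assumes F: "forest F" and xs: "path_in (edges F) xs" "set xs \<subseteq> verts F" and ij: "i + 2 \<le> j" "j < length xs"
  shows "{xs ! i, xs ! j} \<notin> edges F"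
proof
  assume e: "{xs ! i, xs ! j} \<in> edges F"
  let ?ys = "drop i xs" and ?k = "j - i + 1"
  have ys: "path_in (edges F) ?ys" by (rule path_in_drop[OF xs(1)])
  have len: "?k \<le> length ?ys" using ij by simp
  have k3: "3 \<le> ?k" using ij by simp
  have "contains_copy F (cycle_graph ?k)"
  proof -
    have "inj_on ((!) ?ys) {..<?k}"
      using ys len unfolding path_in_def by (auto intro: inj_on_nth)
    moreover have "(!) ?ys ` {..<?k} \<subseteq> verts F"
    proof
      fix v assume "v \<in> (!) ?ys ` {..<?k}"
      then obtain l where "l < ?k" "v = ?ys ! l" by blast
      then have "v \<in> set ?ys" using len nth_mem[OF less_le_trans] by blast
      then show "v \<in> verts F" using set_drop_subset xs(2) by fastforce
    qed
    moreover have "(!) ?ys ` d \<in> edges F" if d: "d \<in> edges (cycle_graph ?k)" for d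
    proof -
      obtain l where l: "d = {l, Suc l mod ?k}" "l < ?k" using d by (auto simp: cycle_graph_def)
      show ?thesis
      proof (cases "Suc l = ?k")
        case True
        then have "d = {j - i, 0}" using l by auto
        then show ?thesis using e ij by (simp add: insert_commute)
      next
        case False
        then have "Suc l < ?k" using l(2) by simp
        then have "d = {l, Suc l}" "Suc l < length ?ys" using l(1) len by auto
        then show ?thesis using path_in_nth[OF ys] by simp
      qed
    qed
    ultimately show "contains_copy F (cycle_graph ?k)"
      unfolding contains_copy_iff[OF simple_graph_cycle[OF k3]]
      by (intro exI[of _ "(!) ?ys"]) (auto simp: cycle_graph_def)
  qed
  then show False using F k3 unfolding forest_def by blast
qed

lemma forest_longest_path:
  assumes F: "forest F" and e: "{u, x} \<in> edges F"
  shows "\<exists>xs. path_in (edges F) xs \<and> set xs \<subseteq> verts F \<and> 2 \<le> length xs \<and>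
    (\<forall>ys. path_in (edges F) ys \<longrightarrow> set ys \<subseteq> verts F \<longrightarrow> length ys \<le> length xs)"
proof -
  have fin: "finite (verts F)" and Fe: "edges_on (verts F) (edges F)"
    using F by (auto simp: forest_def simple_graph_edges_on)
  let ?Q = "\<lambda>k. \<exists>xs. path_in (edges F) xs \<and> set xs \<subseteq> verts F \<and> length xs = k"
  have bound: "\<forall>k. ?Q k \<longrightarrow> k \<le> card (verts F)"
  proof (intro allI impI)
    fix k assume "?Q k"
    then obtain xs where xs: "distinct xs" "set xs \<subseteq> verts F" "length xs = k"
      by (auto simp: path_in_def)
    then show "k \<le> card (verts F)" using card_mono[OF fin xs(2)] distinct_card[OF xs(1)] by simp
  qed
  have "card {u, x} = 2" "u \<in> verts F" "x \<in> verts F" using Fe e by (auto simp: edges_on_def)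
  then have "u \<noteq> x" by auto
  then have Q2: "?Q 2"
    using e \<open>u \<in> verts F\<close> \<open>x \<in> verts F\<close> by (intro exI[of _ "[u, x]"]) (auto simp: path_in_def)
  obtain k where k: "?Q k" "\<forall>l. ?Q l \<longrightarrow> l \<le> k"
    using Nat.ex_has_greatest_nat[of ?Q 2 "card (verts F)", OF Q2] bound by blast
  then obtain xs where xs: "path_in (edges F) xs" "set xs \<subseteq> verts F" "length xs = k" by blast
  moreover have "2 \<le> length xs" using k(2) Q2 xs(3) by blast
  ultimately show ?thesis using k(2) by blast
qed

text \<open>A further neighbour of the end would extend the path or close a cycle.\<close>

lemma longest_path_end:
  assumes F: "forest F" and xs: "path_in (edges F) (a # b # zs)" "set (a # b # zs) \<subseteq> verts F"
    and longest: "\<And>ys. path_in (edges F) ys \<Longrightarrow> set ys \<subseteq> verts F \<Longrightarrow> length ys \<le> length (a # b # zs)"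
  shows "nbrs (edges F) a = {b}"
proof (intro equalityI subsetI)
  let ?xs = "a # b # zs"
  have Fe: "edges_on (verts F) (edges F)" using F by (auto simp: forest_def simple_graph_edges_on)
  fix w assume "w \<in> nbrs (edges F) a"
  then have w: "{a, w} \<in> edges F" by (simp add: nbrs_def)
  then have wV: "w \<in> verts F" and "card {a, w} = 2" using Fe by (auto simp: edges_on_def)
  then have aw: "a \<noteq> w" by auto
  have "w \<in> set ?xs"
  proof (rule ccontr)
    assume "w \<notin> set ?xs"
    then have "path_in (edges F) (w # ?xs)" using xs(1) w by (auto simp: path_in_def insert_commute)
    from longest[OF this] wV xs(2) show False by simp
  qed
  then obtain j where j: "j < length ?xs" "?xs ! j = w" by (metis in_set_conv_nth)
  have "j \<noteq> 0" using j(2) aw by (metis nth_Cons_0)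
  moreover have "\<not> 2 \<le> j" using forest_path_no_chord[OF F xs, of 0 j] j w by auto
  ultimately have "j = 1" by simp
  then show "w \<in> {b}" using j(2) by simp
next
  fix w assume "w \<in> {b}"
  then show "w \<in> nbrs (edges F) a" using xs(1) by (simp add: path_in_def nbrs_def)
qed

lemma forest_leaf:
  assumes F: "forest F" and ne: "edges F \<noteq> {}"
  shows "\<exists>l y. l \<in> verts F \<and> nbrs (edges F) l = {y}"
proof -
  have "edges_on (verts F) (edges F)" using F by (simp add: forest_def simple_graph_edges_on)
  then obtain u x where e: "{u, x} \<in> edges F" using ne edges_onE by (metis ex_in_conv)
  obtain xs where xs: "path_in (edges F) xs" "set xs \<subseteq> verts F" "2 \<le> length xs"
      "\<And>ys. path_in (edges F) ys \<Longrightarrow> set ys \<subseteq> verts F \<Longrightarrow> length ys \<le> length xs"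
    using forest_longest_path[OF F e] by blast
  obtain a b zs where eq: "xs = a # b # zs"
    using xs(3) by (auto simp: Suc_le_length_iff numeral_2_eq_2)
  then show ?thesis using longest_path_end[OF F, of a b zs] xs by auto
qed

lemma forest_bipartite:
  assumes "forest F"
  shows "bipartite F"
  using assms
proof (induction "card (verts F)" arbitrary: F)
  case 0
  then have "verts F = {}" "edges_on (verts F) (edges F)"
    by (auto simp: forest_def simple_graph_edges_on)
  then have "edges F = {}" by (auto simp: edges_on_def)
  then have "two_coloring F {} (verts F)" by (simp add: two_coloring_def independent_set_def)
  then show ?case unfolding bipartite_def by blast
next
  case (Suc k)
  have F: "simple_graph F" "\<forall>k\<ge>3. \<not> contains_copy F (cycle_graph k)"
    using Suc.prems by (auto simp: forest_def)
  have fin: "finite (verts F)" and Fe: "edges_on (verts F) (edges F)"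
    using F(1) by (auto simp: simple_graph_edges_on)
  show ?case
  proof (cases "edges F = {}")
    case True
    then have "two_coloring F {} (verts F)" by (simp add: two_coloring_def independent_set_def)
    then show ?thesis unfolding bipartite_def by blast
  next
    case False
    then obtain l y where l: "l \<in> verts F" "nbrs (edges F) l = {y}"
      using forest_leaf[OF Suc.prems] by blast
    define F' where "F' = induced F (verts F - {l})"
    have vF': "verts F' = verts F - {l}" "edges F' \<subseteq> edges F" by (auto simp: F'_def induced_def)
    have sF': "simple_graph F'" unfolding F'_def by (rule simple_graph_induced[OF F(1)]) auto
    have sub: "subgraph R F" if "subgraph R F'" for R
      using that vF' unfolding subgraph_def by auto
    have "\<not> contains_copy F' (cycle_graph j)" if "j \<ge> 3" for j
      using F(2) that sub unfolding contains_copy_def by meson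
    then have "forest F'" using sF' by (simp add: forest_def)
    moreover have "k = card (verts F')" using Suc.hyps(2) l(1) fin vF'(1) by simp
    ultimately have "bipartite F'" using Suc.hyps(1) by blast
    then obtain A B where AB: "two_coloring F' A B" unfolding bipartite_def by blast
    have AB': "A \<union> B = verts F - {l}" "A \<inter> B = {}" "\<forall>e\<in>edges F'. \<not> e \<subseteq> A \<and> \<not> e \<subseteq> B"
      using AB vF' by (auto simp: two_coloring_def independent_set_def)
    have "{l, y} \<in> edges F" using l(2) by (auto simp: nbrs_def)
    then have "card {l, y} = 2" "y \<in> verts F" using Fe by (auto simp: edges_on_def)
    then have yl: "y \<in> A \<union> B" "y \<noteq> l" unfolding AB'(1) by (auto simp: card_insert_if split: if_splits)
    have edge: "e = {l, y} \<or> l \<notin> e \<and> e \<in> edges F'" if e: "e \<in> edges F" for e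
    proof (cases "l \<in> e")
      case True
      obtain a b where "e = {a, b}" using edges_onE[OF Fe e] by metis
      then obtain w where w: "e = {l, w}" using True by (auto simp: insert_commute)
      then have "w \<in> nbrs (edges F) l" using e by (simp add: nbrs_def)
      then show ?thesis using w l(2) by simp
    next
      case False
      moreover have "e \<subseteq> verts F" using e Fe by (auto simp: edges_on_def)
      ultimately show ?thesis using e by (auto simp: F'_def induced_def)
    qed
    \<comment> \<open>The leaf goes to the class that does not contain its neighbour.\<close>
    have extend: "two_coloring F (insert l C) D"
      if CD: "C \<union> D = verts F - {l}" "C \<inter> D = {}" "\<forall>e\<in>edges F'. \<not> e \<subseteq> C \<and> \<not> e \<subseteq> D" "y \<in> D"
      for C D
    proof -
      have "\<not> e \<subseteq> insert l C \<and> \<not> e \<subseteq> D" if e: "e \<in> edges F" for e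
        using edge[OF e]
      proof
        assume "e = {l, y}"
        then show ?thesis using CD(1,2,4) yl(2) by auto
      next
        assume "l \<notin> e \<and> e \<in> edges F'"
        then show ?thesis using CD(3) by (auto simp: subset_insert)
      qed
      then show ?thesis using CD(1,2) l(1) by (auto simp: two_coloring_def independent_set_def)
    qed
    show ?thesis
    proof (cases "y \<in> B")
      case True
      then show ?thesis using extend[of A B] AB' unfolding bipartite_def by blast
    next
      case False
      then have "y \<in> A" using yl(1) by simp
      then show ?thesis using extend[of B A] AB' unfolding bipartite_def by (metis Int_commute Un_commute)
    qed
  qed
qed

lemma tree_forest: "tree F \<Longrightarrow> forest F"
  by (simp add: tree_def forest_def)

lemma tree_has_edge:
  assumes F: "tree F" and two: "2 \<le> card (verts F)"
  shows "\<exists>u x. {u, x} \<in> edges F"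
proof -
  have fin: "finite (verts F)" and con: "connected_graph F"
    using F by (auto simp: tree_def simple_graph_edges_on)
  obtain u v where uv: "u \<in> verts F" "v \<in> verts F" "u \<noteq> v"
    using two card_le_Suc0_iff_eq[OF fin] by fastforce
  have "(u, v) \<in> {(x, y). {x, y} \<in> edges F}\<^sup>*" using con uv by (auto simp: connected_graph_def)
  then obtain x where "(u, x) \<in> {(x, y). {x, y} \<in> edges F}"
    using uv(3) by (metis converse_rtranclE)
  then show ?thesis by auto
qed

text \<open>The second vertex \<open>y\<close> of a longest path: a neighbour of \<open>y\<close> that is not on the path can replace
  the first vertex, so it also is the end of a longest path and hence a leaf. The exception \<open>z\<close> is
  the third vertex of the path.\<close>

lemma tree_vertex_of_leaves:
  assumes F: "tree F" and three: "3 \<le> card (verts F)"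
  shows "\<exists>y z L. y \<in> verts F \<and> nbrs (edges F) y = insert z L \<and> z \<notin> L \<and> L \<noteq> {} \<and>
    (\<forall>l\<in>L. nbrs (edges F) l = {y})"
proof -
  have Fe: "edges_on (verts F) (edges F)" and con: "connected_graph F"
    using F by (auto simp: tree_def simple_graph_edges_on)
  have FF: "forest F" by (rule tree_forest[OF F])
  obtain u x where e: "{u, x} \<in> edges F" using tree_has_edge[OF F] three by auto
  obtain xs where xs: "path_in (edges F) xs" "set xs \<subseteq> verts F" "2 \<le> length xs"
      "\<And>ys. path_in (edges F) ys \<Longrightarrow> set ys \<subseteq> verts F \<Longrightarrow> length ys \<le> length xs"
    using forest_longest_path[OF FF e] by blast
  obtain a b zs where eq: "xs = a # b # zs"
    using xs(3) by (auto simp: Suc_le_length_iff numeral_2_eq_2)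
  note path = xs(1)[unfolded eq] and sub = xs(2)[unfolded eq] and longest = xs(4)[unfolded eq]
  have na: "nbrs (edges F) a = {b}" by (rule longest_path_end[OF FF path sub longest])
  have out: "nbrs (edges F) w = {b}" if w: "w \<in> nbrs (edges F) b" "w \<notin> set (a # b # zs)" for w
  proof -
    have e: "{b, w} \<in> edges F" using w(1) by (simp add: nbrs_def)
    then have wV: "w \<in> verts F" using Fe by (auto simp: edges_on_def)
    have "path_in (edges F) (w # b # zs)"
      using path w(2) e by (auto simp: path_in_def insert_commute)
    then show ?thesis by (rule longest_path_end[OF FF]) (use sub wV longest in auto)
  qed
  show ?thesis
  proof (cases zs)
    case Nil
    have nb: "nbrs (edges F) b = {a}"
    proof (intro equalityI subsetI)
      fix w assume w: "w \<in> nbrs (edges F) b"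
      then have e: "{b, w} \<in> edges F" by (simp add: nbrs_def)
      then have wV: "w \<in> verts F" and "card {b, w} = 2" using Fe by (auto simp: edges_on_def)
      then have "b \<noteq> w" by auto
      show "w \<in> {a}"
      proof (rule ccontr)
        assume "w \<notin> {a}"
        then have "path_in (edges F) [w, b, a]"
          using path e \<open>b \<noteq> w\<close> Nil by (auto simp: path_in_def insert_commute)
        from longest[OF this] show False using sub wV Nil by simp
      qed
    next
      fix w assume "w \<in> {a}"
      then show "w \<in> nbrs (edges F) b" using path by (simp add: path_in_def nbrs_def insert_commute)
    qed
    have "verts F \<subseteq> {a, b}"
    proof
      fix v assume v: "v \<in> verts F"
      have "(a, v) \<in> {(x, y). {x, y} \<in> edges F}\<^sup>*"
        using con v sub by (auto simp: connected_graph_def)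
      then show "v \<in> {a, b}"
      proof (induction rule: rtrancl_induct)
        case (step y z)
        then have "z \<in> nbrs (edges F) y" by (simp add: nbrs_def)
        then show ?case using step.IH na nb by auto
      qed simp
    qed
    then have "card (verts F) \<le> card {a, b}" by (rule card_mono[rotated]) simp
    also have "\<dots> \<le> 2" by (simp add: card_insert_if)
    finally show ?thesis using three by simp
  next
    case (Cons z zs')
    have az: "a \<noteq> z" using path Cons by (auto simp: path_in_def)
    have zb: "z \<in> nbrs (edges F) b" using path Cons by (simp add: path_in_def nbrs_def)
    have ab: "a \<in> nbrs (edges F) b" using path by (simp add: path_in_def nbrs_def insert_commute)
    let ?L = "nbrs (edges F) b - {z}"
    have leaf: "nbrs (edges F) l = {b}" if l: "l \<in> ?L" for l
    proof (cases "l \<in> set (a # b # zs)")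
      case True
      have e: "{b, l} \<in> edges F" using l by (simp add: nbrs_def)
      then have "card {b, l} = 2" using Fe by (auto simp: edges_on_def)
      then have "l \<noteq> b" by auto
      obtain j where j: "j < length (a # b # zs)" "(a # b # zs) ! j = l"
        using True by (metis in_set_conv_nth)
      have "j \<noteq> 1" using j(2) \<open>l \<noteq> b\<close> by (metis One_nat_def nth_Cons_0 nth_Cons_Suc)
      moreover have "l \<noteq> z" using l by simp
      then have "j \<noteq> 2" using j(2) Cons by (metis numeral_2_eq_2 nth_Cons_0 nth_Cons_Suc)
      moreover have "\<not> 3 \<le> j" using forest_path_no_chord[OF FF path sub, of 1 j] j e by auto
      ultimately have "j = 0" by linarith
      then show ?thesis using j(2) na by simp
    qed (use out l in auto)
    have eq: "nbrs (edges F) b = insert z ?L" using zb by auto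
    have ne: "?L \<noteq> {}" using ab az by auto
    have "b \<in> verts F" using sub by simp
    then show ?thesis
      by (intro exI[of _ b] exI[of _ z] exI[of _ ?L] conjI ballI eq ne leaf) simp_all
  qed
qed

section \<open>Embedding balanced trees\<close>

lemma injection_exists:
  assumes "finite A" "finite B" "card A \<le> card B"
  shows "\<exists>h::nat \<Rightarrow> nat. inj_on h A \<and> h ` A \<subseteq> B"
  using card_le_inj[OF assms] by blast

text \<open>Removal of the leaf \<open>l\<close> leaves \<open>p - 1\<close> vertices in its class, which fit into \<open>S\<close>. So a single edge
  from \<open>A\<close> to a vertex outside \<open>S\<close>, in any colour, completes a rainbow copy: it hosts the edge
  between \<open>l\<close> and its neighbour.\<close>

lemma rainbow_map_leaf_extension:
  assumes F: "simple_graph F" and XY: "two_coloring F X Y" "card X = p" "card Y = p"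
    and l: "l \<in> Y" "y \<in> X" "nbrs (edges F) l = {y}"
    and T: "finite T" and S: "finite S" "card S = p - 1"
    and A: "finite A" "A \<inter> S = {}" "2 * p \<le> card A"
    and full: "\<forall>a\<in>A. \<forall>x\<in>S. card (edges F) \<le> card (colours_of T E {a, x})"
    and av: "a \<in> A" "v \<notin> S" "a \<noteq> v" "i \<in> T" "{a, v} \<in> E i"
  shows "\<exists>f. inj_on f (verts F) \<and> f ` verts F \<subseteq> insert v (S \<union> A) \<and> rainbow_map T E (edges F) f"
proof -
  have VXY: "verts F = X \<union> Y" "X \<inter> Y = {}" using XY(1) by (auto simp: two_coloring_def)
  have fF: "finite (verts F)" "finite (edges F)"
    using F finite_edges_on[of "verts F" "edges F"] by (auto simp: simple_graph_edges_on)
  then have fXY: "finite X" "finite Y" using VXY by auto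
  have p: "p > 0" using l(2) XY(2) fXY card_gt_0_iff by blast
  have "card (Y - {l}) \<le> card S" using XY(3) S(2) l(1) by simp
  then obtain g where g: "inj_on g (Y - {l})" "g ` (Y - {l}) \<subseteq> S"
    using injection_exists[of "Y - {l}" S] fXY S(1) by auto
  have "card A - card {a, v} \<le> card (A - {a, v})" by (rule diff_card_le_card_Diff) simp
  moreover have "card {a, v} = 2" using av(3) by simp
  ultimately have "card (X - {y}) \<le> card (A - {a, v})" using XY(2) l(2) A(3) p by simp
  then obtain h where h: "inj_on h (X - {y})" "h ` (X - {y}) \<subseteq> A - {a, v}"
    using injection_exists[of "X - {y}" "A - {a, v}"] fXY A(1) by auto
  define f where "f w = (if w = l then v else if w = y then a else if w \<in> Y then g w else h w)" for w
  have ly: "l \<noteq> y" using l VXY(2) by auto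
  have fl: "f l = v" and fy: "f y = a" using ly by (auto simp: f_def)
  have fY: "f w = g w \<and> g w \<in> S" if "w \<in> Y - {l}" for w
    using that g(2) l(2) VXY(2) by (auto simp: f_def)
  have fX: "f w = h w \<and> h w \<in> A - {a, v}" if "w \<in> X - {y}" for w
  proof -
    have "w \<noteq> l" "w \<notin> Y" using that l(1) VXY(2) by auto
    then show ?thesis using that h(2) by (auto simp: f_def)
  qed
  have iY: "inj_on f (Y - {l})" using g(1) fY by (simp add: inj_on_def)
  have iX: "inj_on f (X - {y})" using h(1) fX by (simp add: inj_on_def)
  have imY: "f ` (Y - {l}) \<subseteq> S" using fY by auto
  have imX: "f ` (X - {y}) \<subseteq> A - {a, v}" using fX by auto
  have "inj_on f ((Y - {l}) \<union> (X - {y}))"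
    unfolding inj_on_Un using iX iY imX imY A(2) by blast
  moreover have "a \<notin> f ` ((Y - {l}) \<union> (X - {y}))" "v \<notin> f ` ((Y - {l}) \<union> (X - {y}))"
    using imX imY A(2) av(1,2) by (auto simp: image_Un)
  moreover have V: "verts F = insert l (insert y ((Y - {l}) \<union> (X - {y})))"
    using VXY(1) l by auto
  ultimately have inj: "inj_on f (verts F)"
    using fl fy av(3) ly unfolding V inj_on_insert by auto
  have im: "f ` verts F \<subseteq> insert v (S \<union> A)"
    unfolding V using imX imY fl fy av(1) by auto
  have "rainbow_map T E (edges F) f"
  proof (rule rainbow_map_extend[OF T fF(2)])
    have "{y, l} \<in> edges F" using l(3) by (auto simp: nbrs_def insert_commute)
    then show "{{y, l}} \<subseteq> edges F" by simp
    show "inj_on (\<lambda>_. i) {{y, l}}" by simp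
    show "\<forall>e\<in>{{y, l}}. i \<in> T \<and> f ` e \<in> E i" using av fl fy by simp
    show "\<forall>e\<in>edges F - {{y, l}}. card (edges F) \<le> card (colours_of T E (f ` e))"
    proof
      fix e assume e: "e \<in> edges F - {{y, l}}"
      then have "e \<in> edges F" by simp
      then obtain b c where bc: "e = {b, c}" "b \<in> X" "c \<in> Y"
        by (rule two_coloring_edge[OF F XY(1)])
      have "c \<noteq> l"
      proof
        assume "c = l"
        then have "b \<in> nbrs (edges F) l" using e bc by (simp add: nbrs_def insert_commute)
        then show False using l(3) e bc \<open>c = l\<close> by simp
      qed
      then have "f c \<in> S" using fY bc(3) by auto
      moreover have "f b \<in> A" using fX[of b] fy av(1) bc(2) by (cases "b = y") auto
      ultimately show "card (edges F) \<le> card (colours_of T E (f ` e))" using full bc(1) by simp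
    qed
  qed
  then show ?thesis using inj im by blast
qed

text \<open>Since \<open>S1\<close> has to contain \<open>x\<close>, the freedom lies in the \<open>d - 1\<close> elements \<open>D\<close> of \<open>S\<close> that are left
  out. They are taken from \<open>N\<close> as far as possible. Then either all of them are in \<open>N\<close>, together
  with an element of \<open>N\<close> outside \<open>S\<close>, or \<open>S1\<close> meets \<open>N\<close> in \<open>x\<close> only.\<close>

lemma reserve_neighbours:
  assumes S: "finite S" "card S = p - 1" and N: "finite N" "p \<le> card N"
    and x: "x \<in> S" "x \<in> N" and d: "0 < d" "d < p"
  shows "\<exists>S1\<subseteq>S. x \<in> S1 \<and> card S1 = p - d \<and> d \<le> card (N - S1)"
proof -
  let ?M = "N \<inter> S - {x}"
  have cSx: "card (S - {x}) = p - 2" using S x(1) by simp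
  have "\<exists>D\<subseteq>S - {x}. card D = d - 1 \<and> (D \<subseteq> N \<or> ?M \<subseteq> D)"
  proof (cases "d - 1 \<le> card ?M")
    case True
    then obtain D where "D \<subseteq> ?M" "card D = d - 1" using obtain_subset_with_card_n by metis
    then show ?thesis by blast
  next
    case False
    have "\<exists>D. ?M \<subseteq> D \<and> D \<subseteq> S - {x} \<and> card D = d - 1"
      by (rule exists_subset_between) (use False cSx d S(1) in auto)
    then show ?thesis by blast
  qed
  then obtain D where D: "D \<subseteq> S - {x}" "card D = d - 1" "D \<subseteq> N \<or> ?M \<subseteq> D" by blast
  have fD: "finite D" using D(1) S(1) finite_subset by blast
  have "card (S - D) = p - d"
    using card_Diff_subset[OF fD, of S] D S(2) d by auto
  moreover have "d \<le> card (N - (S - D))"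
    using D(3)
  proof
    assume DN: "D \<subseteq> N"
    have "card S < card N" using S(2) N(2) d by simp
    then have "\<not> N \<subseteq> S" using card_mono[OF S(1), of N] by auto
    then obtain w where w: "w \<in> N" "w \<notin> S" by blast
    then have "card (insert w D) = d" using D(1,2) fD d by (subst card_insert_disjoint) auto
    moreover have "insert w D \<subseteq> N - (S - D)" using w DN by auto
    ultimately show ?thesis using card_mono[of "N - (S - D)" "insert w D"] N(1) by simp
  next
    assume "?M \<subseteq> D"
    then have "N - {x} \<subseteq> N - (S - D)" by auto
    then have "card (N - {x}) \<le> card (N - (S - D))" using N(1) by (intro card_mono) auto
    moreover have "card (N - {x}) = card N - 1" using x(2) N(1) by simp
    ultimately show ?thesis using N(2) d by linarith
  qed
  ultimately show ?thesis using D(1) x(1) by (intro exI[of _ "S - D"]) auto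
qed

text \<open>The vertex \<open>y\<close>, whose neighbours are leaves with the exception of \<open>z\<close>, goes to \<open>v\<close>, and \<open>z\<close> to the
  neighbour \<open>x\<close> of \<open>v\<close> in \<open>S\<close>. The set \<open>S1\<close> hosts the class of \<open>z\<close> without the leaves at \<open>y\<close>, and the
  other class without \<open>y\<close> goes to \<open>A\<close>. The \<open>d\<close> leaves at \<open>y\<close> need further neighbours of \<open>v\<close>; they may
  lie in \<open>S\<close> as well, and \<open>reserve_neighbours\<close> keeps enough of them free.\<close>

lemma embedding_at_high_degree:
  assumes F: "simple_graph F" and XY: "two_coloring F X Y" "card X = p" "card Y = p"
    and y: "y \<in> X" "nbrs (edges F) y = insert z L" "z \<notin> L" "L \<noteq> {}"
      "\<forall>l\<in>L. nbrs (edges F) l = {y}"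
    and R: "edges_on V R" "finite V" and S: "S \<subseteq> V" "card S = p - 1"
    and A: "A \<subseteq> V" "A \<inter> S = {}" "2 * p \<le> card A" and full: "\<forall>a\<in>A. \<forall>x\<in>S. {a, x} \<in> R"
    and v: "v \<in> V - S" "p \<le> card (nbrs R v)" and x: "x \<in> S" "{v, x} \<in> R"
  shows "\<exists>f. inj_on f (verts F) \<and> f ` verts F \<subseteq> V \<and> (\<forall>e\<in>edges F. f ` e \<in> R)"
proof -
  have VXY: "verts F = X \<union> Y" "X \<inter> Y = {}" using XY(1) by (auto simp: two_coloring_def)
  have fXY: "finite X" "finite Y" using VXY F by (auto simp: simple_graph_def)
  have fS: "finite S" and fA: "finite A" using S(1) A(1) R(2) finite_subset by auto
  let ?N = "nbrs R v"
  have NV: "?N \<subseteq> V" by (rule nbrs_subset[OF R(1)])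
  have fN: "finite ?N" using NV R(2) by (rule finite_subset)
  have vN: "v \<notin> ?N" using R(1) by (auto simp: nbrs_def edges_on_def)
  have xN: "x \<in> ?N" using x(2) by (simp add: nbrs_def)
  have zLY: "insert z L \<subseteq> Y"
  proof
    fix w assume "w \<in> insert z L"
    then have e: "{y, w} \<in> edges F" using y(2) by (auto simp: nbrs_def)
    then obtain b c where bc: "{y, w} = {b, c}" "b \<in> X" "c \<in> Y"
      by (rule two_coloring_edge[OF F XY(1)])
    then have "y \<noteq> c" using y(1) VXY(2) by auto
    then show "w \<in> Y" using bc by (auto simp: doubleton_eq_iff)
  qed
  have fL: "finite L" using finite_subset[OF zLY fXY(2)] by simp
  define d where "d = card L"
  have d0: "0 < d" using y(4) fL by (simp add: d_def card_gt_0_iff)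
  have "card (insert z L) \<le> card Y" by (rule card_mono[OF fXY(2) zLY])
  then have dp: "d < p" using y(3) fL XY(3) by (simp add: d_def)
  obtain S1 where S1: "S1 \<subseteq> S" "x \<in> S1" "card S1 = p - d" "d \<le> card (?N - S1)"
    using reserve_neighbours[OF fS S(2) fN v(2) x(1) xN d0 dp] by blast
  have fS1: "finite S1" using S1(1) fS by (rule finite_subset)
  obtain h1 where h1: "inj_on h1 L" "h1 ` L \<subseteq> ?N - S1"
    using injection_exists[OF fL, of "?N - S1"] fN S1(4) by (auto simp: d_def)
  let ?Y = "Y - insert z L" and ?X = "X - {y}" and ?A = "A - insert v (h1 ` L)"
  have "card ?Y = p - (d + 1)"
    using card_Diff_subset[OF _ zLY] fL y(3) XY(3) by (simp add: d_def)
  moreover have "card (S1 - {x}) = p - d - 1" using S1(2,3) by simp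
  ultimately obtain h2 where h2: "inj_on h2 ?Y" "h2 ` ?Y \<subseteq> S1 - {x}"
    using injection_exists[of ?Y "S1 - {x}"] fXY(2) fS1 by auto
  have "card (insert v (h1 ` L)) \<le> d + 1"
    using card_insert_le_m1[of "d + 1" "h1 ` L" v] card_image_le[OF fL, of h1] by (simp add: d_def)
  moreover have "card A - card (insert v (h1 ` L)) \<le> card ?A"
    by (rule diff_card_le_card_Diff) (use fL in auto)
  moreover have "card ?X = p - 1" using XY(2) y(1) by simp
  ultimately have "card ?X \<le> card ?A" using A(3) dp by linarith
  then obtain h3 where h3: "inj_on h3 ?X" "h3 ` ?X \<subseteq> ?A"
    using injection_exists[of ?X ?A] fXY(1) fA by auto
  define f where "f w = (if w = y then v else if w = z then x else if w \<in> L then h1 w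
      else if w \<in> Y then h2 w else h3 w)" for w
  have yY: "y \<notin> Y" using y(1) VXY(2) by auto
  have fy: "f y = v" by (simp add: f_def)
  have fz: "f z = x" using zLY yY by (auto simp: f_def)
  have f1: "f w = h1 w" if "w \<in> L" for w using that zLY yY y(3) by (auto simp: f_def)
  have f2: "f w = h2 w" if "w \<in> ?Y" for w using that yY by (auto simp: f_def)
  have f3: "f w = h3 w" if "w \<in> ?X" for w
  proof -
    have "w \<notin> Y" using that VXY(2) by auto
    then show ?thesis using that zLY by (auto simp: f_def)
  qed
  have im1: "f ` L \<subseteq> ?N - S1" using h1(2) f1 by auto
  have im2: "f ` ?Y \<subseteq> S1 - {x}" using h2(2) f2 by auto
  have im3: "f ` ?X \<subseteq> A - insert v (f ` L)"
  proof -
    have "f ` L = h1 ` L" using f1 by auto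
    then show ?thesis using h3(2) f3 by auto
  qed
  have i1: "inj_on f L" using h1(1) f1 by (simp add: inj_on_def)
  have i2: "inj_on f ?Y" using h2(1) f2 by (simp add: inj_on_def)
  have i3: "inj_on f ?X" using h3(1) f3 by (simp add: inj_on_def)
  have d12: "f ` L \<inter> f ` ?Y = {}" using im1 im2 by blast
  have i12: "inj_on f (L \<union> ?Y)" unfolding inj_on_Un using i1 i2 d12 by blast
  have d123: "f ` (L \<union> ?Y) \<inter> f ` ?X = {}"
  proof -
    have "f ` ?Y \<inter> f ` ?X = {}" using im2 im3 S1(1) A(2) by blast
    moreover have "f ` L \<inter> f ` ?X = {}" using im3 by blast
    ultimately show ?thesis by (simp add: image_Un Int_Un_distrib2)
  qed
  have i123: "inj_on f (L \<union> ?Y \<union> ?X)" unfolding inj_on_Un[of f "L \<union> ?Y"] using i12 i3 d123 by blast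
  have ximg: "x \<notin> f ` (L \<union> ?Y \<union> ?X)"
  proof -
    have "x \<notin> f ` L" using im1 S1(2) by blast
    moreover have "x \<notin> f ` ?Y" using im2 by blast
    moreover have "x \<notin> f ` ?X" using im3 A(2) x(1) by blast
    ultimately show ?thesis by (simp add: image_Un)
  qed
  have vimg: "v \<notin> f ` (L \<union> ?Y \<union> ?X)"
  proof -
    have "v \<notin> f ` L" using im1 vN by blast
    moreover have "v \<notin> f ` ?Y" using im2 S1(1) v(1) by blast
    moreover have "v \<notin> f ` ?X" using im3 by blast
    ultimately show ?thesis by (simp add: image_Un)
  qed
  have V: "verts F = insert y (insert z (L \<union> ?Y \<union> ?X))" using VXY(1) zLY y(1) by auto
  have vx: "v \<noteq> x" using v(1) x(1) by auto
  have "inj_on f (insert z (L \<union> ?Y \<union> ?X))"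
    unfolding inj_on_insert fz using i123 ximg by blast
  moreover have "v \<notin> f ` insert z (L \<union> ?Y \<union> ?X)" using vimg vx fz by simp
  ultimately have inj: "inj_on f (verts F)"
    unfolding V inj_on_insert[of f y] fy by blast
  have "f ` L \<subseteq> V" by (rule order_trans[OF im1]) (use NV in auto)
  moreover have "f ` ?Y \<subseteq> V" by (rule order_trans[OF im2]) (use S1(1) S(1) in auto)
  moreover have "f ` ?X \<subseteq> V" by (rule order_trans[OF im3]) (use A(1) in auto)
  moreover have "x \<in> V" "v \<in> V" using x(1) S(1) v(1) by auto
  ultimately have im: "f ` verts F \<subseteq> V" unfolding V by (simp add: image_Un fy fz)
  have "f ` e \<in> R" if e: "e \<in> edges F" for e
  proof -
    obtain b c where bc: "e = {b, c}" "b \<in> X" "c \<in> Y" by (rule two_coloring_edge[OF F XY(1) e])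
    show ?thesis
    proof (cases "c \<in> L")
      case True
      then have "b \<in> nbrs (edges F) c" using e bc by (simp add: nbrs_def insert_commute)
      then have "b = y" using y(5) True by auto
      moreover have "f c \<in> ?N" using im1 True by auto
      ultimately show ?thesis using bc(1) fy by (simp add: nbrs_def)
    next
      case cL: False
      show ?thesis
      proof (cases "b = y")
        case True
        then have "c \<in> nbrs (edges F) y" using e bc by (simp add: nbrs_def)
        then have "c = z" using y(2) cL by auto
        then show ?thesis using bc(1) True fy fz x(2) by simp
      next
        case False
        then have "f b \<in> A" using im3 bc(2) by auto
        moreover have "f c \<in> S"
        proof (cases "c = z")
          case False
          then have "c \<in> ?Y" using cL bc(3) by auto
          then show ?thesis using im2 S1(1) by blast
        qed (use fz x(1) in simp)
        ultimately show ?thesis using full bc(1) by simp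
      qed
    qed
  qed
  then show ?thesis using inj im by blast
qed

lemma ex_upper:
  assumes G: "simple_graph G" "card (verts G) = n" "\<not> contains_copy G F"
  shows "card (edges G) \<le> ex n F"
  unfolding ex_def
proof (rule Greatest_le_nat[where b = "2 ^ n"])
  show "\<exists>H. simple_graph H \<and> card (verts H) = n \<and> \<not> contains_copy H F \<and> card (edges H) = card (edges G)"
    using G by blast
  show "k \<le> 2 ^ n" if "\<exists>H. simple_graph H \<and> card (verts H) = n \<and> \<not> contains_copy H F \<and> card (edges H) = k" for k
    using that card_edges_on_le by (auto simp: simple_graph_edges_on)
qed

text \<open>A vertex outside \<open>S\<close> with a neighbour in \<open>S\<close> has degree at most \<open>p - 1\<close>, for otherwise \<open>F\<close> could be
  embedded by \<open>embedding_at_high_degree\<close>. The vertices without a neighbour in \<open>S\<close> span a graph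
  without a copy of \<open>F\<close>, which by assumption has at most \<open>p - 1\<close> times as many edges as vertices. So
  every vertex outside \<open>S\<close> accounts for at most \<open>p - 1\<close> edges.\<close>

lemma erdos_sos_bound:
  assumes F: "tree F" and XY: "two_coloring F X Y" "card X = p" "card Y = p" and ES: "Erdos_Sos F"
    and R: "edges_on V R" "finite V"
    and free: "\<And>f. inj_on f (verts F) \<Longrightarrow> f ` verts F \<subseteq> V \<Longrightarrow> \<exists>e\<in>edges F. f ` e \<notin> R"
    and S: "S \<subseteq> V" "card S = p - 1"
    and A: "A \<subseteq> V" "A \<inter> S = {}" "2 * p \<le> card A" and full: "\<forall>a\<in>A. \<forall>x\<in>S. {a, x} \<in> R"
  shows "card R \<le> (p - 1) * (card V - (p - 1)) + card {e \<in> R. e \<subseteq> S}"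
proof -
  have sF: "simple_graph F" using F by (simp add: tree_def)
  have VXY: "verts F = X \<union> Y" "X \<inter> Y = {}" using XY(1) by (auto simp: two_coloring_def)
  have fXY: "finite X" "finite Y" using VXY sF by (auto simp: simple_graph_def)
  have cF: "card (verts F) = 2 * p" using VXY fXY XY(2,3) by (simp add: card_Un_disjoint)
  have YX: "two_coloring F Y X" using XY(1) by (auto simp: two_coloring_def)
  have fS: "finite S" using S(1) R(2) by (rule finite_subset)
  define Q1 where "Q1 = {v \<in> V - S. nbrs R v \<inter> S \<noteq> {}}"
  define Q2 where "Q2 = V - S - Q1"
  have fQ: "finite Q1" "finite Q2" using R(2) by (auto simp: Q1_def Q2_def)
  have low: "card (nbrs R v) \<le> p - 1" if v: "v \<in> Q1" for v
  proof (rule ccontr)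
    assume "\<not> card (nbrs R v) \<le> p - 1"
    then have pv: "p \<le> card (nbrs R v)" by simp
    obtain x where x: "x \<in> S" "{v, x} \<in> R" using v by (auto simp: Q1_def nbrs_def)
    have "0 < card S" using x(1) fS card_gt_0_iff by blast
    then have "3 \<le> card (verts F)" using S(2) cF by simp
    then obtain y z L where y: "y \<in> verts F" "nbrs (edges F) y = insert z L" "z \<notin> L" "L \<noteq> {}"
        "\<forall>l\<in>L. nbrs (edges F) l = {y}"
      using tree_vertex_of_leaves[OF F] by blast
    have vV: "v \<in> V - S" using v by (simp add: Q1_def)
    have "\<exists>f. inj_on f (verts F) \<and> f ` verts F \<subseteq> V \<and> (\<forall>e\<in>edges F. f ` e \<in> R)"
    proof (cases "y \<in> X")
      case True
      show ?thesis
        by (rule embedding_at_high_degree[OF sF XY True y(2-5) R S A full vV pv x])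
    next
      case False
      then have "y \<in> Y" using y(1) VXY(1) by simp
      then show ?thesis
        by (intro embedding_at_high_degree[OF sF YX XY(3,2) _ y(2-5) R S A full vV pv x])
    qed
    then show False using free by blast
  qed
  let ?R1 = "{e \<in> R. e \<inter> Q1 \<noteq> {}}" and ?R2 = "{e \<in> R. e \<subseteq> Q2}" and ?RS = "{e \<in> R. e \<subseteq> S}"
  have R1: "card ?R1 \<le> card Q1 * (p - 1)"
  proof -
    have e1: "edges_on V ?R1" by (rule edges_on_subset[OF R(1)]) auto
    have "card ?R1 \<le> (\<Sum>v\<in>Q1. card (nbrs ?R1 v))"
      by (rule edges_covered_card_le[OF e1 R(2) fQ(1)]) auto
    also have "\<dots> \<le> (\<Sum>v\<in>Q1. p - 1)"
    proof (rule sum_mono)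
      fix v assume v: "v \<in> Q1"
      have "card (nbrs ?R1 v) \<le> card (nbrs R v)"
        by (rule card_mono) (use finite_subset[OF nbrs_subset[OF R(1)] R(2)] in \<open>auto simp: nbrs_def\<close>)
      then show "card (nbrs ?R1 v) \<le> p - 1" using low[OF v] by simp
    qed
    finally show ?thesis by simp
  qed
  have R2: "card ?R2 \<le> card Q2 * (p - 1)"
  proof -
    let ?G = "\<lparr>verts = Q2, edges = ?R2\<rparr>"
    have sG: "simple_graph ?G" using R(1) fQ(2) by (auto simp: simple_graph_def edges_on_def)
    have "\<not> contains_copy ?G F"
    proof
      assume "contains_copy ?G F"
      then obtain f where f: "inj_on f (verts F)" "f ` verts F \<subseteq> Q2" "\<forall>e\<in>edges F. f ` e \<in> ?R2"
        unfolding contains_copy_iff[OF sF] by auto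
      have "f ` verts F \<subseteq> V" using f(2) by (auto simp: Q2_def)
      from free[OF f(1) this] f(3) show False by blast
    qed
    then have "card ?R2 \<le> ex (card Q2) F" using ex_upper[OF sG] by simp
    then have "real (card ?R2) \<le> real (ex (card Q2) F)" by simp
    also have "\<dots> \<le> (real (2 * p) - 2) * real (card Q2) / 2"
      using ES unfolding Erdos_Sos_def cF by blast
    also have "\<dots> = real (card Q2) * (real p - 1)" by (simp add: field_simps)
    finally have r: "real (card ?R2) \<le> real (card Q2) * (real p - 1)" .
    show ?thesis
    proof (cases "p = 0")
      case True
      then have "real (card ?R2) \<le> - real (card Q2)" using r by simp
      then show ?thesis by simp
    next
      case False
      then have "real (card ?R2) \<le> real (card Q2 * (p - 1))" using r by (simp add: of_nat_diff)
      then show ?thesis by (simp only: of_nat_le_iff)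
    qed
  qed
  have "R \<subseteq> ?R1 \<union> (?R2 \<union> ?RS)"
  proof
    fix e assume e: "e \<in> R"
    then obtain a b where ab: "e = {a, b}" "a \<in> V" "b \<in> V" using edges_onE[OF R(1)] by metis
    have *: "u \<in> Q1" if "{u, w} = e" "u \<notin> S" "w \<in> S" for u w
    proof -
      have "w \<in> nbrs R u" using that(1) e by (simp add: nbrs_def)
      moreover have "u \<in> V" using that(1) e R(1) by (auto simp: edges_on_def)
      ultimately show ?thesis using that(2,3) by (auto simp: Q1_def)
    qed
    show "e \<in> ?R1 \<union> (?R2 \<union> ?RS)"
    proof (cases "e \<inter> Q1 = {}")
      case True
      then have "a \<notin> Q1" "b \<notin> Q1" using ab(1) by auto
      then have "a \<in> S \<longleftrightarrow> b \<in> S" using *[of a b] *[of b a] ab(1) by (auto simp: insert_commute)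
      then have "e \<subseteq> S \<or> e \<subseteq> Q2"
        using ab \<open>a \<notin> Q1\<close> \<open>b \<notin> Q1\<close> by (auto simp: Q2_def)
      then show ?thesis using e by auto
    qed (use e in auto)
  qed
  then have "card R \<le> card (?R1 \<union> (?R2 \<union> ?RS))"
    by (rule card_mono[rotated]) (use finite_edges_on[OF R] in auto)
  also have "\<dots> \<le> card ?R1 + card (?R2 \<union> ?RS)" by (rule card_Un_le)
  also have "card (?R2 \<union> ?RS) \<le> card ?R2 + card ?RS" by (rule card_Un_le)
  finally have "card R \<le> (card Q1 + card Q2) * (p - 1) + card ?RS"
    using R1 R2 by (simp add: add_mult_distrib)
  moreover have "card Q1 + card Q2 = card V - (p - 1)"
  proof -
    have "card (V - S) = card V - (p - 1)" using card_Diff_subset[OF fS S(1)] S(2) by simp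
    moreover have "V - S = Q1 \<union> Q2" "Q1 \<inter> Q2 = {}" by (auto simp: Q1_def Q2_def)
    ultimately show ?thesis using card_Un_disjoint[OF fQ] by simp
  qed
  ultimately show ?thesis by (simp add: mult.commute)
qed

section \<open>The exact value for balanced trees\<close>

lemma sum_card_eq_sum_colours:
  assumes "finite T" "finite Y" "\<forall>i\<in>T. E i \<subseteq> Y"
  shows "(\<Sum>i\<in>T. card (E i)) = (\<Sum>e\<in>Y. card (colours_of T E e))"
proof -
  have "card (E i) = (\<Sum>e\<in>Y. if e \<in> E i then 1 else 0)" if "i \<in> T" for i
  proof -
    have "Y \<inter> {e. e \<in> E i} = E i" using assms(3) that by auto
    then show ?thesis using assms(2) by (simp add: sum.If_cases)
  qed
  then have "(\<Sum>i\<in>T. card (E i)) = (\<Sum>i\<in>T. \<Sum>e\<in>Y. if e \<in> E i then 1 else 0)" by simp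
  also have "\<dots> = (\<Sum>e\<in>Y. \<Sum>i\<in>T. if e \<in> E i then 1 else 0)" by (rule sum.swap)
  also have "\<dots> = (\<Sum>e\<in>Y. card (colours_of T E e))"
    using assms(1) by (simp add: sum.If_cases colours_of_def Int_def conj_commute)
  finally show ?thesis .
qed

text \<open>If all edges with fewer than \<open>m\<close> colours lie in a bounded set \<open>K\<close>, then with many colours they
  contribute less than one edge to the average colour. Hence the graph of the edges with at least
  \<open>m\<close> colours has as many edges as the smallest colour class.\<close>

lemma many_robust_edges:
  fixes E :: "nat \<Rightarrow> nat set set"
  assumes T: "finite T" and Y: "finite Y" "\<forall>i\<in>T. E i \<subseteq> Y" and K: "finite K" "card K \<le> k"
    and weak: "\<forall>e\<in>Y. card (colours_of T E e) < m \<longrightarrow> e \<subseteq> K"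
    and \<mu>: "\<forall>i\<in>T. \<mu> \<le> card (E i)" and big: "m * 2 ^ k < card T"
  shows "\<mu> \<le> card {e \<in> Y. m \<le> card (colours_of T E e)}"
proof (rule ccontr)
  let ?R = "{e \<in> Y. m \<le> card (colours_of T E e)}" and ?N = "{e \<in> Y. card (colours_of T E e) < m}"
  assume "\<not> \<mu> \<le> card ?R"
  then have lt: "card ?R + 1 \<le> \<mu>" by simp
  have "(card ?R + 1) * card T \<le> \<mu> * card T" by (rule mult_le_mono1[OF lt])
  also have "\<dots> = (\<Sum>i\<in>T. \<mu>)" by simp
  also have "\<dots> \<le> (\<Sum>i\<in>T. card (E i))" by (intro sum_mono) (use \<mu> in auto)
  also have "\<dots> = (\<Sum>e\<in>Y. card (colours_of T E e))" by (rule sum_card_eq_sum_colours[OF T Y])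
  also have "\<dots> \<le> (\<Sum>e\<in>Y. (if e \<in> ?R then card T else 0) + (if e \<in> ?N then m else 0))"
    by (intro sum_mono) (use card_colours_of_le[OF T] in \<open>auto simp: not_le less_imp_le\<close>)
  also have "\<dots> = card ?R * card T + card ?N * m"
    using Y(1) by (simp add: sum.distrib sum.If_cases Int_def)
  also have "card ?N \<le> 2 ^ card K"
    using card_mono[of "Pow K" ?N] weak K(1) by (auto simp: card_Pow)
  also have "(2::nat) ^ card K \<le> 2 ^ k" using K(2) by (intro power_increasing) auto
  finally have "(card ?R + 1) * card T \<le> card ?R * card T + 2 ^ k * m" by simp
  then show False using big by (simp add: mult.commute)
qed

text \<open>Call an edge robust if it has at least \<open>m = card (edges F)\<close> colours in \<open>T\<close>. The graph \<open>R\<close> of robust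
  edges contains no copy of \<open>F\<close>, since such a copy could be coloured greedily, so
  \<open>erdos_sos_bound\<close> applies to \<open>R\<close> once \<open>R\<close> is shown to have as many edges as the smallest colour.
  To this end the vertices \<open>u\<close> outside \<open>W\<close> are classified by the set \<open>P u\<close> of their robust neighbours
  in \<open>W\<close>. If this class is large and \<open>P u\<close> has at least \<open>p - 1\<close> elements, then it has exactly \<open>p - 1\<close>
  and \<open>u\<close> has no other neighbours at all, by \<open>rainbow_map_leaf_extension\<close>. The small classes have
  boundedly many vertices altogether, and so have the large classes with \<open>card (P u) < p - 1\<close>, as
  each of their vertices loses at least half an edge per colour against the average \<open>p - 1\<close>. Consequently
  the edges that are not robust lie in a set \<open>K\<close> whose size does not depend on the number of
  colours, and \<open>many_robust_edges\<close> applies. Too many edges then lie inside \<open>P u\<close>, which yields \<open>F\<close>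
  minus an independent set there and finally \<open>F\<close>.\<close>

lemma balanced_tree_upper:
  assumes F: "tree F" and XY: "two_coloring F X Y" "card X = p" "card Y = p" and ES: "Erdos_Sos F"
    and p: "0 < p" and m: "m = card (edges F)"
    and C1: "C1 = 2 * s * (3 * s + 3) + 2 ^ s + (p - 1) * (p - 1)"
    and c2: "c2 = 2 ^ s * (2 * p)" and K0: "K0 = s + (2 * C1 + 2 * s * c2) + c2"
    and t: "2 * s + 2 * (s * m) + m * 2 ^ K0 < t"
    and att0: "attainable t (p - 1) (indep_deletions F) 0"
    and n: "K0 + p < n"
    and att: "attainable t n {F, matching_graph (s + 1)} e"
  shows "e \<le> int (p - 1) * (int n - int (p - 1)) + ex_rainbow t (p - 1) (indep_deletions F)"
proof (rule ccontr)
  let ?ex = "ex_rainbow t (p - 1) (indep_deletions F)"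
  assume contra: "\<not> ?thesis"
  have sF: "simple_graph F" using F by (simp add: tree_def)
  have t0: "t > 0" using t by simp
  have ex0: "0 \<le> ?ex" using ex_rainbow_greatest(2)[OF t0 att0 att0] .
  have VXY: "verts F = X \<union> Y" "X \<inter> Y = {}" using XY(1) by (auto simp: two_coloring_def)
  have fF: "finite (verts F)" "finite (edges F)"
    using sF finite_edges_on[of "verts F" "edges F"] by (auto simp: simple_graph_edges_on)
  have cF: "card (verts F) = 2 * p"
    using VXY fF(1) XY(2,3) by (simp add: card_Un_disjoint)
  have YX: "two_coloring F Y X" using XY(1) by (auto simp: two_coloring_def)
  have "2 \<le> card (verts F)" using cF p by simp
  then have ne: "edges F \<noteq> {}" using tree_has_edge[OF F] by auto
  then obtain l y where l: "l \<in> verts F" "nbrs (edges F) l = {y}"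
    using forest_leaf[OF tree_forest[OF F]] by blast
  then have ly: "{l, y} \<in> edges F" by (auto simp: nbrs_def)
  have m0: "0 < m" using ne fF(2) m by (simp add: card_gt_0_iff)
  obtain V G where G: "collection V t G" "card V = n"
      "rainbow_free V t G {F, matching_graph (s + 1)}"
      "\<forall>i\<in>{1..t}. e \<le> int (card (edges (G i)))"
    using att unfolding attainable_def by blast
  define E where "E i = edges (G i)" for i
  have V: "finite V" using G(1) by (simp add: collection_def)
  have E: "\<forall>i\<in>{1..t}. edges_on V (E i)"
    using G(1) by (auto simp: collection_def simple_graph_edges_on E_def)
  note free = rainbow_freeD[OF sF G(1,3), folded E_def]
  obtain T W where TW: "T \<subseteq> {1..t}" "W \<subseteq> V" "card W \<le> s" "t \<le> card T + 2 * s"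
      "\<forall>i\<in>T. \<not> flexible s (E i) \<and> high s (E i) \<subseteq> W"
    using common_high_vertices[OF V _ E, of s] free(2) by auto
  have fT: "finite T" using TW(1) finite_subset by blast
  have fW: "finite W" using TW(2) V by (rule finite_subset)
  have ET: "edges_on V (E i)" if "i \<in> T" for i using E TW(1) that by blast
  have freeT: "\<not> rainbow_map T E (edges F) f" if "inj_on f (verts F)" "f ` verts F \<subseteq> V" for f
    using free(1)[OF that] rainbow_map_mono[OF _ TW(1)] by blast
  define \<tau> where "\<tau> = card T"
  have \<tau>: "2 * (s * m) + m * 2 ^ K0 < \<tau>" using t TW(4) unfolding \<tau>_def by linarith
  define U where "U = V - W"
  have fU: "finite U" using V by (simp add: U_def)
  have cU: "card U \<le> n" using card_mono[OF V, of U] G(2) by (simp add: U_def)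
  have cVW: "n \<le> card U + s"
    using diff_card_le_card_Diff[OF fW, of V] G(2) TW(3) by (simp add: U_def)
  define \<mu> where "\<mu> = (p - 1) * (n - (p - 1)) + nat ?ex + 1"
  have \<mu>: "\<mu> \<le> card (E i)" if i: "i \<in> T" for i
  proof -
    have "e \<le> int (card (E i))" using G(4) i TW(1) unfolding E_def by blast
    moreover have n': "int n - int (p - 1) = int (n - (p - 1))"
      using n by (intro of_nat_diff[symmetric]) simp
    have "int \<mu> = int (p - 1) * (int n - int (p - 1)) + ?ex + 1"
      unfolding \<mu>_def n' using ex0 by simp
    ultimately have "int \<mu> \<le> int (card (E i))" using contra by linarith
    then show ?thesis by simp
  qed
  define r where "r e = card (colours_of T E e)" for e
  define P where "P u = {w \<in> W. m \<le> r {u, w}}" for u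
  have PW: "P u \<subseteq> W" "finite (P u)" for u using fW by (auto simp: P_def)
  define cls where "cls u = {u' \<in> U. P u' = P u}" for u
  have cls: "cls u \<subseteq> U" "finite (cls u)" for u using fU by (auto simp: cls_def)
  \<comment> \<open>For \<open>card (P u) = p - 1\<close> this says that \<open>u\<close> has no neighbours outside \<open>P u\<close>. For a larger \<open>P u\<close> it is
    contradictory, as \<open>S\<close> may be chosen to miss a robust neighbour.\<close>
  have closed: "v \<in> S"
    if u: "u \<in> U" "2 * p \<le> card (cls u)" and S: "S \<subseteq> P u" "card S = p - 1"
      and e: "i \<in> T" "{u, v} \<in> E i" for u S i v
  proof (rule ccontr)
    assume vS: "v \<notin> S"
    have "card {u, v} = 2" and vV: "v \<in> V" using ET[OF e(1)] e(2) by (auto simp: edges_on_def)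
    then have uv: "u \<noteq> v" by auto
    have fS: "finite S" using S(1) PW(2) finite_subset by blast
    have dis: "cls u \<inter> S = {}" using S(1) PW(1) cls(1) by (fastforce simp: U_def)
    have full: "\<forall>a\<in>cls u. \<forall>x\<in>S. card (edges F) \<le> card (colours_of T E {a, x})"
    proof (intro ballI)
      fix a x assume "a \<in> cls u" "x \<in> S"
      then have "x \<in> P a" using S(1) by (auto simp: cls_def)
      then show "card (edges F) \<le> card (colours_of T E {a, x})" by (simp add: P_def r_def m)
    qed
    have ucls: "u \<in> cls u" using u(1) by (simp add: cls_def)
    have "\<exists>f. inj_on f (verts F) \<and> f ` verts F \<subseteq> insert v (S \<union> cls u) \<and> rainbow_map T E (edges F) f"
    proof (cases "l \<in> Y")
      case True
      then have "y \<in> X" using two_coloring_edge[OF sF XY(1) ly] VXY(2)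
        by (metis disjoint_iff doubleton_eq_iff)
      then show ?thesis
        by (intro rainbow_map_leaf_extension[OF sF XY True _ l(2) fT fS S(2) cls(2) dis u(2) full
              ucls vS uv e])
    next
      case False
      then have lX: "l \<in> X" using l(1) VXY(1) by simp
      then have "y \<in> Y" using two_coloring_edge[OF sF XY(1) ly] VXY(2)
        by (metis disjoint_iff doubleton_eq_iff)
      then show ?thesis
        by (intro rainbow_map_leaf_extension[OF sF YX XY(3,2) lX _ l(2) fT fS S(2) cls(2) dis u(2) full
              ucls vS uv e])
    qed
    then obtain f where f: "inj_on f (verts F)" "f ` verts F \<subseteq> insert v (S \<union> cls u)"
        "rainbow_map T E (edges F) f" by blast
    have "insert v (S \<union> cls u) \<subseteq> V"
      using vV S(1) PW(1)[of u] TW(2) cls(1)[of u] by (auto simp: U_def)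
    then show False using freeT[OF f(1)] f(2,3) by blast
  qed
  define small where "small = {u \<in> U. card (cls u) < 2 * p}"
  define low where "low = {u \<in> U. 2 * p \<le> card (cls u) \<and> card (P u) < p - 1}"
  define U0 where "U0 = {u \<in> U. 2 * p \<le> card (cls u) \<and> p - 1 \<le> card (P u)}"
  have cP: "card (P u) = p - 1" if u: "u \<in> U0" for u
  proof (rule ccontr)
    assume "card (P u) \<noteq> p - 1"
    moreover have "p - 1 \<le> card (P u)" using u by (simp add: U0_def)
    ultimately have "p \<le> card (P u)" by linarith
    moreover obtain S where S: "S \<subseteq> P u" "card S = p - 1"
      using obtain_subset_with_card_n[of "p - 1" "P u"] u by (auto simp: U0_def)
    ultimately have "S \<noteq> P u" using p by auto
    then obtain w where w: "w \<in> P u" "w \<notin> S" using S(1) by blast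
    then have "0 < card (colours_of T E {u, w})" using m0 by (simp add: P_def r_def)
    then have "colours_of T E {u, w} \<noteq> {}" by auto
    then obtain i where "i \<in> T" "{u, w} \<in> E i" by (auto simp: colours_of_def)
    then show False using closed[OF _ _ S] u w(2) by (auto simp: U0_def)
  qed
  have U0_nbrs: "nbrs (E i) u \<subseteq> P u" if "u \<in> U0" "i \<in> T" for u i
    using closed[OF _ _ order_refl cP[OF that(1)]] that by (auto simp: U0_def nbrs_def)
  have csmall: "card small \<le> c2"
  proof (rule ccontr)
    assume "\<not> card small \<le> c2"
    then have "2 ^ s * (2 * p) < card small" using c2 by simp
    moreover have "card (Pow W) \<le> 2 ^ s"
      unfolding card_Pow[OF fW] by (intro power_increasing TW(3)) simp
    ultimately have "card (Pow W) * (2 * p) < card small"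
      using mult_le_mono1 le_less_trans by blast
    moreover have "finite small" using fU by (simp add: small_def)
    moreover have "P ` small \<subseteq> Pow W" "finite (Pow W)" using PW(1) fW by auto
    ultimately obtain Q where Q: "2 * p < card {u \<in> small. P u = Q}"
      using pigeonhole_fibre[of small "Pow W" P "2 * p"] by blast
    then have "{u \<in> small. P u = Q} \<noteq> {}" by (metis card.empty not_less_zero)
    then obtain u where u: "u \<in> small" "P u = Q" by blast
    have "{u \<in> small. P u = Q} \<subseteq> cls u" using u(2) by (auto simp: small_def cls_def)
    then have "2 * p < card (cls u)" by (rule less_le_trans[OF Q card_mono[OF cls(2)]])
    then show False using u(1) by (simp add: small_def)
  qed
  \<comment> \<open>The factor 2 avoids fractions: a vertex of \<open>low\<close> has at least half an edge per colour less than
    \<open>p - 1\<close>, since the edges that are not robust contribute at most \<open>s * m \<le> \<tau> / 2\<close>.\<close>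
  have per: "2 * (\<Sum>w\<in>W. r {u, w}) + (if u \<in> low then \<tau> else 0) \<le>
      2 * ((p - 1) * \<tau>) + (if u \<in> small then 2 * (s * \<tau>) else 0)" if u: "u \<in> U" for u
  proof -
    have rle: "r e \<le> \<tau>" for e unfolding r_def \<tau>_def by (rule card_colours_of_le[OF fT])
    consider "u \<in> U0" "u \<notin> low" | "u \<in> low" "u \<notin> small" | "u \<in> small" "u \<notin> low"
      using u unfolding U0_def low_def small_def mem_Collect_eq by linarith
    then show ?thesis
    proof cases
      case 1
      have "r {u, w} = 0" if "w \<in> W - P u" for w
      proof -
        have "colours_of T E {u, w} = {}"
          using U0_nbrs[OF 1(1)] that by (fastforce simp: colours_of_def nbrs_def)
        then show ?thesis by (simp add: r_def)
      qed
      then have "(\<Sum>w\<in>W. r {u, w}) = (\<Sum>w\<in>P u. r {u, w})"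
        by (intro sum.mono_neutral_right fW PW(1)) auto
      also have "\<dots> \<le> (\<Sum>w\<in>P u. \<tau>)" by (intro sum_mono rle)
      also have "\<dots> = (p - 1) * \<tau>" using cP[OF 1(1)] by simp
      finally show ?thesis using 1(2) by simp
    next
      case 2
      have "(\<Sum>w\<in>W. r {u, w}) \<le> (\<Sum>w\<in>W. (if w \<in> P u then \<tau> else 0) + m)"
        by (intro sum_mono) (use rle in \<open>auto simp: P_def not_le intro: trans_le_add1\<close>)
      also have "\<dots> = card (P u) * \<tau> + card W * m"
      proof -
        have "W \<inter> {w. w \<in> P u} = P u" using PW(1) by auto
        then show ?thesis using fW by (simp add: sum.distrib sum.If_cases)
      qed
      also have "\<dots> \<le> card (P u) * \<tau> + s * m" using TW(3) by simp
      finally have "2 * (\<Sum>w\<in>W. r {u, w}) + \<tau> \<le> 2 * (card (P u) * \<tau>) + 2 * \<tau>"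
        using \<tau> by linarith
      also have "\<dots> = 2 * ((card (P u) + 1) * \<tau>)" by simp
      also have "\<dots> \<le> 2 * ((p - 1) * \<tau>)"
        using 2(1) by (intro mult_le_mono2 mult_le_mono1) (auto simp: low_def)
      finally show ?thesis using 2 by simp
    next
      case 3
      have "(\<Sum>w\<in>W. r {u, w}) \<le> (\<Sum>w\<in>W. \<tau>)" by (intro sum_mono rle)
      also have "\<dots> \<le> s * \<tau>" using mult_le_mono1[OF TW(3)] by simp
      finally show ?thesis using 3 by simp
    qed
  qed
  have clow: "card low \<le> 2 * C1 + 2 * s * c2"
  proof -
    have Ui: "(p - 1) * n \<le> (\<Sum>u\<in>U. card (nbrs (E i) u \<inter> W)) + C1" if i: "i \<in> T" for i
    proof -
      have "card (E i) \<le> card {e \<in> E i. e \<inter> W = {}} + card {e \<in> E i. e \<subseteq> W} +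
          (\<Sum>u\<in>U. card (nbrs (E i) u \<inter> W))"
        unfolding U_def by (rule card_edges_split[OF ET[OF i] V])
      moreover have "card {e \<in> E i. e \<inter> W = {}} \<le> 2 * s * (3 * s + 3)"
        by (rule nonflexible_few_edges_avoid_high[OF ET[OF i] V]) (use TW(5) i in auto)
      moreover have "card {e \<in> E i. e \<subseteq> W} \<le> 2 ^ s"
        by (rule order_trans[OF card_edges_inside_le[OF fW] power_increasing[OF TW(3)]]) simp
      moreover have "(p - 1) * n \<le> \<mu> + (p - 1) * (p - 1)"
      proof -
        have "(p - 1) * n = (p - 1) * (n - (p - 1)) + (p - 1) * (p - 1)"
          using n by (simp add: add_mult_distrib2[symmetric])
        then show ?thesis by (simp add: \<mu>_def)
      qed
      ultimately show ?thesis using \<mu>[OF i] C1 by linarith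
    qed
    have "(\<Sum>i\<in>T. (p - 1) * n) \<le> (\<Sum>i\<in>T. (\<Sum>u\<in>U. card (nbrs (E i) u \<inter> W)) + C1)"
      by (intro sum_mono Ui)
    also have "\<dots> = (\<Sum>u\<in>U. \<Sum>i\<in>T. card (nbrs (E i) u \<inter> W)) + \<tau> * C1"
      by (simp add: sum.distrib \<tau>_def) (rule sum.swap)
    also have "\<dots> = (\<Sum>u\<in>U. \<Sum>w\<in>W. r {u, w}) + \<tau> * C1"
      by (simp add: sum_card_nbrs_eq[OF fT fW] r_def)
    finally have lower: "\<tau> * ((p - 1) * n) \<le> (\<Sum>u\<in>U. \<Sum>w\<in>W. r {u, w}) + \<tau> * C1"
      by (simp add: \<tau>_def)
    have "(\<Sum>u\<in>U. 2 * (\<Sum>w\<in>W. r {u, w}) + (if u \<in> low then \<tau> else 0)) \<le>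
        (\<Sum>u\<in>U. 2 * ((p - 1) * \<tau>) + (if u \<in> small then 2 * (s * \<tau>) else 0))"
      by (intro sum_mono per)
    moreover have "U \<inter> {u. u \<in> low} = low" "U \<inter> {u. u \<in> small} = small"
      by (auto simp: low_def small_def)
    ultimately have "2 * (\<Sum>u\<in>U. \<Sum>w\<in>W. r {u, w}) + card low * \<tau> \<le>
        card U * (2 * ((p - 1) * \<tau>)) + card small * (2 * (s * \<tau>))"
      using fU by (simp add: sum.distrib sum.If_cases sum_distrib_left)
    also have "\<dots> \<le> n * (2 * ((p - 1) * \<tau>)) + c2 * (2 * (s * \<tau>))"
      by (intro add_mono mult_le_mono1 cU csmall)
    finally have "card low * \<tau> \<le> \<tau> * (2 * C1 + 2 * s * c2)"
      using lower by (simp add: algebra_simps)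
    then show ?thesis using \<tau> by (simp add: mult.commute)
  qed
  define K where "K = W \<union> (low \<union> small)"
  have fK: "finite K" using fW fU by (simp add: K_def low_def small_def)
  have cK: "card K \<le> K0"
  proof -
    have "card K \<le> card W + card (low \<union> small)" unfolding K_def by (rule card_Un_le)
    also have "card (low \<union> small) \<le> card low + card small" by (rule card_Un_le)
    finally show ?thesis using TW(3) clow csmall K0 by linarith
  qed
  have KV: "V - U0 \<subseteq> K" by (auto simp: K_def U_def U0_def low_def small_def)
  have "U0 \<noteq> {}"
  proof
    assume "U0 = {}"
    then have "card V \<le> card K" using KV by (intro card_mono[OF fK]) auto
    then show False using cK n G(2) by simp
  qed
  then obtain u where u: "u \<in> U0" by blast
  let ?S = "P u" and ?A = "cls u"
  let ?Y = "\<Union>i\<in>T. E i"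
  define R where "R = {e \<in> ?Y. m \<le> r e}"
  have Yon: "edges_on V ?Y" using ET by (auto simp: edges_on_def)
  have Ron: "edges_on V R" by (rule edges_on_subset[OF Yon]) (auto simp: R_def)
  have Rr: "m \<le> r e" if "e \<in> R" for e using that by (simp add: R_def)
  have rR: "e \<in> R" if "m \<le> r e" for e
  proof -
    have "colours_of T E e \<noteq> {}" using that m0 by (auto simp: r_def)
    then show ?thesis using that by (auto simp: R_def colours_of_def)
  qed
  have weak: "e \<subseteq> K" if e: "e \<in> ?Y" "r e < m" for e
  proof (rule ccontr)
    assume "\<not> e \<subseteq> K"
    moreover have "e \<subseteq> V" using Yon e(1) by (auto simp: edges_on_def)
    ultimately obtain a where a: "a \<in> e" "a \<in> U0" using KV by blast
    obtain b c where "e = {b, c}" using edges_onE[OF Yon e(1)] by metis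
    then obtain d where d: "e = {a, d}" using a(1) by (auto simp: insert_commute)
    obtain i where i: "i \<in> T" "e \<in> E i" using e(1) by blast
    then have "d \<in> P a" using U0_nbrs[OF a(2) i(1)] d by (auto simp: nbrs_def)
    then show False using e(2) d by (simp add: P_def)
  qed
  have \<mu>R: "\<mu> \<le> card R"
    unfolding R_def r_def
    by (rule many_robust_edges[OF fT _ _ fK cK])
      (use weak \<mu> \<tau> finite_edges_on[OF Yon V] in \<open>auto simp: r_def \<tau>_def\<close>)
  have Rcopy: "rainbow_map T E X f" if "finite X" "card X \<le> m" "\<forall>e\<in>X. f ` e \<in> R" for X f
  proof (rule rainbow_map_extend[OF fT that(1), of "{}"])
    show "\<forall>e\<in>X - {}. card X \<le> card (colours_of T E (f ` e))"
      using that(2,3) Rr unfolding r_def by (meson DiffD1 order_trans)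
  qed auto
  have Rfree: "\<exists>e\<in>edges F. f ` e \<notin> R" if "inj_on f (verts F)" "f ` verts F \<subseteq> V" for f
    using freeT[OF that] Rcopy[OF fF(2)] m by blast
  have SV: "?S \<subseteq> V" using PW(1) TW(2) by blast
  have AV: "?A \<subseteq> V" using cls(1) by (auto simp: U_def)
  have AS: "?A \<inter> ?S = {}" using cls(1)[of u] PW(1)[of u] by (auto simp: U_def)
  have cA: "2 * p \<le> card ?A" using u by (simp add: U0_def)
  have robust: "m \<le> r {a, x}" if "a \<in> ?A" "x \<in> ?S" for a x
  proof -
    have "x \<in> P a" using that by (simp add: cls_def)
    then show ?thesis by (simp add: P_def)
  qed
  have "card R \<le> (p - 1) * (card V - (p - 1)) + card {e \<in> R. e \<subseteq> ?S}"
    by (rule erdos_sos_bound[OF F XY ES Ron V Rfree SV cP[OF u] AV AS cA]) (use robust rR in auto)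
  then have "nat ?ex + 1 \<le> card {e \<in> R. e \<subseteq> ?S}" using \<mu>R G(2) unfolding \<mu>_def by simp
  then have exS: "?ex + 1 \<le> int (card {e \<in> R. e \<subseteq> ?S})" using ex0 by linarith
  let ?G = "\<lambda>i::nat. \<lparr>verts = ?S, edges = {e \<in> R. e \<subseteq> ?S}\<rparr>"
  have col: "collection ?S t ?G"
    using Ron PW(2) by (auto simp: collection_def simple_graph_def edges_on_def)
  have "\<not> rainbow_free ?S t ?G (indep_deletions F)"
    by (rule attainable_above_ex[OF t0 att0 _ col cP[OF u], of "?ex + 1"]) (use exS in auto)
  then obtain S' f where f: "covering F S'" "inj_on f S'" "f ` S' \<subseteq> ?S"
      "rainbow_map {1..t} (\<lambda>i. {e \<in> R. e \<subseteq> ?S}) (edges (induced F S')) f"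
    unfolding rainbow_free_indep_deletions_iff[OF sF col] by auto
  have "\<forall>e\<in>edges (induced F S'). f ` e \<in> R" using f(4) unfolding rainbow_map_def by blast
  moreover have "edges (induced F S') \<subseteq> edges F" by (auto simp: induced_def)
  ultimately have fmap: "rainbow_map T E (edges (induced F S')) f"
    using Rcopy finite_subset[OF _ fF(2)] card_mono[OF fF(2)] m by blast
  have "\<exists>g. inj_on g (verts F) \<and> g ` verts F \<subseteq> ?S \<union> ?A \<and> rainbow_map T E (edges F) g"
    by (rule rainbow_map_from_cover[OF sF f(1-3) fmap fT cls(2) AS])
      (use cA cF robust in \<open>auto simp: r_def m\<close>)
  then obtain g where g: "inj_on g (verts F)" "g ` verts F \<subseteq> ?S \<union> ?A"
      "rainbow_map T E (edges F) g" by blast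
  have "g ` verts F \<subseteq> V" using g(2) SV AV by blast
  from freeT[OF g(1) this] g(3) show False by blast
qed

lemma balanced_tree_exact:
  assumes F: "tree F" and p: "p = min_class F" "card (verts F) = 2 * p" "p \<le> s" and ES: "Erdos_Sos F"
  shows "\<forall>\<^sub>F t in sequentially. \<forall>\<^sub>F n in sequentially.
    ex_rainbow t n {F, matching_graph (s + 1)} =
      (int p - 1) * (int n - int p + 1) + ex_rainbow t (p - 1) (cover_family F (p - 1))"
proof -
  have sF: "simple_graph F" using F by (simp add: tree_def)
  have "verts F \<noteq> {}" using F by (simp add: tree_def connected_graph_def)
  then have p0: "0 < p" using p(2) sF by (auto simp: simple_graph_def card_gt_0_iff)
  have bip: "bipartite F" by (rule forest_bipartite[OF tree_forest[OF F]])
  obtain X Y where XY: "two_coloring F X Y" "card X = p" using min_class_coloring[OF bip] p(1) by blast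
  have U: "X \<union> Y = verts F" "X \<inter> Y = {}" using XY(1) by (auto simp: two_coloring_def)
  then have "finite (X \<union> Y)" using sF by (simp add: simple_graph_def)
  then have "card (X \<union> Y) = card X + card Y" using card_Un_disjoint[of X Y] U(2) by simp
  then have cY: "card Y = p" using p(2) XY(2) U(1) by simp
  define C1 where "C1 = 2 * s * (3 * s + 3) + 2 ^ s + (p - 1) * (p - 1)"
  define c2 where "c2 = 2 ^ s * (2 * p)"
  define K0 where "K0 = s + (2 * C1 + 2 * s * c2) + c2"
  let ?t0 = "2 * s + 2 * (s * card (edges F)) + card (edges F) * 2 ^ K0 + 1"
  have "ex_rainbow t n {F, matching_graph (s + 1)} =
      (int p - 1) * (int n - int p + 1) + ex_rainbow t (p - 1) (cover_family F (p - 1))"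
    if t: "?t0 \<le> t" and n: "K0 + p + 1 \<le> n" for t n
  proof -
    have t0: "t > 0" using t by simp
    have "indep_cover_free F (p - 1)" by (rule indep_cover_free_min_class[OF sF]) (use p(1) p0 in simp)
    then have att0: "attainable t (p - 1) (indep_deletions F) 0"
      by (rule attainable_zero_indep_deletions[OF sF])
    have "ex_rainbow t n {F, matching_graph (s + 1)} =
        int (p - 1) * (int n - int (p - 1)) + ex_rainbow t (p - 1) (indep_deletions F)"
    proof (rule ex_rainbow_eqI)
      show "attainable t n {F, matching_graph (s + 1)}
          (int (p - 1) * (int n - int (p - 1)) + ex_rainbow t (p - 1) (indep_deletions F))"
        by (rule join_attainable[OF sF _ _ ex_rainbow_greatest(1)[OF t0 att0]]) (use n p(3) in auto)
      show "e \<le> int (p - 1) * (int n - int (p - 1)) + ex_rainbow t (p - 1) (indep_deletions F)"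
        if "attainable t n {F, matching_graph (s + 1)} e" for e
        by (rule balanced_tree_upper[OF F XY cY ES p0 refl C1_def c2_def K0_def _ att0 _ that])
          (use t n in auto)
    qed
    moreover have "int (p - 1) = int p - 1" using p0 by simp
    ultimately show ?thesis unfolding ex_rainbow_cover_family[OF sF] by (simp add: algebra_simps)
  qed
  then show ?thesis
    by (intro eventually_sequentiallyI[of ?t0] eventually_sequentiallyI[of "K0 + p + 1"])
qed

section \<open>The extremal numbers\<close>

theorem theorem1p1:
  fixes F :: graph and s :: nat
  assumes "simple_graph F" and "s > 0"
  shows
    "(\<forall>t. t \<ge> max (card (edges F)) (s + 1) \<longrightarrow> \<not> bipartite F \<longrightarrow>
       (\<forall>\<^sub>F n in sequentially.
          ex_rainbow t n {F, matching_graph (s + 1)} =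
            int s * (int n - int s) + ex_rainbow t s (indep_deletions F)))
     \<and>
     (\<forall>t. t \<ge> max (card (edges F)) (s + 1) \<longrightarrow> bipartite F \<longrightarrow> min_class F > s \<longrightarrow>
       (\<forall>\<^sub>F n in sequentially.
          ex_rainbow t n {F, matching_graph (s + 1)} =
            int s * (int n - int s) + ex_rainbow t s (cover_family F s)))
     \<and>
     (\<forall>p. bipartite F \<longrightarrow> edges F \<noteq> {} \<longrightarrow> p = min_class F \<longrightarrow> p \<le> s \<longrightarrow>
       (\<forall>\<^sub>F t in sequentially. t \<ge> max (card (edges F)) (s + 1) \<longrightarrow>
          (\<lambda>n. real_of_int (ex_rainbow t n {F, matching_graph (s + 1)})
                 - (real p - 1) * real n) \<in> O(\<lambda>n. 1)))
     \<and>
     (\<forall>p. tree F \<longrightarrow> p = min_class F \<longrightarrow> card (verts F) = 2 * p \<longrightarrow> Erdos_Sos F \<longrightarrow> p \<le> s \<longrightarrow>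
       (\<forall>\<^sub>F t in sequentially. t \<ge> max (card (edges F)) (s + 1) \<longrightarrow>
          (\<forall>\<^sub>F n in sequentially.
             ex_rainbow t n {F, matching_graph (s + 1)} =
               (int p - 1) * (int n - int p + 1)
                 + ex_rainbow t (p - 1) (cover_family F (p - 1)))))"
proof (intro conjI allI impI)
  let ?N = "\<lambda>t. s + t * 2 ^ s + card (verts F) + s * s + 2 * s * (3 * s + 3) + 1"
  fix t assume t: "max (card (edges F)) (s + 1) \<le> t"
  show "\<forall>\<^sub>F n in sequentially. ex_rainbow t n {F, matching_graph (s + 1)} =
      int s * (int n - int s) + ex_rainbow t s (indep_deletions F)" if "\<not> bipartite F"
    by (rule eventually_sequentiallyI[of "?N t"],
        rule ex_rainbow_eq_cover[OF assms t indep_cover_free_nonbipartite[OF assms(1) that]]) simp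
  show "\<forall>\<^sub>F n in sequentially. ex_rainbow t n {F, matching_graph (s + 1)} =
      int s * (int n - int s) + ex_rainbow t s (cover_family F s)" if "s < min_class F"
    unfolding ex_rainbow_cover_family[OF assms(1)]
    by (rule eventually_sequentiallyI[of "?N t"],
        rule ex_rainbow_eq_cover[OF assms t indep_cover_free_min_class[OF assms(1) that]]) simp
next
  fix p assume F: "bipartite F" "edges F \<noteq> {}" and p: "p = min_class F" "p \<le> s"
  show "\<forall>\<^sub>F t in sequentially. max (card (edges F)) (s + 1) \<le> t \<longrightarrow>
      (\<lambda>n. real_of_int (ex_rainbow t n {F, matching_graph (s + 1)}) - (real p - 1) * real n) \<in> O(\<lambda>n. 1)"
    by (rule eventually_sequentiallyI[of
          "2 * s + (card (verts F) * 2 ^ s + 1) + s * card (edges F) + 1"], rule impI,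
        rule bipartite_asymptotics[OF assms(1) F p]) simp
next
  fix p assume "tree F" "p = min_class F" "card (verts F) = 2 * p" "Erdos_Sos F" "p \<le> s"
  then show "\<forall>\<^sub>F t in sequentially. max (card (edges F)) (s + 1) \<le> t \<longrightarrow>
      (\<forall>\<^sub>F n in sequentially. ex_rainbow t n {F, matching_graph (s + 1)} =
        (int p - 1) * (int n - int p + 1) + ex_rainbow t (p - 1) (cover_family F (p - 1)))"
    by (intro eventually_mono[OF balanced_tree_exact]) auto
qed

end
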